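(* There exists $\tilde p<1$ such that, for every $p$ with $\tilde p\le p<1$, every $c\ge1$, every box $\Lambda$ satisfying $|\Lambda|\ge e^{2d^2c}$ and every time $t\in\mathbb N$ with $t\ge c|\Lambda|\ln|\Lambda|$, $$P_\mu\left(d_H^{\,2dc\ln|\Lambda|}\Big(\bigcup_{r\in[t-c|\Lambda|\ln|\Lambda|,\,t]}\mathcal P_r,\ \bigcup_{s\in[t,\,t+c|\Lambda|\ln|\Lambda|]}\mathcal P_s\Big)\ge 2dc\ln|\Lambda|\right)\le\frac1{|\Lambda|^{c-3}},$$ where $r$ and $s$ range over integer times.
   Context: Fix an integer $d\ge 2$. $\mathbb E^d$ is the set of pairs $\{x,y\}$ of points of $\mathbb Z^d$ at Euclidean distance $1$; an edge is identified with the corresponding closed unit segment. $\Lambda$ is a closed cubic box of positive side length in $\mathbb R^d$, centred at the origin, with sides parallel to the axes and corners in $\mathbb Z^d$; $|\Lambda|$ is the cardinality of $\Lambda\cap\mathbb Z^d$; $\Lambda^c=\mathbb R^d\setminus\Lambda$; $T$ and $B$ are the top and bottom sides (faces) of $\Lambda$. A configuration is a map $\omega$ from the set of edges included in $\Lambda$ to $\{0,1\}$; $e$ is open if $\omega(e)=1$, closed if $\omega(e)=0$. $T\overset{\omega}{\longleftrightarrow}B$ means that a path of open edges joins a vertex of $T$ to a vertex of $B$. $\omega^e$ is the configuration obtained from $\omega$ by opening $e$. Coupling. Let $0<p<1$. Let $(E_t)_{t\ge1}$ be i.i.d. uniform on the edges included in $\Lambda$ and $(B_t)_{t\ge1}$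 i.i.d. Bernoulli($p$), all independent of each other and of $(X_0,Y_0)$. For $t\ge1$: $X_t(e)=X_{t-1}(e)$ and $Y_t(e)=Y_{t-1}(e)$ for $e\ne E_t$; $X_t(E_t)=B_t$; $Y_t(E_t)=1$ if $B_t=1$ and $T$ is not connected to $B$ in $Y_{t-1}^{E_t}$, and $Y_t(E_t)=0$ otherwise. This Markov chain, on the set of pairs $(\omega_1,\omega_2)$ with $\omega_1\ge\omega_2$ edgewise and $T$ not connected to $B$ in $\omega_2$, has a unique equilibrium distribution $\mu_p$; $P_\mu$ is the law of $(X_t,Y_t)_{t\in\mathbb N}$ when $(X_0,Y_0)$ has law $\mu_p$. $\mathcal P_t=\{e\subset\Lambda:T\overset{Y_t^e}{\longleftrightarrow}B\}$ is the set of pivotal edges in $Y_t$. For $A\subset\mathbb R^d$ and $r\ge0$, $\mathcal V(A,r)=\{x\in\mathbb R^d:d(x,A)<r\}$, with $d(\cdot,\cdot)$ the Euclidean distance (and $d(x,\emptyset)=+\infty$). For $\ell\ge0$ and $A,B'\subset\Lambda$, $$d_H^\ell(A,B')=\inf\{r\ge0: A\setminus\mathcal V(\Lambda^c,\ell)\subset\mathcal V(B',r)\ \text{and}\ B'\setminus\mathcal V(\Lambda^c,\ell)\subset\mathcal V(A,r)\}$$ ($\inf\emptyset=+\infty$). Sets of edges are viewed as subsets of $\mathbb R^d$ (unions of segments); $d$ alone is the dimension. The constant $\tilde p$ depends only on $d$. *)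

theory Defs
  imports "HOL-Probability.Probability"
begin

definition int_lattice :: "(real ^ 'd) set" where
  "int_lattice = {x. \<forall>i. x $ i \<in> \<int>}"

definition lattice_edges :: "(real ^ 'd) set set" where
  "lattice_edges = {{x, y} | x y. x \<in> int_lattice \<and> y \<in> int_lattice \<and> dist x y = 1}"

text \<open>The closed unit segment of the edge \<open>{x, y}\<close> is \<open>convex hull {x, y}\<close>.\<close>

definition edges_in :: "(real ^ 'd) set \<Rightarrow> (real ^ 'd) set set" where
  "edges_in \<Lambda> = {e \<in> lattice_edges. convex hull e \<subseteq> \<Lambda>}"

definition edges_support :: "(real ^ 'd) set set \<Rightarrow> (real ^ 'd) set" where
  "edges_support F = (\<Union>e\<in>F. convex hull e)"

definition centred_box :: "(real ^ 'd) set \<Rightarrow> bool" where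
  "centred_box \<Lambda> \<longleftrightarrow>
     (\<exists>s>0. \<Lambda> = cbox (vec (- s / 2)) (vec (s / 2)) \<and>
            (\<forall>x::real ^ 'd. (\<forall>i. \<bar>x $ i\<bar> = s / 2) \<longrightarrow> x \<in> int_lattice))"

definition box_card :: "(real ^ 'd) set \<Rightarrow> nat" where
  "box_card \<Lambda> = card (\<Lambda> \<inter> int_lattice)"

text \<open>The index type \<open>'d\<close> has no preferred coordinate, so the vertical axis \<open>v\<close> is a parameter.\<close>

definition top_face :: "'d \<Rightarrow> (real ^ 'd) set \<Rightarrow> (real ^ 'd) set" where
  "top_face v \<Lambda> = {x \<in> \<Lambda>. \<forall>y\<in>\<Lambda>. y $ v \<le> x $ v}"

definition bottom_face :: "'d \<Rightarrow> (real ^ 'd) set \<Rightarrow> (real ^ 'd) set" where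
  "bottom_face v \<Lambda> = {x \<in> \<Lambda>. \<forall>y\<in>\<Lambda>. x $ v \<le> y $ v}"

text \<open>
  \<open>True\<close> means open. Configurations are extensional: they take the value
  \<open>undefined\<close> off \<open>edges_in \<Lambda>\<close>.
\<close>

type_synonym 'd config = "(real ^ 'd) set \<Rightarrow> bool"

definition configs :: "(real ^ 'd) set \<Rightarrow> 'd config set" where
  "configs \<Lambda> = (edges_in \<Lambda> \<rightarrow>\<^sub>E UNIV)"

definition open_adj :: "(real ^ 'd) set \<Rightarrow> 'd config \<Rightarrow> ((real ^ 'd) \<times> (real ^ 'd)) set" where
  "open_adj \<Lambda> \<eta> = {(x, y). {x, y} \<in> edges_in \<Lambda> \<and> \<eta> {x, y}}"

definition top_bottom_connected :: "'d \<Rightarrow> (real ^ 'd) set \<Rightarrow> 'd config \<Rightarrow> bool" where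
  "top_bottom_connected v \<Lambda> \<eta> \<longleftrightarrow>
     (\<exists>x \<in> top_face v \<Lambda> \<inter> int_lattice. \<exists>y \<in> bottom_face v \<Lambda> \<inter> int_lattice.
        (x, y) \<in> (open_adj \<Lambda> \<eta>)\<^sup>*)"

definition pivotal :: "'d \<Rightarrow> (real ^ 'd) set \<Rightarrow> 'd config \<Rightarrow> (real ^ 'd) set set" where
  "pivotal v \<Lambda> \<eta> = {e \<in> edges_in \<Lambda>. top_bottom_connected v \<Lambda> (\<eta>(e := True))}"

definition coupled_states :: "'d \<Rightarrow> (real ^ 'd) set \<Rightarrow> ('d config \<times> 'd config) set" where
  "coupled_states v \<Lambda> =
     {(\<eta>1, \<eta>2) \<in> configs \<Lambda> \<times> configs \<Lambda>.
        (\<forall>e\<in>edges_in \<Lambda>. \<eta>2 e \<le> \<eta>1 e) \<and> \<not> top_bottom_connected v \<Lambda> \<eta>2}"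

fun coupled_step ::
    "'d \<Rightarrow> (real ^ 'd) set \<Rightarrow> (real ^ 'd) set \<times> bool \<Rightarrow> 'd config \<times> 'd config \<Rightarrow> 'd config \<times> 'd config" where
  "coupled_step v \<Lambda> (e, b) (x, y) =
     (x(e := b), y(e := b \<and> \<not> top_bottom_connected v \<Lambda> (y(e := True))))"

fun coupled_state ::
    "'d \<Rightarrow> (real ^ 'd) set \<Rightarrow> 'd config \<times> 'd config \<Rightarrow> (nat \<Rightarrow> (real ^ 'd) set \<times> bool) \<Rightarrow> nat
      \<Rightarrow> 'd config \<times> 'd config" where
  "coupled_state v \<Lambda> s \<nu> 0 = s"
| "coupled_state v \<Lambda> s \<nu> (Suc t) = coupled_step v \<Lambda> (\<nu> (Suc t)) (coupled_state v \<Lambda> s \<nu> t)"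

text \<open>
  The joint law of one pair \<open>(E\<^sub>t, B\<^sub>t)\<close>. The edge factor has the finite set
  \<open>edges_in \<Lambda>\<close> as its space (rather than being a \<open>pmf\<close> on all sets of points), and likewise
  the state space below is \<open>coupled_states v \<Lambda>\<close>; the underlying types are too large
  for functions of several coordinates to be measurable for the product \<open>\<sigma>\<close>-algebra otherwise.
\<close>

definition noise :: "(real ^ 'd) set \<Rightarrow> real \<Rightarrow> ((real ^ 'd) set \<times> bool) measure" where
  "noise \<Lambda> p = uniform_count_measure (edges_in \<Lambda>) \<Otimes>\<^sub>M measure_pmf (bernoulli_pmf p)"

definition equilibrium ::
    "'d \<Rightarrow> (real ^ 'd) set \<Rightarrow> real \<Rightarrow> ('d config \<times> 'd config) measure \<Rightarrow> bool" where
  "equilibrium v \<Lambda> p \<mu> \<longleftrightarrow>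
     prob_space \<mu> \<and> sets \<mu> = sets (count_space (coupled_states v \<Lambda>)) \<and>
     distr (\<mu> \<Otimes>\<^sub>M noise \<Lambda> p) (count_space (coupled_states v \<Lambda>))
       (\<lambda>(s, n). coupled_step v \<Lambda> n s) = \<mu>"

text \<open>The law of \<open>(X\<^sub>t, Y\<^sub>t)\<close>, \<open>t \<in> \<nat>\<close>, when \<open>(X\<^sub>0, Y\<^sub>0)\<close> has law \<open>\<mu>\<close>.\<close>

definition process_law ::
    "'d \<Rightarrow> (real ^ 'd) set \<Rightarrow> real \<Rightarrow> ('d config \<times> 'd config) measure
      \<Rightarrow> (nat \<Rightarrow> 'd config \<times> 'd config) measure" where
  "process_law v \<Lambda> p \<mu> =
     distr (\<mu> \<Otimes>\<^sub>M (\<Pi>\<^sub>M t\<in>{1..}. noise \<Lambda> p))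
       (\<Pi>\<^sub>M t\<in>UNIV. count_space (coupled_states v \<Lambda>))
       (\<lambda>(s, \<nu>). coupled_state v \<Lambda> s \<nu>)"

text \<open>
  Extended-real values give \<open>d(x, {}) = \<infinity>\<close> (whereas \<open>infdist x {} = 0\<close>) and
  \<open>Inf {} = \<infinity>\<close>.
\<close>

definition dist_to_set :: "(real ^ 'd) \<Rightarrow> (real ^ 'd) set \<Rightarrow> ereal" where
  "dist_to_set x A = (INF a\<in>A. ereal (dist x a))"

definition neighbourhood :: "(real ^ 'd) set \<Rightarrow> real \<Rightarrow> (real ^ 'd) set" where
  "neighbourhood A r = {x. dist_to_set x A < ereal r}"

definition hausdorff_inner ::
    "(real ^ 'd) set \<Rightarrow> real \<Rightarrow> (real ^ 'd) set \<Rightarrow> (real ^ 'd) set \<Rightarrow> ereal" where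
  "hausdorff_inner \<Lambda> l A A' =
     Inf (ereal ` {r. r \<ge> 0 \<and>
        A - neighbourhood (- \<Lambda>) l \<subseteq> neighbourhood A' r \<and>
        A' - neighbourhood (- \<Lambda>) l \<subseteq> neighbourhood A r})"

end

theory Submission
  imports Defs
begin

text \<open>
  Suppose that the two unions of pivotal edges are far apart. Then there
  is an edge \<open>e\<close>, pivotal at a time of one of the two windows and deep inside the box, such that
  no edge near \<open>e\<close> is pivotal during the other window. The law of the conditioned configuration
  \<open>Y\<close> is invariant under time reversal, so it is enough to treat the case in which the
  quiet window comes first.

  As long as no edge near \<open>e\<close> is pivotal, \<open>Y\<close> evolves near \<open>e\<close> like unconstrained percolation:
  the last draw of an edge decides its state. When \<open>e\<close> becomes pivotal, it lies on a cut of closed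
  edges between top and bottom, and such a cut is connected through unit squares all the way to
  the boundary of the box (\<open>closed_star_path_to_boundary\<close>). Follow the cut away from \<open>e\<close>.
  Whenever the path meets an edge that has already been pivotal, jump back to the first time at
  which that edge was pivotal and follow the cut of that earlier time. The times decrease, so this
  stops, and it can only stop by leaving the neighbourhood of \<open>e\<close>. The result
  (\<open>spacetime_path_leaves_quiet_region\<close>, and \<open>rtrancl_simple_path\<close> to remove loops) is a path
  of distinct edges, of length proportional to \<open>ln \<bar>\<Lambda>\<bar>\<close>, with nonincreasing times, such that each edge was closed by the coin of its last draw
  before its time, or has not been drawn at all since the beginning of the quiet window.

  Each edge of the path is then improbable: the coin has probability \<open>1 - p\<close>, and not being drawn
  during \<open>c \<bar>\<Lambda>\<bar> ln \<bar>\<Lambda>\<bar>\<close> steps has probability about \<open>\<bar>\<Lambda>\<bar>\<close> to the power \<open>- c / d\<close>. The numbers of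
  paths and of time sequences grow only exponentially in the length: the times matter only up to
  blocks of \<open>\<bar>\<Lambda>\<bar>\<close> steps, there are of order \<open>c ln \<bar>\<Lambda>\<bar>\<close> blocks, and the blocks are nonincreasing
  along the path (\<open>card_nonincreasing_lists\<close>). For \<open>p\<close> close to 1 a union bound
  (\<open>strays_draws_prob\<close>) gives a large power of \<open>1 / \<bar>\<Lambda>\<bar>\<close>.

  Time reversal (\<open>time_reversal\<close>) comes from detailed balance. The product weight is reversible
  for the single-edge updates of \<open>Y\<close>, and a maximum principle shows that the \<open>Y\<close>-marginal of any
  equilibrium is proportional to it, because every configuration can reach the fully closed one.
\<close>

section \<open>Closed cochains on a box of the grid\<close>

text \<open>
  A box of the grid is simply connected, so a mod 2 edge labelling that sums to zero around every
  unit square is the coboundary of a vertex labelling. The vertex labelling is obtained by adding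
  one coordinate direction at a time: integrate the labels along the new direction; the square
  condition says that the integral does not disturb the directions already treated.
\<close>

lemma grid_cochain_exact:
  fixes h :: "'d::finite \<Rightarrow> ('d \<Rightarrow> nat) \<Rightarrow> bool"
  assumes sq: "\<And>g i j. i \<noteq> j \<Longrightarrow> (\<forall>k. g k \<le> n) \<Longrightarrow> g i < n \<Longrightarrow> g j < n \<Longrightarrow>
      (h i g \<noteq> h j (g(i := Suc (g i)))) = (h j g \<noteq> h i (g(j := Suc (g j))))"
  shows "\<exists>f :: ('d \<Rightarrow> nat) \<Rightarrow> bool. \<forall>g i. (\<forall>k. g k \<le> n) \<longrightarrow> g i < n \<longrightarrow> (f g \<noteq> f (g(i := Suc (g i)))) = h i g"
proof -
  have "\<exists>f :: ('d \<Rightarrow> nat) \<Rightarrow> bool. \<forall>g. \<forall>i\<in>I. (\<forall>k. g k \<le> n) \<longrightarrow> g i < n \<longrightarrow> (f g \<noteq> f (g(i := Suc (g i)))) = h i g"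
    if "finite I" for I :: "'d set"
    using that
  proof (induction I rule: finite_induct)
    case empty
    then show ?case by simp
  next
    case (insert j I)
    obtain f :: "('d \<Rightarrow> nat) \<Rightarrow> bool" where f_all: "\<forall>g. \<forall>i\<in>I. (\<forall>k. g k \<le> n) \<longrightarrow> g i < n \<longrightarrow>
        (f g \<noteq> f (g(i := Suc (g i)))) = h i g"
      using insert.IH ..
    have f: "(f g \<noteq> f (g(i := Suc (g i)))) = h i g" if "i \<in> I" "\<forall>k. g k \<le> n" "g i < n" for g i
      using f_all[rule_format, OF that(1)] that(2,3) by simp
    \<comment> \<open>\<open>par g m\<close> is the parity of the labels on the first \<open>m\<close> edges of the line through \<open>g\<close> in direction \<open>j\<close>.\<close>
    define par where "par g = rec_nat False (\<lambda>k r. r \<noteq> h j (g(j := k)))" for g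
    have par_simps: "par g 0 = False" "par g (Suc m) = (par g m \<noteq> h j (g(j := m)))" for g m
      by (simp_all add: par_def)
    have par_upd: "par (g(j := k)) = par g" for g k
      by (simp add: par_def)
    define F where "F g = (f (g(j := 0)) \<noteq> par g (g j))" for g
    have F0: "F (g(j := 0)) = f (g(j := 0))" for g
      by (simp add: F_def par_simps)
    have FS: "F (g(j := Suc m)) = (F (g(j := m)) \<noteq> h j (g(j := m)))" for g m
      by (auto simp: F_def par_simps par_upd)
    have FI: "(F (g(j := m)) \<noteq> F ((g(j := m))(i := Suc (g i)))) = h i (g(j := m))"
      if i: "i \<in> I" "g i < n" and g: "\<forall>k. g k \<le> n" and m: "m \<le> n" for g i m
      using m
    proof (induction m)
      case 0
      have ij: "i \<noteq> j" using i insert by auto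
      have tw: "(g(j := 0))(i := Suc (g i)) = (g(i := Suc (g i)))(j := 0)"
        using ij by auto
      have gi: "(g(j := 0)) i = g i" using ij by simp
      have "(f (g(j := 0)) \<noteq> f ((g(j := 0))(i := Suc ((g(j := 0)) i)))) = h i (g(j := 0))"
        by (rule f) (use i g ij in auto)
      then show ?case unfolding gi tw F0 .
    next
      case (Suc m)
      have ij: "i \<noteq> j" using i insert by auto
      have tw: "(g(j := k))(i := Suc (g i)) = (g(i := Suc (g i)))(j := k)" for k
        using ij by auto
      have "(h i (g(j := m)) \<noteq> h j ((g(j := m))(i := Suc ((g(j := m)) i)))) =
            (h j (g(j := m)) \<noteq> h i ((g(j := m))(j := Suc ((g(j := m)) j))))"
        by (rule sq) (use i g ij Suc.prems in auto)
      moreover have "(g(j := m)) i = g i" "(g(j := m)) j = m" "(g(j := m))(j := Suc m) = g(j := Suc m)"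
        using ij by auto
      ultimately have sqm: "(h i (g(j := m)) \<noteq> h j ((g(i := Suc (g i)))(j := m))) =
            (h j (g(j := m)) \<noteq> h i (g(j := Suc m)))"
        by (simp only: tw)
      have "(F (g(j := m)) \<noteq> F ((g(i := Suc (g i)))(j := m))) = h i (g(j := m))"
        using Suc.IH Suc.prems unfolding tw by linarith
      then show ?case
        using sqm unfolding tw FS by argo
    qed
    show ?case
    proof (intro exI[of _ F] allI ballI impI)
      fix g i assume i: "i \<in> insert j I" and g: "\<forall>k. g k \<le> n" and gi: "g i < n"
      show "(F g \<noteq> F (g(i := Suc (g i)))) = h i g"
      proof (cases "i = j")
        case True
        then show ?thesis using FS[of g "g j"] by auto
      next
        case False
        then show ?thesis using FI[of i g "g j"] i g gi by simp
      qed
    qed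
  qed
  from this[of UNIV] show ?thesis by auto
qed

text \<open>
  Vertices are indexed by natural coordinates counted from the lowest corner of the box, so that
  induction along a coordinate line is induction on \<open>nat\<close>.
\<close>

definition grid_pt :: "nat \<Rightarrow> ('d \<Rightarrow> nat) \<Rightarrow> real ^ 'd" where
  "grid_pt M g = (\<chi> i. real (g i) - real M)"

definition grid_edge :: "nat \<Rightarrow> ('d \<Rightarrow> nat) \<Rightarrow> 'd \<Rightarrow> (real ^ 'd) set" where
  "grid_edge M g i = {grid_pt M g, grid_pt M (g(i := Suc (g i)))}"

lemma grid_pt_eq_iff: "grid_pt M g = grid_pt M g' \<longleftrightarrow> g = g'"
  by (auto simp: grid_pt_def vec_eq_iff fun_eq_iff)

lemma dist_grid_edge:
  fixes g :: "'d::finite \<Rightarrow> nat"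
  shows "dist (grid_pt M g) (grid_pt M (g(i := Suc (g i)))) = 1"
proof -
  have "grid_pt M (g(i := Suc (g i))) = grid_pt M g + axis i 1"
    by (auto simp: grid_pt_def vec_eq_iff axis_def)
  then show ?thesis by (simp add: dist_norm norm_axis_1)
qed

lemma sum_squares_eq_1:
  fixes u :: "'d::finite \<Rightarrow> int"
  assumes "(\<Sum>i\<in>UNIV. (u i)\<^sup>2) = 1"
  shows "\<exists>i. \<bar>u i\<bar> = 1 \<and> (\<forall>j. j \<noteq> i \<longrightarrow> u j = 0)"
proof -
  have "\<exists>i. u i \<noteq> 0"
    using assms by (metis (no_types, lifting) power_zero_numeral sum.neutral zero_neq_one)
  then obtain i where i: "u i \<noteq> 0" by blast
  have split: "(\<Sum>i\<in>UNIV. (u i)\<^sup>2) = (u i)\<^sup>2 + (\<Sum>j\<in>UNIV - {i}. (u j)\<^sup>2)"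
    by (simp add: sum.remove)
  have ge: "(\<Sum>j\<in>UNIV - {i}. (u j)\<^sup>2) \<ge> 0" by (simp add: sum_nonneg)
  have pos: "(u i)\<^sup>2 \<ge> 1"
    using i by (metis int_one_le_iff_zero_less zero_less_power2)
  have eq: "(u i)\<^sup>2 = 1" and z: "(\<Sum>j\<in>UNIV - {i}. (u j)\<^sup>2) = 0"
    using split ge pos assms by linarith+
  have "\<forall>j\<in>UNIV - {i}. (u j)\<^sup>2 = 0"
    using z by (subst (asm) sum_nonneg_eq_0_iff) auto
  moreover have "\<bar>u i\<bar> = 1" using eq power2_eq_1_iff by fastforce
  ultimately show ?thesis by auto
qed

locale lattice_box =
  fixes \<Lambda> :: "(real ^ 'd) set" and M :: nat
  assumes M_pos: "M > 0" and box: "\<Lambda> = cbox (vec (- real M)) (vec (real M))"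
    and dim: "CARD('d::finite) \<ge> 2"
begin

lemma in_box_iff: "x \<in> \<Lambda> \<longleftrightarrow> (\<forall>i. \<bar>x $ i\<bar> \<le> real M)"
proof -
  have "(- real M \<le> x $ i \<and> x $ i \<le> real M) \<longleftrightarrow> \<bar>x $ i\<bar> \<le> real M" for i by linarith
  then show ?thesis by (simp add: box mem_box_cart)
qed

lemma grid_pt_in:
  assumes "\<forall>k. g k \<le> 2 * M" shows "grid_pt M g \<in> \<Lambda> \<inter> int_lattice"
proof -
  have "\<bar>real (g i) - real M\<bar> \<le> real M" for i
    using assms[rule_format, of i] by linarith
  then show ?thesis
    by (auto simp: in_box_iff int_lattice_def grid_pt_def)
qed

lemma box_vertices: "\<Lambda> \<inter> int_lattice = grid_pt M ` {g. \<forall>k. g k \<le> 2 * M}"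
proof (intro equalityI subsetI)
  fix x :: "real ^ 'd" assume x: "x \<in> \<Lambda> \<inter> int_lattice"
  define g where "g i = nat (\<lfloor>x $ i\<rfloor> + int M)" for i
  have fl: "x $ i = of_int \<lfloor>x $ i\<rfloor>" for i
    using x by (auto simp: int_lattice_def elim!: Ints_cases)
  have b: "- int M \<le> \<lfloor>x $ i\<rfloor>" "\<lfloor>x $ i\<rfloor> \<le> int M" for i
  proof -
    have "\<bar>x $ i\<bar> \<le> real M" using x by (simp add: in_box_iff)
    then have "\<bar>real_of_int \<lfloor>x $ i\<rfloor>\<bar> \<le> real_of_int (int M)" using fl[of i] by simp
    then have "\<bar>\<lfloor>x $ i\<rfloor>\<bar> \<le> int M" by (metis of_int_abs of_int_le_iff)
    then show "- int M \<le> \<lfloor>x $ i\<rfloor>" "\<lfloor>x $ i\<rfloor> \<le> int M" by linarith+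
  qed
  have "real (g i) = x $ i + real M" for i
  proof -
    have "int (g i) = \<lfloor>x $ i\<rfloor> + int M" using b[of i] by (simp add: g_def)
    then show ?thesis by (metis fl of_int_add of_int_of_nat_eq)
  qed
  moreover have "g i \<le> 2 * M" for i using b[of i] by (simp add: g_def)
  ultimately show "x \<in> grid_pt M ` {g. \<forall>k. g k \<le> 2 * M}"
    by (intro image_eqI[of _ _ g]) (auto simp: grid_pt_def vec_eq_iff)
next
  fix x :: "real ^ 'd" assume "x \<in> grid_pt M ` {g. \<forall>k. g k \<le> 2 * M}"
  then show "x \<in> \<Lambda> \<inter> int_lattice" using grid_pt_in by auto
qed

lemma grid_edge_in:
  assumes "\<forall>k. g k \<le> 2 * M" "g i < 2 * M"
  shows "grid_edge M g i \<in> edges_in \<Lambda>"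
proof -
  have 1: "grid_pt M g \<in> \<Lambda> \<inter> int_lattice" "grid_pt M (g(i := Suc (g i))) \<in> \<Lambda> \<inter> int_lattice"
    using assms by (auto intro!: grid_pt_in[THEN IntD1] grid_pt_in[THEN IntD2])
  have "convex \<Lambda>" by (simp add: box)
  then have "convex hull (grid_edge M g i) \<subseteq> \<Lambda>"
    using 1 by (intro hull_minimal) (auto simp: grid_edge_def)
  moreover have "grid_edge M g i \<in> lattice_edges"
    unfolding lattice_edges_def grid_edge_def using 1 dist_grid_edge by blast
  ultimately show ?thesis by (simp add: edges_in_def)
qed

lemma edges_in_eq: 
  "edges_in \<Lambda> = {grid_edge M g i | g i. (\<forall>k. g k \<le> 2 * M) \<and> g i < 2 * M}"
proof (intro equalityI subsetI)
  fix e :: "(real ^ 'd) set" assume "e \<in> edges_in \<Lambda>"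
  then obtain x y where e: "e = {x, y}" "x \<in> int_lattice" "y \<in> int_lattice" "dist x y = 1"
      "convex hull e \<subseteq> \<Lambda>"
    by (auto simp: edges_in_def lattice_edges_def)
  have "{x, y} \<subseteq> convex hull e" unfolding e(1) by (rule hull_subset)
  then have "x \<in> \<Lambda> \<inter> int_lattice" "y \<in> \<Lambda> \<inter> int_lattice" using e by auto
  then obtain g g' where g: "x = grid_pt M g" "y = grid_pt M g'" "\<forall>k. g k \<le> 2 * M" "\<forall>k. g' k \<le> 2 * M"
    unfolding box_vertices by auto
  define u where "u i = int (g i) - int (g' i)" for i
  have "(dist x y)\<^sup>2 = (\<Sum>i\<in>UNIV. (x $ i - y $ i)\<^sup>2)"
    by (simp add: dist_vec_def L2_set_def sum_nonneg dist_real_def)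
  also have "\<dots> = real_of_int (\<Sum>i\<in>UNIV. (u i)\<^sup>2)"
    by (simp add: g grid_pt_def u_def)
  finally have "real_of_int (\<Sum>i\<in>UNIV. (u i)\<^sup>2) = 1" using e(4) by (simp only: one_power2)
  then have "(\<Sum>i\<in>UNIV. (u i)\<^sup>2) = 1" by (simp only: of_int_eq_1_iff)
  from sum_squares_eq_1[OF this] obtain i where i: "\<bar>u i\<bar> = 1" "\<forall>j. j \<noteq> i \<longrightarrow> u j = 0" by blast
  have oth: "g j = g' j" if "j \<noteq> i" for j using i that by (auto simp: u_def)
  consider "g' i = Suc (g i)" | "g i = Suc (g' i)" using i unfolding u_def by linarith
  then show "e \<in> {grid_edge M g i | g i. (\<forall>k. g k \<le> 2 * M) \<and> g i < 2 * M}"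
  proof cases
    case 1
    then have "g' = g(i := Suc (g i))" using oth by auto
    moreover have "g i < 2 * M" using 1 g(4) by (metis Suc_le_eq)
    ultimately show ?thesis using e(1) g by (auto simp: grid_edge_def)
  next
    case 2
    then have "g = g'(i := Suc (g' i))" using oth by auto
    moreover have "g' i < 2 * M" using 2 g(3) by (metis Suc_le_eq)
    ultimately show ?thesis using e(1) g unfolding grid_edge_def by blast
  qed
next
  fix e :: "(real ^ 'd) set" assume "e \<in> {grid_edge M g i | g i. (\<forall>k. g k \<le> 2 * M) \<and> g i < 2 * M}"
  then show "e \<in> edges_in \<Lambda>" using grid_edge_in by auto
qed

end

lemma centred_box_lattice_box:
  assumes "centred_box (\<Lambda> :: (real ^ 'd) set)" "CARD('d::finite) \<ge> 2"
  shows "\<exists>M. lattice_box \<Lambda> M"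
proof -
  obtain s where s: "s > 0" "\<Lambda> = cbox (vec (- s / 2)) (vec (s / 2))"
    "\<forall>x::real ^ 'd. (\<forall>i. \<bar>x $ i\<bar> = s / 2) \<longrightarrow> x \<in> int_lattice"
    using assms unfolding centred_box_def by blast
  have "(vec (s / 2) :: real ^ 'd) \<in> int_lattice" using s(1,3) by simp
  then have "s / 2 \<in> \<int>" by (auto simp: int_lattice_def)
  then obtain k where k: "s / 2 = of_int k" by (auto elim: Ints_cases)
  then have "k > 0" using s by (metis half_gt_zero of_int_0_less_iff)
  then have "s / 2 = real (nat k)" using k by simp
  then have "lattice_box \<Lambda> (nat k)"
    using s(2) \<open>k > 0\<close> assms(2) by unfold_locales auto
  then show ?thesis ..
qed

section \<open>Cuts reach the boundary of the box\<close>

definition square_edges :: "real ^ 'd \<Rightarrow> 'd \<Rightarrow> 'd \<Rightarrow> (real ^ 'd) set set" where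
  "square_edges x i j =
     {{x, x + axis i 1}, {x, x + axis j 1},
      {x + axis i 1, x + axis i 1 + axis j 1}, {x + axis j 1, x + axis i 1 + axis j 1}}"

text \<open>
  In the dual picture an edge is a plaquette, and two edges of a common unit square are plaquettes
  that meet. This is the adjacency for which minimal cuts are connected.
\<close>

definition star_adj :: "(real ^ 'd) set \<Rightarrow> (real ^ 'd) set \<Rightarrow> bool" where
  "star_adj e e' \<longleftrightarrow> (\<exists>x i j. i \<noteq> j \<and> e \<in> square_edges x i j \<and> e' \<in> square_edges x i j)"

lemma star_adj_sym: "star_adj e e' \<Longrightarrow> star_adj e' e"
  by (auto simp: star_adj_def)

lemma grid_pt_upd: "grid_pt M (g(i := Suc (g i))) = grid_pt M g + axis i 1"
  by (auto simp: grid_pt_def vec_eq_iff axis_def)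

lemma grid_edge_axis: "grid_edge M g i = {grid_pt M g, grid_pt M g + axis i 1}"
  by (simp add: grid_edge_def grid_pt_upd)

lemma grid_square:
  assumes "i \<noteq> j"
  shows "square_edges (grid_pt M g) i j =
    {grid_edge M g i, grid_edge M g j, grid_edge M (g(i := Suc (g i))) j, grid_edge M (g(j := Suc (g j))) i}"
  using assms by (auto simp: square_edges_def grid_edge_axis grid_pt_upd add_ac)

lemma rtrancl_exit:
  assumes "(x, y) \<in> r\<^sup>*" "x \<in> Q" "y \<notin> Q"
  shows "\<exists>a b. (x, a) \<in> (r \<inter> Q \<times> Q)\<^sup>* \<and> a \<in> Q \<and> (a, b) \<in> r \<and> b \<notin> Q"
proof -
  have "(x, w) \<in> (r \<inter> Q \<times> Q)\<^sup>* \<and> w \<in> Q \<or>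
    (\<exists>a b. (x, a) \<in> (r \<inter> Q \<times> Q)\<^sup>* \<and> a \<in> Q \<and> (a, b) \<in> r \<and> b \<notin> Q)"
    if "(x, w) \<in> r\<^sup>*" for w
    using that
  proof (induction rule: rtrancl_induct)
    case base
    then show ?case using assms by blast
  next
    case (step p q)
    then show ?case by (cases "q \<in> Q") (blast intro: rtrancl_into_rtrancl)+
  qed
  then show ?thesis using assms(1,3) by blast
qed

text \<open>
  Follow a path from top to bottom in the configuration with \<open>e\<close> opened. It cannot avoid \<open>e\<close>, and
  after its last step from the component of the top through \<open>e\<close> it uses edges that were
  already open.
\<close>

lemma pivotal_endpoints:
  assumes nc: "\<not> top_bottom_connected v \<Lambda> \<eta>" and piv: "e \<in> pivotal v \<Lambda> \<eta>"
  shows "\<exists>x y s b. e = {x, y} \<and> s \<in> top_face v \<Lambda> \<inter> int_lattice \<and> b \<in> bottom_face v \<Lambda> \<inter> int_lattice \<and>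
      (s, x) \<in> (open_adj \<Lambda> \<eta>)\<^sup>* \<and> (y, b) \<in> (open_adj \<Lambda> \<eta>)\<^sup>*"
proof -
  \<comment> \<open>Each vertex of the path is joined by open edges to \<open>s\<close>, or to an end of \<open>e\<close> whose other end is joined to \<open>s\<close>.\<close>
  define r where "r = open_adj \<Lambda> \<eta>"
  obtain s b where sb: "s \<in> top_face v \<Lambda> \<inter> int_lattice" "b \<in> bottom_face v \<Lambda> \<inter> int_lattice"
      "(s, b) \<in> (open_adj \<Lambda> (\<eta>(e := True)))\<^sup>*"
    using piv by (auto simp: pivotal_def top_bottom_connected_def)
  have "(s, z) \<in> r\<^sup>* \<or> (\<exists>x y. e = {x, y} \<and> (s, x) \<in> r\<^sup>* \<and> (y, z) \<in> r\<^sup>*)"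
    if "(s, z) \<in> (open_adj \<Lambda> (\<eta>(e := True)))\<^sup>*" for z
    using that
  proof (induction rule: rtrancl_induct)
    case base
    then show ?case by simp
  next
    case (step z z')
    show ?case
    proof (cases "{z, z'} = e")
      case False
      then have "(z, z') \<in> r" using step by (auto simp: open_adj_def r_def)
      with step.IH show ?thesis by (blast intro: rtrancl_into_rtrancl)
    next
      case True
      from step.IH show ?thesis
      proof
        assume "(s, z) \<in> r\<^sup>*"
        then show ?thesis using True by blast
      next
        assume "\<exists>x y. e = {x, y} \<and> (s, x) \<in> r\<^sup>* \<and> (y, z) \<in> r\<^sup>*"
        then obtain x y where xy: "e = {x, y}" "(s, x) \<in> r\<^sup>*" by blast
        then have "(z = x \<and> z' = y) \<or> (z = y \<and> z' = x)"
          using True by (auto simp: doubleton_eq_iff)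
        then show ?thesis using xy True by blast
      qed
    qed
  qed
  from this[OF sb(3)] show ?thesis
    using nc sb(1,2) unfolding r_def top_bottom_connected_def by blast
qed

context lattice_box
begin

lemma top_face_iff: "x \<in> top_face v \<Lambda> \<longleftrightarrow> x \<in> \<Lambda> \<and> x $ v = real M"
proof
  assume x: "x \<in> top_face v \<Lambda>"
  have "(vec (real M) :: real ^ 'd) \<in> \<Lambda>" by (simp add: in_box_iff)
  with x have "real M \<le> x $ v" "x \<in> \<Lambda>" unfolding top_face_def by fastforce+
  moreover have "x $ v \<le> real M"
    using calculation by (simp add: in_box_iff abs_le_iff)
  ultimately show "x \<in> \<Lambda> \<and> x $ v = real M" by simp
next
  assume "x \<in> \<Lambda> \<and> x $ v = real M"
  then show "x \<in> top_face v \<Lambda>" by (simp add: top_face_def in_box_iff abs_le_iff)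
qed

lemma bottom_face_iff: "x \<in> bottom_face v \<Lambda> \<longleftrightarrow> x \<in> \<Lambda> \<and> x $ v = - real M"
proof
  assume x: "x \<in> bottom_face v \<Lambda>"
  have "(vec (- real M) :: real ^ 'd) \<in> \<Lambda>" by (simp add: in_box_iff)
  with x have "x $ v \<le> - real M" "x \<in> \<Lambda>" unfolding bottom_face_def by fastforce+
  moreover have "x $ v \<ge> - real M"
    using calculation by (metis abs_le_D2 in_box_iff minus_le_iff)
  ultimately show "x \<in> \<Lambda> \<and> x $ v = - real M" by simp
next
  assume "x \<in> \<Lambda> \<and> x $ v = - real M"
  then show "x \<in> bottom_face v \<Lambda>" by (auto simp: bottom_face_def in_box_iff abs_le_iff) 
     (metis minus_le_iff)
qed

text \<open>
  Two vertices of one face are joined inside the face by changing the other coordinates one by one.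
\<close>

lemma const_on_face:
  fixes f :: "('d \<Rightarrow> nat) \<Rightarrow> bool"
  assumes f: "\<And>g i j. \<forall>k. g k \<le> 2 * M \<Longrightarrow> g i < 2 * M \<Longrightarrow> j \<noteq> i \<Longrightarrow> g j = 0 \<or> g j = 2 * M \<Longrightarrow>
      f g = f (g(i := Suc (g i)))"
    and g: "\<forall>k. g k \<le> 2 * M" "\<forall>k. g' k \<le> 2 * M" "g j = g' j" "g j = 0 \<or> g j = 2 * M"
  shows "f g = f g'"
proof -
  have line: "f u = f (u(i := m))" if u: "\<forall>k. u k \<le> 2 * M" "m \<le> 2 * M" "u j = g j" "i \<noteq> j" for u i m
  proof -
    have "f (u(i := 0)) = f (u(i := m))" if "m \<le> 2 * M" for m
      using that
    proof (induction m)
      case (Suc m)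
      have "f (u(i := m)) = f ((u(i := m))(i := Suc ((u(i := m)) i)))"
        by (rule f[where j = j]) (use Suc u g in auto)
      also have "(u(i := m))(i := Suc ((u(i := m)) i)) = u(i := Suc m)"
        by simp
      finally show ?case using Suc.IH Suc.prems by (metis Suc_leD)
    qed simp
    from this[of m] this[of "u i"] u show ?thesis by simp
  qed
  have "f g = f (\<lambda>i. if i \<in> D then g' i else g i)" if "finite D" "j \<notin> D" for D
    using that
  proof (induction D rule: finite_induct)
    case empty
    then show ?case by simp
  next
    case (insert i D)
    define u where "u = (\<lambda>i. if i \<in> D then g' i else g i)"
    have "f u = f (u(i := g' i))"
      by (rule line) (use insert g in \<open>auto simp: u_def\<close>)
    moreover have "u(i := g' i) = (\<lambda>k. if k \<in> insert i D then g' k else g k)"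
      by (auto simp: u_def)
    ultimately show ?case using insert by (auto simp: u_def)
  qed
  from this[of "UNIV - {j}"] have "f g = f (\<lambda>i. if i \<in> UNIV - {j} then g' i else g i)" by simp
  also have "(\<lambda>i. if i \<in> UNIV - {j} then g' i else g i) = g'" using g(3) by auto
  finally show ?thesis .
qed

text \<open>
  In dimension at least two the surface of the box is connected: go to a side face inside the top
  face, down along the side face, and across the bottom face.
\<close>

lemma const_on_boundary:
  fixes f :: "('d \<Rightarrow> nat) \<Rightarrow> bool"
  assumes f: "\<And>g i j. \<forall>k. g k \<le> 2 * M \<Longrightarrow> g i < 2 * M \<Longrightarrow> j \<noteq> i \<Longrightarrow> g j = 0 \<or> g j = 2 * M \<Longrightarrow>
      f g = f (g(i := Suc (g i)))"
    and g: "\<forall>k. g k \<le> 2 * M" "\<forall>k. g' k \<le> 2 * M" "g v = 2 * M" "g' v = 0"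
  shows "f g = f g'"
proof -
  obtain j :: 'd where j: "j \<noteq> v"
  proof -
    have "\<not> (UNIV :: 'd set) \<subseteq> {v}"
    proof
      assume "(UNIV :: 'd set) \<subseteq> {v}"
      then have "CARD('d) \<le> card {v}" by (rule card_mono[rotated]) simp
      then show False using dim by simp
    qed
    then show ?thesis using that by blast
  qed
  define u where "u = g(j := 2 * M)"
  define u' where "u' = u(v := 0)"
  have "f g = f u" 
    by (rule const_on_face[OF f, where j = v]) (use g j in \<open>auto simp: u_def\<close>)
  also have "f u = f u'"
    by (rule const_on_face[OF f, where j = j]) (use g j in \<open>auto simp: u_def u'_def\<close>)
  also have "f u' = f g'"
    by (rule const_on_face[OF f, where j = v]) (use g j in \<open>auto simp: u_def u'_def\<close>)
  finally show ?thesis .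
qed

text \<open>
  The edge boundary \<open>Cut\<close> of the component \<open>A\<close> of the top consists of closed edges and contains \<open>e\<close>.
  Let \<open>C\<close> be the part of \<open>Cut\<close> that is connected to \<open>e\<close> through unit squares. A unit square that
  meets \<open>C\<close> has the same edges in \<open>C\<close> as in \<open>Cut\<close>, and a coboundary has an even number of
  edges in a square; so \<open>C\<close> is a closed cochain and hence the edge boundary of some vertex set. If \<open>C\<close>
  did not touch the boundary of the box, the two ends of \<open>e\<close> would be on the same side of \<open>C\<close>:
  each is joined by open edges to the top or to the bottom, and these are joined along the surface of
  the box.
\<close>

lemma closed_star_path_to_boundary:
  assumes nc: "\<not> top_bottom_connected v \<Lambda> \<eta>" and piv: "e \<in> pivotal v \<Lambda> \<eta>"
  shows "\<exists>h. (e, h) \<in> {(a, b). star_adj a b \<and> a \<in> edges_in \<Lambda> \<and> b \<in> edges_in \<Lambda> \<and> \<not> \<eta> a \<and> \<not> \<eta> b}\<^sup>* \<and>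
     h \<in> edges_in \<Lambda> \<and> (\<exists>y\<in>h. \<exists>i. \<bar>y $ i\<bar> = real M)"
proof (rule ccontr)
  assume contra: "\<not> ?thesis"
  define r where "r = open_adj \<Lambda> \<eta>"
  define A where "A = {z. \<exists>s \<in> top_face v \<Lambda> \<inter> int_lattice. (s, z) \<in> r\<^sup>*}"
  define Cut where "Cut = {e' \<in> edges_in \<Lambda>. \<exists>x y. e' = {x, y} \<and> x \<in> A \<and> y \<notin> A}"
  define R where "R = {(a, b). star_adj a b \<and> a \<in> Cut \<and> b \<in> Cut}"
  define C where "C = R\<^sup>* `` {e}"
  obtain x y s b where xy: "e = {x, y}" "s \<in> top_face v \<Lambda> \<inter> int_lattice" "b \<in> bottom_face v \<Lambda> \<inter> int_lattice"
      "(s, x) \<in> r\<^sup>*" "(y, b) \<in> r\<^sup>*"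
    using pivotal_endpoints[OF nc piv] unfolding r_def by blast
  have eE: "e \<in> edges_in \<Lambda>" using piv by (simp add: pivotal_def)
  have "x \<in> A" using xy by (auto simp: A_def)
  have "y \<notin> A"
  proof
    assume "y \<in> A"
    then obtain s' where "s' \<in> top_face v \<Lambda> \<inter> int_lattice" "(s', b) \<in> r\<^sup>*"
      using xy(5) by (auto simp: A_def intro: rtrancl_trans)
    then show False using nc xy(3) by (auto simp: top_bottom_connected_def r_def)
  qed
  have eCut: "e \<in> Cut" using eE xy \<open>x \<in> A\<close> \<open>y \<notin> A\<close> by (auto simp: Cut_def)
  have CCut: "C \<subseteq> Cut"
  proof
    fix h assume "h \<in> C"
    then have "(e, h) \<in> R\<^sup>*" by (simp add: C_def)
    then show "h \<in> Cut" by (cases rule: rtranclE) (use eCut in \<open>auto simp: R_def\<close>)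
  qed
  have closed: "\<not> \<eta> h" if cut: "h \<in> Cut" for h
  proof
    assume "\<eta> h"
    then obtain p q where pq: "h = {p, q}" "p \<in> A" "q \<notin> A" "h \<in> edges_in \<Lambda>"
      using cut unfolding Cut_def by blast
    then have "(p, q) \<in> r" using \<open>\<eta> h\<close> by (simp add: r_def open_adj_def)
    then show False using pq by (auto simp: A_def intro: rtrancl_into_rtrancl)
  qed
  have no_boundary: "\<bar>z $ i\<bar> \<noteq> real M" if "h \<in> C" "z \<in> h" for h z i
  proof -
    have "(e, h) \<in> R\<^sup>*" using that by (simp add: C_def)
    moreover have "R \<subseteq> {(a, b). star_adj a b \<and> a \<in> edges_in \<Lambda> \<and> b \<in> edges_in \<Lambda> \<and> \<not> \<eta> a \<and> \<not> \<eta> b}"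
      using closed by (auto simp: R_def Cut_def)
    ultimately have "(e, h) \<in> {(a, b). star_adj a b \<and> a \<in> edges_in \<Lambda> \<and> b \<in> edges_in \<Lambda> \<and> \<not> \<eta> a \<and> \<not> \<eta> b}\<^sup>*"
      using rtrancl_mono by blast
    moreover have "h \<in> edges_in \<Lambda>" using that CCut by (auto simp: Cut_def)
    ultimately show ?thesis using contra that by blast
  qed
  have Cut_grid: "grid_edge M g i \<in> Cut \<longleftrightarrow> (grid_pt M g \<in> A) \<noteq> (grid_pt M (g(i := Suc (g i))) \<in> A)"
    if "\<forall>k. g k \<le> 2 * M" "g i < 2 * M" for g i
    using grid_edge_in[OF that] unfolding Cut_def grid_edge_def by (auto simp: doubleton_eq_iff)
  have C_spread: "h' \<in> C \<longleftrightarrow> h' \<in> Cut" if "h \<in> C" "star_adj h h'" for h h'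
  proof
    assume "h' \<in> Cut"
    then have "(h, h') \<in> R" using that CCut by (auto simp: R_def)
    then show "h' \<in> C" using that by (auto simp: C_def intro: rtrancl_into_rtrancl)
  qed (use CCut in auto)
  have "\<exists>f :: ('d \<Rightarrow> nat) \<Rightarrow> bool. \<forall>g i. (\<forall>k. g k \<le> 2 * M) \<longrightarrow> g i < 2 * M \<longrightarrow>
      (f g \<noteq> f (g(i := Suc (g i)))) = (grid_edge M g i \<in> C)"
  proof (rule grid_cochain_exact)
    fix g :: "'d \<Rightarrow> nat" and i j
    assume ij: "i \<noteq> j" and g: "\<forall>k. g k \<le> 2 * M" "g i < 2 * M" "g j < 2 * M"
    let ?gi = "g(i := Suc (g i))" and ?gj = "g(j := Suc (g j))"
    let ?S = "square_edges (grid_pt M g) i j"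
    have sw: "?gi(j := Suc (?gi j)) = ?gj(i := Suc (?gj i))" using ij by auto
    have cut: "grid_edge M g i \<in> Cut \<longleftrightarrow> (grid_pt M g \<in> A) \<noteq> (grid_pt M ?gi \<in> A)"
      "grid_edge M g j \<in> Cut \<longleftrightarrow> (grid_pt M g \<in> A) \<noteq> (grid_pt M ?gj \<in> A)"
      by (rule Cut_grid; use g in simp)+
    have cut_i: "grid_edge M ?gi j \<in> Cut \<longleftrightarrow> (grid_pt M ?gi \<in> A) \<noteq> (grid_pt M (?gi(j := Suc (?gi j))) \<in> A)"
      by (rule Cut_grid) (use g ij in auto)
    have cut_j: "grid_edge M ?gj i \<in> Cut \<longleftrightarrow> (grid_pt M ?gj \<in> A) \<noteq> (grid_pt M (?gi(j := Suc (?gi j))) \<in> A)"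
      unfolding sw by (rule Cut_grid) (use g ij in auto)
    show "((grid_edge M g i \<in> C) \<noteq> (grid_edge M ?gi j \<in> C)) = ((grid_edge M g j \<in> C) \<noteq> (grid_edge M ?gj i \<in> C))"
    proof (cases "?S \<inter> C = {}")
      case True
      then show ?thesis unfolding grid_square[OF ij] by auto
    next
      case False
      then obtain h where h: "h \<in> ?S" "h \<in> C" by blast
      have "h' \<in> C \<longleftrightarrow> h' \<in> Cut" if "h' \<in> ?S" for h'
        by (rule C_spread[OF h(2)]) (use h that ij in \<open>auto simp: star_adj_def\<close>)
      then have "grid_edge M g i \<in> C \<longleftrightarrow> grid_edge M g i \<in> Cut" "grid_edge M g j \<in> C \<longleftrightarrow> grid_edge M g j \<in> Cut"
        "grid_edge M ?gi j \<in> C \<longleftrightarrow> grid_edge M ?gi j \<in> Cut" "grid_edge M ?gj i \<in> C \<longleftrightarrow> grid_edge M ?gj i \<in> Cut"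
        unfolding grid_square[OF ij] by blast+
      then show ?thesis using cut cut_i cut_j by argo
    qed
  qed
  then obtain f :: "('d \<Rightarrow> nat) \<Rightarrow> bool" where f_all: "\<forall>g i. (\<forall>k. g k \<le> 2 * M) \<longrightarrow> g i < 2 * M \<longrightarrow>
      (f g \<noteq> f (g(i := Suc (g i)))) = (grid_edge M g i \<in> C)" ..
  have f: "(f g \<noteq> f (g(i := Suc (g i)))) = (grid_edge M g i \<in> C)"
    if "\<forall>k. g k \<le> 2 * M" "g i < 2 * M" for g i
    using f_all that by simp
  define F where "F z = f (inv (grid_pt M) z)" for z :: "real ^ 'd"
  have "inj (grid_pt M :: ('d \<Rightarrow> nat) \<Rightarrow> _)" by (auto simp: inj_def grid_pt_eq_iff)
  then have F_grid: "F (grid_pt M g) = f g" for g by (simp add: F_def)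
  have F_edge: "(F p \<noteq> F q) = ({p, q} \<in> C)" if pq: "{p, q} \<in> edges_in \<Lambda>" for p q
  proof -
    obtain g i where g: "{p, q} = grid_edge M g i" "\<forall>k. g k \<le> 2 * M" "g i < 2 * M"
      using pq unfolding edges_in_eq by blast
    then have "(p = grid_pt M g \<and> q = grid_pt M (g(i := Suc (g i)))) \<or> (q = grid_pt M g \<and> p = grid_pt M (g(i := Suc (g i))))"
      by (auto simp: grid_edge_def doubleton_eq_iff)
    then have "(F p \<noteq> F q) = (f g \<noteq> f (g(i := Suc (g i))))" by (elim disjE) (simp_all only: F_grid, blast+)
    also have "\<dots> = ({p, q} \<in> C)" using f g by simp
    finally show ?thesis .
  qed
  have F_path: "F p = F q" if "(p, q) \<in> r\<^sup>*" for p q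
    using that
  proof (induction rule: rtrancl_induct)
    case (step q q')
    then have "{q, q'} \<in> edges_in \<Lambda>" "{q, q'} \<notin> C"
      using closed CCut by (auto simp: r_def open_adj_def)
    then show ?case using step F_edge by blast
  qed simp
  obtain gs gb where gs: "s = grid_pt M gs" "\<forall>k. gs k \<le> 2 * M" and gb: "b = grid_pt M gb" "\<forall>k. gb k \<le> 2 * M"
  proof -
    have "s \<in> \<Lambda> \<inter> int_lattice" "b \<in> \<Lambda> \<inter> int_lattice"
      using xy(2,3) by (auto simp: top_face_iff bottom_face_iff)
    then show ?thesis using that unfolding box_vertices by blast
  qed
  have "f gs = f gb"
  proof (rule const_on_boundary[where v = v])
    show "gs v = 2 * M" using xy(2) by (auto simp: top_face_iff gs grid_pt_def)
    show "gb v = 0" using xy(3) by (auto simp: bottom_face_iff gb grid_pt_def)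
    fix g :: "'d \<Rightarrow> nat" and i j
    assume g: "\<forall>k. g k \<le> 2 * M" "g i < 2 * M" "j \<noteq> i" "g j = 0 \<or> g j = 2 * M"
    then have "\<bar>grid_pt M g $ j\<bar> = real M" by (auto simp: grid_pt_def)
    then have "grid_edge M g i \<notin> C" using no_boundary[of "grid_edge M g i" "grid_pt M g" j] by (auto simp: grid_edge_def)
    then show "f g = f (g(i := Suc (g i)))" using f g by blast
  qed (use gs gb in auto)
  then have "F s = F b" by (simp add: gs gb F_grid)
  moreover have "F x \<noteq> F y"
    using F_edge[of x y] eE xy(1) by (auto simp: C_def)
  ultimately show False using F_path[OF xy(4)] F_path[OF xy(5)] by simp
qed

end

section \<open>Space-time paths\<close>

text \<open>
  The condition is on the last draw of \<open>g\<close> in the time interval from \<open>s\<close> (exclusive) to \<open>w\<close>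
  (inclusive), and it is vacuously true if there is no such draw. A draw is a pair of an edge and the
  value of its coin.
\<close>

definition last_draw_closed :: "(nat \<Rightarrow> 'e \<times> bool) \<Rightarrow> nat \<Rightarrow> nat \<Rightarrow> 'e \<Rightarrow> bool" where
  "last_draw_closed \<nu> s w g \<longleftrightarrow>
     (\<forall>u. s < u \<longrightarrow> u \<le> w \<longrightarrow> fst (\<nu> u) = g \<longrightarrow> (\<forall>u'. u < u' \<longrightarrow> u' \<le> w \<longrightarrow> fst (\<nu> u') \<noteq> g) \<longrightarrow> \<not> snd (\<nu> u))"

text \<open>
  The second component of the coupling is a Markov chain in its own right; this is its update.
\<close>

definition conditioned_step :: "'d \<Rightarrow> (real ^ 'd) set \<Rightarrow> (real ^ 'd) set \<times> bool \<Rightarrow> 'd config \<Rightarrow> 'd config" where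
  "conditioned_step v \<Lambda> n y =
     y(fst n := snd n \<and> \<not> top_bottom_connected v \<Lambda> (y(fst n := True)))"

definition conditioned_path ::
    "'d \<Rightarrow> (real ^ 'd) set \<Rightarrow> nat \<Rightarrow> (nat \<Rightarrow> (real ^ 'd) set \<times> bool) \<Rightarrow> (nat \<Rightarrow> 'd config) \<Rightarrow> bool" where
  "conditioned_path v \<Lambda> T \<nu> ys \<longleftrightarrow>
     (\<forall>t<T. ys (Suc t) = conditioned_step v \<Lambda> (\<nu> (Suc t)) (ys t)) \<and>
     (\<forall>t\<le>T. \<not> top_bottom_connected v \<Lambda> (ys t))"

text \<open>
  The constraint can overrule the coin only at an edge that is pivotal just before the update. At
  the other edges the coin of the last draw is the current state.
\<close>

lemma last_draw_closed_if_never_pivotal: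
  assumes path: "conditioned_path v \<Lambda> T \<nu> ys" and "w \<le> T" and g: "g \<in> edges_in \<Lambda>"
    and closed: "\<not> ys w g" and np: "\<And>q. s \<le> q \<Longrightarrow> q < w \<Longrightarrow> g \<notin> pivotal v \<Lambda> (ys q)"
  shows "last_draw_closed \<nu> s w g"
  unfolding last_draw_closed_def
proof (intro allI impI)
  fix u assume u: "s < u" "u \<le> w" "fst (\<nu> u) = g" and later: "\<forall>u'. u < u' \<longrightarrow> u' \<le> w \<longrightarrow> fst (\<nu> u') \<noteq> g"
  obtain u0 where u0: "u = Suc u0" using u by (cases u) auto
  have step: "ys (Suc q) = conditioned_step v \<Lambda> (\<nu> (Suc q)) (ys q)" if "q < w" for q
    using path \<open>w \<le> T\<close> that by (simp add: conditioned_path_def)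
  have "g \<notin> pivotal v \<Lambda> (ys u0)" using np[of u0] u u0 by auto
  then have drawn: "ys u g = snd (\<nu> u)"
    using step[of u0] u u0 g by (simp add: conditioned_step_def pivotal_def)
  have "ys q g = ys u g" if "u \<le> q" "q \<le> w" for q
    using that
  proof (induction q rule: dec_induct)
    case (step q)
    then have "fst (\<nu> (Suc q)) \<noteq> g" using later by simp
    moreover have "ys (Suc q) = conditioned_step v \<Lambda> (\<nu> (Suc q)) (ys q)"
      using path \<open>w \<le> T\<close> step.prems by (simp add: conditioned_path_def)
    ultimately show ?case
      using step by (simp add: conditioned_step_def)
  qed simp
  from this[of w] show "\<not> snd (\<nu> u)" using drawn closed u by simp
qed

text \<open>
  A path of minimal length visits no edge twice: between two visits of the same edge it could be cut
  short, and the later times remain smaller than the earlier ones. Distinctness of the edges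
  is what makes their draws behave independently.
\<close>

lemma rtrancl_simple_path:
  assumes "((e, w), (g, w')) \<in> {((g, w), (g', w')). adj g g' \<and> w' \<le> w \<and> valid g' w'}\<^sup>*" "valid e w"
  shows "\<exists>n G W. G 0 = e \<and> G n = g \<and> (\<forall>i<n. adj (G i) (G (Suc i)) \<and> W (Suc i) \<le> (W i :: nat)) \<and>
     (\<forall>i\<le>n. valid (G i) (W i)) \<and> inj_on G {..n}"
proof -
  define P where "P n = (\<exists>G W. G 0 = e \<and> G n = g \<and> (\<forall>i<n. adj (G i) (G (Suc i)) \<and> W (Suc i) \<le> W i) \<and>
     (\<forall>i\<le>n. valid (G i) (W i)))" for n
  have "\<exists>n G W. G 0 = e \<and> G n = fst z \<and> W n = snd z \<and> (\<forall>i<n. adj (G i) (G (Suc i)) \<and> W (Suc i) \<le> W i) \<and>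
     (\<forall>i\<le>n. valid (G i) (W i))" if "((e, w), z) \<in> {((g, w), (g', w')). adj g g' \<and> w' \<le> w \<and> valid g' w'}\<^sup>*" for z
    using that
  proof (induction rule: rtrancl_induct)
    case base
    show ?case by (intro exI[of _ 0] exI[of _ "\<lambda>_. e"] exI[of _ "\<lambda>_. w"]) (use assms in auto)
  next
    case (step y z)
    then obtain n G W where G: "G 0 = e" "G n = fst y" "W n = snd y"
      "\<forall>i<n. adj (G i) (G (Suc i)) \<and> W (Suc i) \<le> W i" "\<forall>i\<le>n. valid (G i) (W i)" by blast
    have z: "adj (fst y) (fst z)" "snd z \<le> snd y" "valid (fst z) (snd z)" using step by auto
    have "(\<forall>i<Suc n. adj ((G(Suc n := fst z)) i) ((G(Suc n := fst z)) (Suc i)) \<and>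
        (W(Suc n := snd z)) (Suc i) \<le> (W(Suc n := snd z)) i)"
      using G z by (auto simp: less_Suc_eq)
    moreover have "\<forall>i\<le>Suc n. valid ((G(Suc n := fst z)) i) ((W(Suc n := snd z)) i)"
      using G z by (auto simp: le_Suc_eq)
    ultimately show ?case using G(1)
      by (intro exI[of _ "Suc n"] exI[of _ "G(Suc n := fst z)"] exI[of _ "W(Suc n := snd z)"]) simp
  qed
  from this[OF assms(1)] obtain n0 G0 W0 where "G0 0 = e" "G0 n0 = fst (g, w')" "W0 n0 = snd (g, w')"
    "\<forall>i<n0. adj (G0 i) (G0 (Suc i)) \<and> W0 (Suc i) \<le> W0 i" "\<forall>i\<le>n0. valid (G0 i) (W0 i)"
    by (elim exE conjE) (rule that)
  then have "P n0" unfolding P_def by (intro exI[of _ G0] exI[of _ W0] conjI) simp_all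
  then have "\<exists>n. P n" ..
  define n where "n = (LEAST n. P n)"
  have "P n" unfolding n_def using \<open>\<exists>n. P n\<close> by (rule LeastI_ex)
  have least: "\<not> P m" if "m < n" for m using that not_less_Least unfolding n_def by blast
  obtain G W where G: "G 0 = e" "G n = g" "\<forall>i<n. adj (G i) (G (Suc i)) \<and> W (Suc i) \<le> W i"
    "\<forall>i\<le>n. valid (G i) (W i)" using \<open>P n\<close> unfolding P_def by (elim exE conjE) (rule that)
  have "G i \<noteq> G j" if ij: "i < j" "j \<le> n" for i j
  proof
    assume eq: "G i = G j"
    define c where "c = j - i"
    have c: "j = i + c" "c > 0" using ij by (auto simp: c_def)
    have "W q \<le> W i" if "i \<le> q" "q \<le> n" for q
      using that
    proof (induction q rule: dec_induct)
      case (step q)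
      then have "W (Suc q) \<le> W q" using G(3) by auto
      then show ?case using step by simp
    qed simp
    then have "W j \<le> W i" using ij by simp
    \<comment> \<open>Cut out the piece between the two visits; the edge visited twice keeps the time of its second visit, which is the smaller one.\<close>
    define G' where "G' k = (if k \<le> i then G k else G (k + c))" for k
    define W' where "W' k = (if k < i then W k else W (k + c))" for k
    have "G' 0 = e" using G by (simp add: G'_def)
    moreover have "G' (n - c) = g"
    proof (cases "n = j")
      case True
      then show ?thesis using G(2) eq c by (simp add: G'_def)
    next
      case False
      then have "\<not> n - c \<le> i" "n - c + c = n" using ij c by auto
      then show ?thesis using G(2) by (simp add: G'_def)
    qed
    moreover have "\<forall>k<n - c. adj (G' k) (G' (Suc k)) \<and> W' (Suc k) \<le> W' k"
    proof (intro allI impI)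
      fix k assume k: "k < n - c"
      consider "Suc k < i" | "Suc k = i" | "k = i" | "i < k" by linarith
      then show "adj (G' k) (G' (Suc k)) \<and> W' (Suc k) \<le> W' k"
      proof cases
        case 1
        then show ?thesis using G(3) k by (simp add: G'_def W'_def)
      next
        case 2
        have "adj (G k) (G (Suc k))" "W (Suc k) \<le> W k" using G(3) k by auto
        then show ?thesis using 2 \<open>W j \<le> W i\<close> c by (auto simp: G'_def W'_def)
      next
        case 3
        have "adj (G (k + c)) (G (Suc (k + c))) \<and> W (Suc (k + c)) \<le> W (k + c)" using G(3) k by auto
        then show ?thesis using 3 c eq by (auto simp: G'_def W'_def)
      next
        case 4
        have "adj (G (k + c)) (G (Suc (k + c))) \<and> W (Suc (k + c)) \<le> W (k + c)" using G(3) k by auto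
        then show ?thesis using 4 by (auto simp: G'_def W'_def)
      qed
    qed
    moreover have "\<forall>k\<le>n - c. valid (G' k) (W' k)"
    proof (intro allI impI)
      fix k assume k: "k \<le> n - c"
      have k2: "k + c \<le> n" "k \<le> n" using k ij c by auto
      show "valid (G' k) (W' k)"
      proof (cases "k = i")
        case True
        then show ?thesis using G(4) c ij eq by (auto simp: G'_def W'_def)
      next
        case False
        then show ?thesis using G(4) k2 by (auto simp: G'_def W'_def)
      qed
    qed
    ultimately have "P (n - c)" unfolding P_def by (intro exI[of _ G'] exI[of _ W'] conjI)
    moreover have "n - c < n" using c ij by auto
    ultimately show False using least by blast
  qed
  then have "inj_on G {..n}"
    by (intro linorder_inj_onI) auto
  with G show ?thesis by (intro exI[of _ n] exI[of _ G] exI[of _ W] conjI)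
qed

context lattice_box
begin

text \<open>
  Induction on the time \<open>w\<close> at which \<open>e\<close> is first pivotal. Along the cut through \<open>e\<close> at time \<open>w\<close>,
  consider the first edge outside the set \<open>Q\<close> of edges of the region \<open>D\<close> that have not been pivotal
  before \<open>w\<close>. Either it is outside the region, or it was pivotal at an earlier time, and the
  induction hypothesis applies to it at the first such time.
\<close>

lemma spacetime_path_leaves_quiet_region:
  fixes v :: 'd
  assumes path: "conditioned_path v \<Lambda> T \<nu> ys"
    and bd: "\<And>h y i. h \<in> edges_in \<Lambda> \<Longrightarrow> y \<in> h \<Longrightarrow> \<bar>y $ i\<bar> = real M \<Longrightarrow> h \<notin> D"
    and quiet: "\<And>q g. s \<le> q \<Longrightarrow> q \<le> t \<Longrightarrow> g \<in> D \<Longrightarrow> g \<notin> pivotal v \<Lambda> (ys q)"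
    and valid: "valid = (\<lambda>g w. g \<in> edges_in \<Lambda> \<and> t < w \<and> w \<le> T \<and> last_draw_closed \<nu> s w g)"
    and e: "e \<in> D" "e \<in> pivotal v \<Lambda> (ys w)" "\<And>q. s \<le> q \<Longrightarrow> q < w \<Longrightarrow> e \<notin> pivotal v \<Lambda> (ys q)"
      "t < w" "w \<le> T"
  shows "valid e w \<and> (\<exists>g w' h. ((e, w), (g, w')) \<in> {((g, w), (g', w')). star_adj g g' \<and> w' \<le> w \<and> valid g' w'}\<^sup>* \<and>
      valid g w' \<and> star_adj g h \<and> h \<in> edges_in \<Lambda> \<and> h \<notin> D)"
  using e
proof (induction w arbitrary: e rule: less_induct)
  case (less w)
  define R where "R = {((g, w), (g', w')). star_adj g g' \<and> w' \<le> w \<and> valid g' w'}"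
  have nc: "\<not> top_bottom_connected v \<Lambda> (ys w)" using path less.prems by (simp add: conditioned_path_def)
  have eE: "e \<in> edges_in \<Lambda>" using less.prems by (simp add: pivotal_def)
  have "\<not> ys w e"
  proof
    assume "ys w e"
    then have "(ys w)(e := True) = ys w" by (simp add: fun_upd_idem)
    then show False using nc less.prems by (simp add: pivotal_def)
  qed
  define S where "S = {(a, b). star_adj a b \<and> a \<in> edges_in \<Lambda> \<and> b \<in> edges_in \<Lambda> \<and> \<not> ys w a \<and> \<not> ys w b}"
  define Q where "Q = {g \<in> D. g \<in> edges_in \<Lambda> \<and> \<not> ys w g \<and> (\<forall>q. s \<le> q \<longrightarrow> q < w \<longrightarrow> g \<notin> pivotal v \<Lambda> (ys q))}"
  have Q_valid: "valid g w" if "g \<in> Q" for g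
    using last_draw_closed_if_never_pivotal[OF path, of w g s] that less.prems by (simp add: valid Q_def)
  have "e \<in> Q" using less.prems eE \<open>\<not> ys w e\<close> by (simp add: Q_def)
  obtain h where h: "(e, h) \<in> S\<^sup>*" "h \<in> edges_in \<Lambda>" "\<exists>y\<in>h. \<exists>i. \<bar>y $ i\<bar> = real M"
    using closed_star_path_to_boundary[OF nc less.prems(2)] unfolding S_def by blast
  then have "h \<notin> Q" using bd by (auto simp: Q_def)
  then obtain a b where ab: "(e, a) \<in> (S \<inter> Q \<times> Q)\<^sup>*" "a \<in> Q" "(a, b) \<in> S" "b \<notin> Q"
    using rtrancl_exit[OF h(1) \<open>e \<in> Q\<close>] by blast
  have lift: "((e, w), (k, w)) \<in> R\<^sup>*" if "(e, k) \<in> (S \<inter> Q \<times> Q)\<^sup>*" for k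
    using that
  proof (induction rule: rtrancl_induct)
    case (step k k')
    then have "((k, w), (k', w)) \<in> R" using Q_valid by (auto simp: R_def S_def)
    then show ?case using step by simp
  qed simp
  have b: "star_adj a b" "b \<in> edges_in \<Lambda>" "\<not> ys w b" using ab by (auto simp: S_def)
  show ?case
  proof (cases "b \<in> D")
    case False
    then show ?thesis using lift[OF ab(1)] Q_valid[OF ab(2)] Q_valid[OF \<open>e \<in> Q\<close>] b unfolding R_def by blast
  next
    case True
    define earlier where "earlier q \<longleftrightarrow> s \<le> q \<and> q < w \<and> b \<in> pivotal v \<Lambda> (ys q)" for q
    have ex: "\<exists>q. earlier q" using ab(4) True b by (auto simp: Q_def earlier_def)
    define w' where "w' = (LEAST q. earlier q)"
    have w': "earlier w'" unfolding w'_def using ex by (rule LeastI_ex)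
    have first: "\<not> earlier q" if "q < w'" for q using that not_less_Least unfolding w'_def by blast
    have "t < w'" using quiet[of w' b] w' True by (meson earlier_def not_less)
    have "valid b w' \<and> (\<exists>g u h. ((b, w'), (g, u)) \<in> R\<^sup>* \<and> valid g u \<and> star_adj g h \<and> h \<in> edges_in \<Lambda> \<and> h \<notin> D)"
      unfolding R_def
    proof (rule less.IH)
      show "b \<notin> pivotal v \<Lambda> (ys q)" if "s \<le> q" "q < w'" for q
        using first[of q] that w' by (auto simp: earlier_def)
    qed (use w' True \<open>t < w'\<close> less.prems in \<open>auto simp: earlier_def\<close>)
    then obtain g u h where g: "valid b w'" "((b, w'), (g, u)) \<in> R\<^sup>*" "valid g u" "star_adj g h" "h \<in> edges_in \<Lambda>" "h \<notin> D"
      by blast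
    have "((a, w), (b, w')) \<in> R" using b g w' by (simp add: R_def earlier_def)
    then have "((e, w), (g, u)) \<in> R\<^sup>*" using lift[OF ab(1)] g(2) by (meson converse_rtrancl_into_rtrancl rtrancl_trans)
    then show ?thesis using g Q_valid[OF \<open>e \<in> Q\<close>] unfolding R_def by blast
  qed
qed

end

section \<open>Certificates for long space-time paths\<close>

text \<open>
  Some edge pivotal during \<open>I\<close> has a point at depth \<open>l\<close> in the box and at distance at least \<open>l / 2\<close>
  from the endpoints of all edges pivotal during \<open>J\<close>. One half leaves room: a distance at least
  \<open>l\<close> between the two unions only gives a witness for each radius below \<open>l\<close>.
\<close>

definition strays :: "'d \<Rightarrow> (real ^ 'd) set \<Rightarrow> real \<Rightarrow> (nat \<Rightarrow> 'd config) \<Rightarrow> nat set \<Rightarrow> nat set \<Rightarrow> bool" where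
  "strays v \<Lambda> l ys I J \<longleftrightarrow>
     (\<exists>r\<in>I. \<exists>e\<in>pivotal v \<Lambda> (ys r). \<exists>x\<in>convex hull e. x \<notin> neighbourhood (- \<Lambda>) l \<and>
        (\<forall>q\<in>J. \<forall>g\<in>pivotal v \<Lambda> (ys q). \<forall>y\<in>g. l / 2 \<le> dist x y))"

lemma not_in_neighbourhood_dist:
  assumes "x \<notin> neighbourhood A r" "y \<in> A"
  shows "r \<le> dist x y"
proof -
  have "ereal r \<le> dist_to_set x A" using assms(1) by (simp add: neighbourhood_def)
  also have "\<dots> \<le> ereal (dist x y)" unfolding dist_to_set_def using assms(2) by (rule INF_lower)
  finally show ?thesis by simp
qed

lemma hausdorff_inner_large_strays:
  assumes "ereal l \<le> hausdorff_inner \<Lambda> l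
      (edges_support (\<Union>r\<in>I. pivotal v \<Lambda> (ys r))) (edges_support (\<Union>q\<in>J. pivotal v \<Lambda> (ys q)))"
    and "l > 0"
  shows "strays v \<Lambda> l ys I J \<or> strays v \<Lambda> l ys J I"
proof (rule ccontr)
  assume no: "\<not> ?thesis"
  define A where "A I = edges_support (\<Union>r\<in>I. pivotal v \<Lambda> (ys r))" for I
  have sub: "A I - neighbourhood (- \<Lambda>) l \<subseteq> neighbourhood (A J) (l / 2)"
    if ns: "\<not> strays v \<Lambda> l ys I J" for I J
  proof
    fix x assume x: "x \<in> A I - neighbourhood (- \<Lambda>) l"
    then obtain r e where re: "r \<in> I" "e \<in> pivotal v \<Lambda> (ys r)" "x \<in> convex hull e"
      by (auto simp: A_def edges_support_def)
    then obtain q g y where q: "q \<in> J" "g \<in> pivotal v \<Lambda> (ys q)" "y \<in> g" "dist x y < l / 2"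
      using ns x unfolding strays_def by (meson DiffD2 not_le)
    have "y \<in> A J" using q hull_subset[of g convex] by (auto simp: A_def edges_support_def)
    then show "x \<in> neighbourhood (A J) (l / 2)" using not_in_neighbourhood_dist q(4) by (meson not_le)
  qed
  have "hausdorff_inner \<Lambda> l (A I) (A J) \<le> ereal (l / 2)"
    unfolding hausdorff_inner_def using sub[of I J] sub[of J I] no \<open>l > 0\<close> by (intro Inf_lower) auto
  then have "ereal l \<le> ereal (l / 2)" using assms(1) unfolding A_def by (rule order_trans[rotated])
  then show False using \<open>l > 0\<close> by simp
qed

lemma square_edges_vertex:
  assumes "e \<in> square_edges x i j" "p \<in> e"
  shows "\<exists>\<alpha> \<beta>. \<alpha> \<in> {0, 1} \<and> \<beta> \<in> {0, 1 :: real} \<and> p = x + \<alpha> *\<^sub>R axis i 1 + \<beta> *\<^sub>R axis j 1"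
proof -
  have "p \<in> {x, x + axis i 1, x + axis j 1, x + axis i 1 + axis j 1}"
    using assms by (auto simp: square_edges_def)
  then show ?thesis
  proof (elim insertE emptyE)
    assume "p = x" then show ?thesis by (intro exI[of _ 0]) auto
  next
    assume "p = x + axis i 1" then show ?thesis by (intro exI[of _ 1] exI[of _ 0]) auto
  next
    assume "p = x + axis j 1" then show ?thesis by (intro exI[of _ 0] exI[of _ 1]) auto
  next
    assume "p = x + axis i 1 + axis j 1" then show ?thesis by (intro exI[of _ 1] exI[of _ 1]) auto
  qed
qed

lemma dist_star_adj:
  fixes e e' :: "(real ^ 'd::finite) set"
  assumes "star_adj e e'" "p \<in> e" "q \<in> e'"
  shows "dist p q \<le> 2"
proof -
  obtain x and i j :: 'd where "e \<in> square_edges x i j" "e' \<in> square_edges x i j"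
    using assms(1) by (auto simp: star_adj_def)
  then obtain \<alpha> \<beta> \<alpha>' \<beta>' where 1: "\<alpha> \<in> {0, 1}" "\<beta> \<in> {0, 1 :: real}" "p = x + \<alpha> *\<^sub>R axis i 1 + \<beta> *\<^sub>R axis j 1"
    and 2: "\<alpha>' \<in> {0, 1}" "\<beta>' \<in> {0, 1 :: real}" "q = x + \<alpha>' *\<^sub>R axis i 1 + \<beta>' *\<^sub>R axis j 1"
    using square_edges_vertex assms(2,3) by metis
  have "p - q = (\<alpha> - \<alpha>') *\<^sub>R axis i 1 + (\<beta> - \<beta>') *\<^sub>R axis j 1"
    using 1 2 by (simp add: algebra_simps)
  also have "norm \<dots> \<le> \<bar>\<alpha> - \<alpha>'\<bar> + \<bar>\<beta> - \<beta>'\<bar>"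
    by (rule order_trans[OF norm_triangle_ineq]) (simp add: norm_axis_1)
  also have "\<dots> \<le> 1 + 1" using 1 2 by (intro add_mono) auto
  finally show ?thesis by (simp add: dist_norm)
qed

text \<open>
  A neighbour is determined by the two directions of the square, the corner at which a chosen
  vertex of \<open>e\<close> sits, and the side of the square.
\<close>

lemma card_star_adj:
  fixes e :: "(real ^ 'd::finite) set"
  assumes "e \<noteq> {}"
  shows "finite {e'. star_adj e e'}" "card {e'. star_adj e e'} \<le> 16 * CARD('d)\<^sup>2"
proof -
  obtain y where y: "y \<in> e" using assms by blast
  define sh where "sh i j k = (if k = 0 then 0 else if k = 1 then axis i 1 else if k = (2::nat) then axis j 1
      else axis i 1 + axis j 1 :: real ^ 'd)" for i j k
  define ed where "ed x i j m = (if m = 0 then {x, x + axis i 1} else if m = 1 then {x, x + axis j 1}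
      else if m = (2::nat) then {x + axis i 1, x + axis i 1 + axis j 1}
      else {x + axis j 1, x + axis i 1 + axis j 1})" for x :: "real ^ 'd" and i j m
  define F where "F = (\<lambda>((i, j), (k, m)). ed (y - sh i j k) i j m)"
  define S where "S = ((UNIV :: 'd set) \<times> (UNIV :: 'd set)) \<times> ({..<4::nat} \<times> {..<4::nat})"
  have sub: "{e'. star_adj e e'} \<subseteq> F ` S"
  proof
    fix e' assume "e' \<in> {e'. star_adj e e'}"
    then obtain x i j where x: "e \<in> square_edges x i j" "e' \<in> square_edges x i j"
      by (auto simp: star_adj_def)
    have "y \<in> {x, x + axis i 1, x + axis j 1, x + axis i 1 + axis j 1}"
      using x(1) y by (auto simp: square_edges_def)
    then have "\<exists>k\<in>{0,1,2,3}. y = x + sh i j k" by (auto simp: sh_def)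
    then obtain k where k: "k \<in> {0,1,2,3}" "y = x + sh i j k" by blast
    have "\<exists>m\<in>{0,1,2,3}. e' = ed x i j m" using x(2) by (auto simp: ed_def square_edges_def)
    then obtain m where m: "m \<in> {0,1,2,3}" "e' = ed x i j m" by blast
    have "e' = F ((i, j), (k, m))" using k m by (simp add: F_def)
    moreover have "((i, j), (k, m)) \<in> S" using k m by (auto simp: S_def)
    ultimately show "e' \<in> F ` S" by blast
  qed
  have fin: "finite S" by (simp add: S_def)
  then show "finite {e'. star_adj e e'}" using sub finite_surj by blast
  have "card {e'. star_adj e e'} \<le> card (F ` S)" using sub fin by (intro card_mono) auto
  also have "\<dots> \<le> card S" using fin by (rule card_image_le)
  also have "\<dots> = 16 * CARD('d)\<^sup>2" by (simp add: S_def card_cartesian_product power2_eq_square)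
  finally show "card {e'. star_adj e e'} \<le> 16 * CARD('d)\<^sup>2" .
qed

lemma card_successively_lists:
  assumes fin: "finite E" and nb: "\<And>y. y \<in> E \<Longrightarrow> card {x \<in> E. adj x y} \<le> D"
  shows "card {xs. length xs = Suc n \<and> set xs \<subseteq> E \<and> successively adj xs} \<le> card E * D ^ n"
proof -
  define L where "L n = {xs. length xs = n \<and> set xs \<subseteq> E \<and> successively adj xs}" for n
  have finL: "finite (L n)" for n
    by (rule finite_subset[OF _ finite_lists_length_eq[OF fin, of n]]) (auto simp: L_def)
  have "card (L (Suc n)) \<le> card E * D ^ n"
  proof (induction n)
    case 0
    have "L (Suc 0) \<subseteq> (\<lambda>x. [x]) ` E" by (auto simp: L_def length_Suc_conv)
    then have "card (L (Suc 0)) \<le> card ((\<lambda>x. [x]) ` E)" using fin by (intro card_mono) auto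
    also have "\<dots> \<le> card E" using fin by (rule card_image_le)
    finally show ?case by simp
  next
    case (Suc n)
    have "L (Suc (Suc n)) \<subseteq> (\<Union>ys\<in>L (Suc n). (\<lambda>x. x # ys) ` {x \<in> E. adj x (hd ys)})"
    proof
      fix xs assume "xs \<in> L (Suc (Suc n))"
      then obtain x y zs where "xs = x # y # zs" "y # zs \<in> L (Suc n)" "x \<in> E" "adj x y"
        by (auto simp: L_def length_Suc_conv)
      then show "xs \<in> (\<Union>ys\<in>L (Suc n). (\<lambda>x. x # ys) ` {x \<in> E. adj x (hd ys)})"
        by (intro UN_I[of "y # zs"]) auto
    qed
    then have "card (L (Suc (Suc n))) \<le> card (\<Union>ys\<in>L (Suc n). (\<lambda>x. x # ys) ` {x \<in> E. adj x (hd ys)})"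
      using fin finL by (intro card_mono) auto
    also have "\<dots> \<le> (\<Sum>ys\<in>L (Suc n). card ((\<lambda>x. x # ys) ` {x \<in> E. adj x (hd ys)}))"
      using finL by (rule card_UN_le)
    also have "\<dots> \<le> (\<Sum>ys\<in>L (Suc n). D)"
    proof (rule sum_mono)
      fix ys assume "ys \<in> L (Suc n)"
      then have "hd ys \<in> E" by (auto simp: L_def length_Suc_conv)
      then have "card {x \<in> E. adj x (hd ys)} \<le> D" by (rule nb)
      moreover have "card ((\<lambda>x. x # ys) ` {x \<in> E. adj x (hd ys)}) \<le> card {x \<in> E. adj x (hd ys)}"
        using fin by (intro card_image_le) auto
      ultimately show "card ((\<lambda>x. x # ys) ` {x \<in> E. adj x (hd ys)}) \<le> D" by simp
    qed
    also have "\<dots> = card (L (Suc n)) * D" by simp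
    also have "\<dots> \<le> card E * D ^ n * D" using Suc by (intro mult_right_mono) auto
    finally show ?case by (simp add: mult_ac)
  qed
  then show ?thesis unfolding L_def .
qed

text \<open>
  Along a space-time path only the block of time steps containing each time is recorded. Monotonicity
  keeps the number of such records exponential in the length of the path, where arbitrary
  sequences would cost a factor equal to the number of blocks for each edge.
\<close>

definition nonincreasing_lists :: "nat \<Rightarrow> nat \<Rightarrow> nat list set" where
  "nonincreasing_lists n K = {bs. length bs = n \<and> sorted_wrt (\<ge>) bs \<and> set bs \<subseteq> {..<K}}"

lemma finite_nonincreasing_lists: "finite (nonincreasing_lists n K)"
  by (rule finite_subset[OF _ finite_lists_length_eq[of "{..<K}" n]]) (auto simp: nonincreasing_lists_def)

lemma card_nonincreasing_lists: "card (nonincreasing_lists n K) \<le> 2 ^ (n + K)"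
proof (induction n arbitrary: K)
  case 0
  have "nonincreasing_lists 0 K \<subseteq> {[]}" by (auto simp: nonincreasing_lists_def)
  then have "card (nonincreasing_lists 0 K) \<le> card {[] :: nat list}" by (rule card_mono[rotated]) simp
  also have "\<dots> \<le> 2 ^ (0 + K)" by simp
  finally show ?case .
next
  case (Suc n)
  show ?case
  proof (induction K)
    case 0
    have "nonincreasing_lists (Suc n) 0 = {}" by (auto simp: nonincreasing_lists_def)
    then show ?case by simp
  next
    case (Suc K)
    have "nonincreasing_lists (Suc n) (Suc K) \<subseteq>
        (\<lambda>bs. K # bs) ` nonincreasing_lists n (Suc K) \<union> nonincreasing_lists (Suc n) K"
    proof
      fix xs assume xs: "xs \<in> nonincreasing_lists (Suc n) (Suc K)"
      then obtain b bs where b: "xs = b # bs" by (auto simp: nonincreasing_lists_def length_Suc_conv)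
      show "xs \<in> (\<lambda>bs. K # bs) ` nonincreasing_lists n (Suc K) \<union> nonincreasing_lists (Suc n) K"
      proof (cases "b = K")
        case True
        then show ?thesis using xs b by (auto simp: nonincreasing_lists_def)
      next
        case False
        then have "b < K" using xs b by (auto simp: nonincreasing_lists_def)
        moreover have "\<forall>c\<in>set bs. c \<le> b" using xs b by (auto simp: nonincreasing_lists_def)
        ultimately have "set xs \<subseteq> {..<K}" using b by auto
        then show ?thesis using xs by (auto simp: nonincreasing_lists_def)
      qed
    qed
    then have "card (nonincreasing_lists (Suc n) (Suc K)) \<le>
        card ((\<lambda>bs. K # bs) ` nonincreasing_lists n (Suc K) \<union> nonincreasing_lists (Suc n) K)"
      by (intro card_mono) (auto simp: finite_nonincreasing_lists)
    also have "\<dots> \<le> card ((\<lambda>bs. K # bs) ` nonincreasing_lists n (Suc K)) + card (nonincreasing_lists (Suc n) K)"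
      by (rule card_Un_le)
    also have "\<dots> \<le> card (nonincreasing_lists n (Suc K)) + card (nonincreasing_lists (Suc n) K)"
      by (intro add_mono card_image_le finite_nonincreasing_lists order_refl)
    also have "\<dots> \<le> 2 ^ (n + Suc K) + 2 ^ (Suc n + K)"
      by (intro add_mono Suc.IH \<open>\<And>K. card (nonincreasing_lists n K) \<le> 2 ^ (n + K)\<close>)
    also have "\<dots> = 2 ^ (Suc n + Suc K)" by simp
    finally show ?case .
  qed
qed

text \<open>
  At time \<open>z\<close> the edge \<open>g\<close> is drawn with a closing coin, and it is not drawn again up to \<open>w\<close>; the
  value \<open>z = s\<close> encodes that \<open>g\<close> is not drawn at all between \<open>s\<close> and \<open>w\<close>. The time \<open>w\<close> will be the
  beginning of a block; if \<open>z\<close> falls inside the block, the second condition is empty. For fixed \<open>z\<close> this is a constraint on each draw separately.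
\<close>

definition closing_certificate :: "(nat \<Rightarrow> 'e \<times> bool) \<Rightarrow> nat \<Rightarrow> nat \<Rightarrow> 'e \<Rightarrow> nat \<Rightarrow> bool" where
  "closing_certificate \<nu> s w g z \<longleftrightarrow>
     (s < z \<longrightarrow> \<nu> z = (g, False)) \<and> (\<forall>u. z < u \<longrightarrow> u \<le> w \<longrightarrow> fst (\<nu> u) \<noteq> g)"

lemma last_draw_closed_certificate:
  assumes ldc: "last_draw_closed \<nu> s w g" and w: "s \<le> w0" "w0 \<le> w" "w \<le> w1"
  shows "\<exists>z\<in>{s..w1}. closing_certificate \<nu> s w0 g z"
proof (cases "\<exists>u. s < u \<and> u \<le> w \<and> fst (\<nu> u) = g")
  case False
  then show ?thesis using w by (intro bexI[of _ s]) (auto simp: closing_certificate_def)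
next
  case True
  define P where "P u \<longleftrightarrow> s < u \<and> u \<le> w \<and> fst (\<nu> u) = g" for u
  define z where "z = (GREATEST u. P u)"
  have "P z" unfolding z_def using True by (intro GreatestI_ex_nat[of P w]) (auto simp: P_def)
  have later: "\<not> P u" if "z < u" for u
    using that Greatest_le_nat[of P u w] unfolding z_def by (auto simp: P_def)
  have "fst (\<nu> u) \<noteq> g" if "z < u" "u \<le> w" for u
    using later[OF that(1)] \<open>P z\<close> that by (auto simp: P_def)
  moreover have "\<not> snd (\<nu> z)" using ldc \<open>P z\<close> calculation unfolding last_draw_closed_def P_def by blast
  ultimately show ?thesis using \<open>P z\<close> w
    by (intro bexI[of _ z]) (auto simp: closing_certificate_def P_def prod_eq_iff)
qed

context lattice_box
begin

text \<open>
  Points of the complement of the box lie arbitrarily close to every boundary point.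
\<close>

lemma far_boundary:
  assumes x: "x \<notin> neighbourhood (- \<Lambda>) l" and y: "y \<in> \<Lambda>" "\<bar>y $ i\<bar> = real M"
  shows "l \<le> dist x y"
proof (rule field_le_epsilon)
  fix \<delta> :: real assume "\<delta> > 0"
  define z where "z = y + (sgn (y $ i) * \<delta>) *\<^sub>R axis i 1"
  have "y $ i \<noteq> 0" using y M_pos by auto
  have "z $ i = y $ i + sgn (y $ i) * \<delta>" by (simp add: z_def axis_def)
  then have "\<bar>z $ i\<bar> = real M + \<delta>" using y(2) \<open>\<delta> > 0\<close> \<open>y $ i \<noteq> 0\<close>
    by (cases "y $ i > 0") (auto simp: sgn_real_def)
  then have "z \<in> - \<Lambda>" using \<open>\<delta> > 0\<close> by (auto simp: in_box_iff intro!: exI[of _ i])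
  then have "l \<le> dist x z" using not_in_neighbourhood_dist[OF x] by blast
  also have "\<dots> \<le> dist x y + dist y z" by (rule dist_triangle)
  also have "dist y z = \<delta>"
    using \<open>\<delta> > 0\<close> \<open>y $ i \<noteq> 0\<close> by (simp add: z_def dist_norm norm_axis_1 abs_mult abs_sgn_eq)
  finally show "l \<le> dist x y + \<delta>" .
qed

lemma edge_dist:
  assumes "e \<in> edges_in \<Lambda>" "p \<in> e" "q \<in> e"
  shows "dist p q \<le> 1"
proof -
  obtain a b where "e = {a, b}" "dist a b = 1" using assms(1) by (auto simp: edges_in_def lattice_edges_def)
  then show ?thesis using assms(2,3) by (auto simp: dist_commute)
qed

lemma edge_hull_dist:
  assumes "e \<in> edges_in \<Lambda>" "x \<in> convex hull e" "p \<in> e"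
  shows "dist x p \<le> 1"
proof -
  obtain a b where ab: "e = {a, b}" "dist a b = 1" using assms(1) by (auto simp: edges_in_def lattice_edges_def)
  then have "x \<in> closed_segment a b" using assms(2) by (simp add: segment_convex_hull)
  then have "dist x a \<le> 1" "dist x b \<le> 1" using ab(2) dist_in_closed_segment by metis+
  then show ?thesis using ab assms(3) by auto
qed

text \<open>
  The region is the set of edges with an endpoint at distance less than \<open>l / 2\<close> from \<open>x\<close>. It contains
  no edge at the boundary of the box because \<open>x\<close> has depth \<open>l\<close>. A step between adjacent edges changes
  the distance by at most 2, which bounds the length of a path that leaves the region from below.
\<close>

lemma strays_spacetime_path:
  fixes v :: 'd
  assumes path: "conditioned_path v \<Lambda> T \<nu> ys" and "s \<le> t" "t \<le> T"
    and strays: "strays v \<Lambda> l ys {t..T} {s..t}" and l: "4 * real n + 2 \<le> l" "n \<ge> 1"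
  shows "\<exists>G W. (\<forall>i<n. G i \<in> edges_in \<Lambda> \<and> t < W i \<and> W i \<le> T \<and> last_draw_closed \<nu> s (W i) (G i)) \<and>
      inj_on G {..<n} \<and> (\<forall>i. Suc i < n \<longrightarrow> star_adj (G i) (G (Suc i)) \<and> W (Suc i) \<le> W i)"
proof -
  obtain r e x where r: "r \<in> {t..T}" and e: "e \<in> pivotal v \<Lambda> (ys r)" and x: "x \<in> convex hull e"
    "x \<notin> neighbourhood (- \<Lambda>) l"
    and J: "\<And>q g y. q \<in> {s..t} \<Longrightarrow> g \<in> pivotal v \<Lambda> (ys q) \<Longrightarrow> y \<in> g \<Longrightarrow> l / 2 \<le> dist x y"
    using strays unfolding strays_def by blast
  define D where "D = {g. \<exists>y\<in>g. dist x y < l / 2}"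
  define valid where "valid = (\<lambda>g w. g \<in> edges_in \<Lambda> \<and> t < w \<and> w \<le> T \<and> last_draw_closed \<nu> s w g)"
  have l2: "l > 4" using l by linarith
  have eE: "e \<in> edges_in \<Lambda>" using e by (simp add: pivotal_def)
  then have "e \<noteq> {}" by (auto simp: edges_in_def lattice_edges_def)
  then have "e \<in> D" using edge_hull_dist[OF eE x(1)] l2 by (force simp: D_def)
  have quiet: "g \<notin> pivotal v \<Lambda> (ys q)" if "s \<le> q" "q \<le> t" "g \<in> D" for q g
    using J[of q g] that by (force simp: D_def)
  have bd: "h \<notin> D" if h: "h \<in> edges_in \<Lambda>" "y \<in> h" "\<bar>y $ i\<bar> = real M" for h y i
  proof
    assume "h \<in> D"
    then obtain y' where y': "y' \<in> h" "dist x y' < l / 2" by (auto simp: D_def)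
    have "y \<in> \<Lambda>" using h hull_subset[of h convex] by (auto simp: edges_in_def)
    then have "l \<le> dist x y" using far_boundary x(2) h by blast
    also have "\<dots> \<le> dist x y' + dist y' y" by (rule dist_triangle)
    also have "\<dots> \<le> dist x y' + 1" using edge_dist[OF h(1) y'(1) h(2)] by simp
    finally show False using y' l2 by linarith
  qed
  \<comment> \<open>Start the path at the first time at which \<open>e\<close> is pivotal.\<close>
  define w where "w = (LEAST q. s \<le> q \<and> e \<in> pivotal v \<Lambda> (ys q))"
  have rr: "s \<le> r \<and> e \<in> pivotal v \<Lambda> (ys r)" using r e \<open>s \<le> t\<close> by auto
  have w: "s \<le> w" "e \<in> pivotal v \<Lambda> (ys w)"
    using LeastI[of "\<lambda>q. s \<le> q \<and> e \<in> pivotal v \<Lambda> (ys q)", OF rr] unfolding w_def by auto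
  have "w \<le> r" unfolding w_def using rr by (rule Least_le)
  have first: "e \<notin> pivotal v \<Lambda> (ys q)" if "s \<le> q" "q < w" for q
    using not_less_Least[OF that(2)[unfolded w_def]] that by auto
  have "t < w" using quiet[OF w(1) _ \<open>e \<in> D\<close>] w(2) by (meson not_less)
  have "w \<le> T" using \<open>w \<le> r\<close> r by simp
  obtain g w' h where start: "valid e w"
    and gw: "((e, w), (g, w')) \<in> {((g, w), (g', w')). star_adj g g' \<and> w' \<le> w \<and> valid g' w'}\<^sup>*"
    and h: "star_adj g h" "h \<notin> D" "h \<in> edges_in \<Lambda>"
  proof -
    have "valid e w \<and> (\<exists>g w' h.
        ((e, w), (g, w')) \<in> {((g, w), (g', w')). star_adj g g' \<and> w' \<le> w \<and> valid g' w'}\<^sup>* \<and>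
        valid g w' \<and> star_adj g h \<and> h \<in> edges_in \<Lambda> \<and> h \<notin> D)"
    proof (rule spacetime_path_leaves_quiet_region[OF path _ _ valid_def \<open>e \<in> D\<close> w(2) _ \<open>t < w\<close> \<open>w \<le> T\<close>])
      show "h \<notin> D" if "h \<in> edges_in \<Lambda>" "y \<in> h" "\<bar>y $ i\<bar> = real M" for h y i
        using bd that by blast
      show "g \<notin> pivotal v \<Lambda> (ys q)" if "s \<le> q" "q \<le> t" "g \<in> D" for q g
        using quiet that by blast
      show "e \<notin> pivotal v \<Lambda> (ys q)" if "s \<le> q" "q < w" for q
        using first that by blast
    qed
    then show ?thesis using that by blast
  qed
  obtain m G W where G: "G 0 = e" "G m = g" "\<forall>i<m. star_adj (G i) (G (Suc i)) \<and> W (Suc i) \<le> W i"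
    "\<forall>i\<le>m. valid (G i) (W i)" "inj_on G {..m}"
    using rtrancl_simple_path[OF gw start] by (elim exE conjE) (rule that)
  have dist_G: "\<forall>y\<in>G i. dist x y \<le> 1 + 2 * real i" if "i \<le> m" for i
    using that
  proof (induction i)
    case 0
    then show ?case using edge_hull_dist[OF eE x(1)] G(1) by simp
  next
    case (Suc i)
    then have "valid (G i) (W i)" "star_adj (G i) (G (Suc i))" using G by auto
    then obtain p where p: "p \<in> G i" unfolding valid_def edges_in_def lattice_edges_def by blast
    show ?case
    proof
      fix y assume "y \<in> G (Suc i)"
      have "dist x y \<le> dist x p + dist p y" by (rule dist_triangle)
      also have "dist x p \<le> 1 + 2 * real i" using Suc p by simp
      also have "dist p y \<le> 2" using dist_star_adj p \<open>y \<in> G (Suc i)\<close> \<open>star_adj (G i) (G (Suc i))\<close> by blast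
      finally show "dist x y \<le> 1 + 2 * real (Suc i)" by simp
    qed
  qed
  have "valid (G m) (W m)" using G(4) by blast
  then obtain p where p: "p \<in> G m" unfolding valid_def edges_in_def lattice_edges_def by blast
  obtain y where y: "y \<in> h" using h(3) unfolding edges_in_def lattice_edges_def by blast
  have "l / 2 \<le> dist x y" using h(2) y by (auto simp: D_def)
  also have "\<dots> \<le> dist x p + dist p y" by (rule dist_triangle)
  also have "\<dots> \<le> (1 + 2 * real m) + 2"
    using dist_G[of m] p dist_star_adj[OF h(1)] y G(2) by (intro add_mono) auto
  finally have "2 * real n + 1 \<le> 2 * real m + 3" using l by linarith
  then have "n \<le> Suc m" by linarith
  have "inj_on G {..<n}" by (rule inj_on_subset[OF G(5)]) (use \<open>n \<le> Suc m\<close> in auto)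
  moreover have "\<forall>i<n. G i \<in> edges_in \<Lambda> \<and> t < W i \<and> W i \<le> T \<and> last_draw_closed \<nu> s (W i) (G i)"
    using G(4) \<open>n \<le> Suc m\<close> unfolding valid_def by auto
  moreover have "\<forall>i. Suc i < n \<longrightarrow> star_adj (G i) (G (Suc i)) \<and> W (Suc i) \<le> W i"
    using G(3) \<open>n \<le> Suc m\<close> by auto
  ultimately show ?thesis by blast
qed

lemma strays_certified_path:
  fixes v :: 'd
  assumes path: "conditioned_path v \<Lambda> T \<nu> ys" and "s \<le> t" "t \<le> T"
    and strays: "strays v \<Lambda> l ys {t..T} {s..t}" and l: "4 * real n + 2 \<le> l" "n \<ge> 1"
    and L: "L > 0" "T - t \<le> K * L"
  shows "\<exists>gs bs. length gs = n \<and> distinct gs \<and> set gs \<subseteq> edges_in \<Lambda> \<and> successively star_adj gs \<and>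
      bs \<in> nonincreasing_lists n K \<and>
      (\<forall>i<n. \<exists>z\<in>{s..t + (bs ! i + 1) * L}. closing_certificate \<nu> s (t + bs ! i * L) (gs ! i) z)"
proof -
  obtain G W where G: "\<And>i. i < n \<Longrightarrow> G i \<in> edges_in \<Lambda>" "\<And>i. i < n \<Longrightarrow> t < W i" "\<And>i. i < n \<Longrightarrow> W i \<le> T"
      "\<And>i. i < n \<Longrightarrow> last_draw_closed \<nu> s (W i) (G i)"
      "inj_on G {..<n}" and adj: "\<And>i. Suc i < n \<Longrightarrow> star_adj (G i) (G (Suc i))" 
      and dec: "\<And>i. Suc i < n \<Longrightarrow> W (Suc i) \<le> W i"
    using strays_spacetime_path[OF path \<open>s \<le> t\<close> \<open>t \<le> T\<close> strays l] by blast
  \<comment> \<open>Block \<open>k\<close> consists of the times from \<open>t + k * L + 1\<close> to \<open>t + (k + 1) * L\<close>.\<close>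
  define b where "b i = (W i - t - 1) div L" for i
  define gs where "gs = map G [0..<n]"
  define bs where "bs = map b [0..<n]"
  have dec': "W j \<le> W i" if "i \<le> j" "j < n" for i j
    using that
  proof (induction j rule: dec_induct)
    case (step q)
    then show ?case using dec[of q] by simp
  qed simp
  have "sorted_wrt (\<ge>) bs"
    unfolding bs_def sorted_wrt_iff_nth_less b_def
    using dec' by (auto intro!: div_le_mono diff_le_mono)
  moreover have "b i < K" if "i < n" for i
  proof -
    have "W i - t - 1 < K * L" using G(2,3)[OF that] L by linarith
    then show ?thesis using L(1) by (simp add: b_def less_mult_imp_div_less)
  qed
  ultimately have "bs \<in> nonincreasing_lists n K"
    by (auto simp: nonincreasing_lists_def bs_def)
  moreover have "distinct gs" using G(5) by (simp add: gs_def distinct_map atLeast0LessThan)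
  moreover have "successively star_adj gs" using adj by (auto simp: gs_def successively_conv_nth)
  moreover have "set gs \<subseteq> edges_in \<Lambda>" using G(1) by (auto simp: gs_def)
  moreover have "\<exists>z\<in>{s..t + (bs ! i + 1) * L}. closing_certificate \<nu> s (t + bs ! i * L) (gs ! i) z"
    if i: "i < n" for i
  proof -
    have "last_draw_closed \<nu> s (W i) (gs ! i)" using G(4) i by (simp add: gs_def)
    moreover have "s \<le> t + bs ! i * L" using \<open>s \<le> t\<close> by simp
    moreover have "t + bs ! i * L \<le> W i" "W i \<le> t + (bs ! i + 1) * L"
    proof -
      have eq: "W i - t - 1 = bs ! i * L + (W i - t - 1) mod L"
        using i by (simp add: bs_def b_def)
      have "(W i - t - 1) mod L < L" using L by simp
      then show "t + bs ! i * L \<le> W i" "W i \<le> t + (bs ! i + 1) * L"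
        using eq G(2)[OF i] by (auto simp: algebra_simps)
    qed
    ultimately show ?thesis by (rule last_draw_closed_certificate)
  qed
  ultimately show ?thesis by (intro exI[of _ gs] exI[of _ bs]) (simp add: gs_def)
qed

end

section \<open>Probability of the certificates\<close>

lemma one_minus_inverse_power_ge:
  fixes N :: nat
  assumes "N \<ge> 2"
  shows "1 / 4 \<le> (1 - 1 / real N) ^ (N - 1)"
proof -
  have pos: "1 - 1 / real N > 0" using assms by simp
  have "1 / (1 - 1 / real N) = 1 + 1 / real (N - 1)"
    using assms by (simp add: field_simps of_nat_diff)
  also have "\<dots> \<le> exp (1 / real (N - 1))" by (rule exp_ge_add_one_self)
  finally have "(1 / (1 - 1 / real N)) ^ (N - 1) \<le> exp (1 / real (N - 1)) ^ (N - 1)"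
    using pos by (intro power_mono) auto
  also have "\<dots> = exp 1" using assms by (simp flip: exp_of_nat_mult)
  also have "\<dots> \<le> 4" using exp_le by simp
  finally have "1 / (1 - 1 / real N) ^ (N - 1) \<le> 4" by (simp add: power_one_over)
  then show ?thesis using pos by (simp add: field_simps)
qed

text \<open>
  The sum over the possible times of a last draw: each later time step without a draw of the edge
  contributes a factor \<open>r\<close>.
\<close>

lemma sum_geometric_le:
  fixes r :: real
  assumes "0 \<le> r" "r < 1"
  shows "(\<Sum>z\<in>{s<..w}. r ^ (w - z)) \<le> 1 / (1 - r)"
proof -
  have "(\<Sum>z\<in>{s<..w}. r ^ (w - z)) = (\<Sum>j<w - s. r ^ j)"
    by (rule sum.reindex_bij_witness[where i = "\<lambda>j. w - j" and j = "\<lambda>z. w - z"]) auto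
  also have "\<dots> \<le> 1 / (1 - r)"
    using assms by (simp add: sum_gp_strict divide_right_mono)
  finally show ?thesis .
qed

lemma measure_pair_Times:
  assumes "sigma_finite_measure M2" "A \<in> sets M1" "B \<in> sets M2"
  shows "measure (M1 \<Otimes>\<^sub>M M2) (A \<times> B) = measure M1 A * measure M2 B"
  using assms by (simp add: measure_def sigma_finite_measure.emeasure_pair_measure_Times enn2real_mult)

locale noisy_box = lattice_box \<Lambda> M for \<Lambda> :: "(real ^ 'd::finite) set" and M :: nat +
  fixes p :: real
  assumes p_pos: "0 < p" and p_less: "p < 1"
begin

abbreviation "N \<equiv> card (edges_in \<Lambda>)"

definition draw_prob :: "(real ^ 'd) set \<times> bool \<Rightarrow> real" where
  "draw_prob m = (if snd m then p else 1 - p) / N"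

lemma finite_box_index: "finite {g :: 'd \<Rightarrow> nat. \<forall>k. g k \<le> 2 * M}"
proof -
  have "{g :: 'd \<Rightarrow> nat. \<forall>k. g k \<le> 2 * M} = (UNIV :: 'd set) \<rightarrow>\<^sub>E {..2 * M}"
    by (auto simp: PiE_UNIV_domain Pi_iff)
  then show ?thesis by (simp add: finite_PiE)
qed

lemma finite_vertices: "finite (\<Lambda> \<inter> int_lattice)"
  unfolding box_vertices using finite_box_index by simp

lemma edges_subset_image: "edges_in \<Lambda> \<subseteq> (\<lambda>(x, i). {x, x + axis i 1}) ` ((\<Lambda> \<inter> int_lattice) \<times> UNIV)"
proof
  fix e assume "e \<in> edges_in \<Lambda>"
  then obtain g i where g: "e = grid_edge M g i" "\<forall>k. g k \<le> 2 * M" unfolding edges_in_eq by blast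
  then show "e \<in> (\<lambda>(x, i). {x, x + axis i 1}) ` ((\<Lambda> \<inter> int_lattice) \<times> UNIV)"
    using grid_pt_in[OF g(2)] by (intro image_eqI[of _ _ "(grid_pt M g, i)"]) (auto simp: grid_edge_axis)
qed

lemma finite_edges: "finite (edges_in \<Lambda>)"
  by (rule finite_subset[OF edges_subset_image]) (simp add: finite_vertices)

lemma card_edges_le: "N \<le> CARD('d) * box_card \<Lambda>"
proof -
  have "N \<le> card ((\<lambda>(x, i). {x, x + axis i 1}) ` ((\<Lambda> \<inter> int_lattice) \<times> (UNIV :: 'd set)))"
    by (rule card_mono[OF _ edges_subset_image]) (simp add: finite_vertices)
  also have "\<dots> \<le> card ((\<Lambda> \<inter> int_lattice) \<times> (UNIV :: 'd set))"
    by (rule card_image_le) (simp add: finite_vertices)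
  finally show ?thesis by (simp add: card_cartesian_product box_card_def mult.commute)
qed

lemma box_card_le: "box_card \<Lambda> \<le> 2 * N"
proof -
  have "\<Lambda> \<inter> int_lattice \<subseteq> \<Union> (edges_in \<Lambda>)"
  proof
    fix x assume "x \<in> \<Lambda> \<inter> int_lattice"
    then obtain g where g: "x = grid_pt M g" "\<forall>k. g k \<le> 2 * M" unfolding box_vertices by blast
    fix i :: 'd
    have "\<exists>e\<in>edges_in \<Lambda>. x \<in> e"
    proof (cases "g i < 2 * M")
      case True
      then show ?thesis using grid_edge_in[OF g(2) True] g by (intro bexI[of _ "grid_edge M g i"]) (auto simp: grid_edge_def)
    next
      case False
      define g' where "g' = g(i := g i - 1)"
      have "g i = 2 * M" using False g(2) by (meson le_neq_implies_less)
      then have 1: "g' i < 2 * M" "\<forall>k. g' k \<le> 2 * M" "g'(i := Suc (g' i)) = g"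
        using g(2) M_pos by (auto simp: g'_def)
      then show ?thesis using grid_edge_in[OF 1(2,1)] g by (intro bexI[of _ "grid_edge M g' i"]) (auto simp: grid_edge_def)
    qed
    then show "x \<in> \<Union> (edges_in \<Lambda>)" by blast
  qed
  moreover have finU: "finite (\<Union> (edges_in \<Lambda>))" 
    using finite_edges by (auto simp: edges_in_def lattice_edges_def)
  ultimately have "box_card \<Lambda> \<le> card (\<Union> (edges_in \<Lambda>))" unfolding box_card_def by (intro card_mono)
  also have "\<dots> \<le> (\<Sum>e\<in>edges_in \<Lambda>. card e)" by (rule card_Union_le_sum_card)
  also have "\<dots> \<le> (\<Sum>e\<in>edges_in \<Lambda>. 2)"
  proof (rule sum_mono)
    fix e assume "e \<in> edges_in \<Lambda>"
    then obtain x y where "e = {x, y}" by (auto simp: edges_in_def lattice_edges_def)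
    then show "card e \<le> 2" by (simp add: card_insert_if)
  qed
  finally show ?thesis by simp
qed

lemma N_ge_2: "N \<ge> 2"
proof -
  define g :: "'d \<Rightarrow> nat" where "g = (\<lambda>_. 0)"
  fix i :: 'd
  have 1: "\<forall>k. g k \<le> 2 * M" "g i < 2 * M" "\<forall>k. (g(i := 1)) k \<le> 2 * M" "(g(i := 1)) i < 2 * M"
    using M_pos by (auto simp: g_def)
  have "grid_edge M g i \<noteq> grid_edge M (g(i := 1)) i"
    by (auto simp: grid_edge_def doubleton_eq_iff grid_pt_eq_iff g_def fun_eq_iff split: if_splits)
  then have "card {grid_edge M g i, grid_edge M (g(i := 1)) i} = 2" by simp
  moreover have "{grid_edge M g i, grid_edge M (g(i := 1)) i} \<subseteq> edges_in \<Lambda>"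
    using grid_edge_in 1 by blast
  ultimately show ?thesis using card_mono[OF finite_edges] by metis
qed

lemma space_noise: "space (noise \<Lambda> p) = edges_in \<Lambda> \<times> UNIV"
  by (simp add: noise_def space_pair_measure space_uniform_count_measure)

lemma sets_noise: "sets (noise \<Lambda> p) = Pow (edges_in \<Lambda> \<times> UNIV)"
proof -
  have "sets (noise \<Lambda> p) = sets (count_space (edges_in \<Lambda>) \<Otimes>\<^sub>M count_space (UNIV :: bool set))"
    unfolding noise_def by (intro sets_pair_measure_cong) (auto simp: sets_uniform_count_measure)
  also have "count_space (edges_in \<Lambda>) \<Otimes>\<^sub>M count_space (UNIV :: bool set) = count_space (edges_in \<Lambda> \<times> UNIV)"
    by (rule pair_measure_count_space) (auto simp: finite_edges)
  finally show ?thesis by simp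
qed

lemma prob_space_noise: "prob_space (noise \<Lambda> p)"
proof -
  have "edges_in \<Lambda> \<noteq> {}" using N_ge_2 by auto
  then interpret U: prob_space "uniform_count_measure (edges_in \<Lambda>)"
    using finite_edges by (intro prob_space_uniform_count_measure)
  interpret B: prob_space "measure_pmf (bernoulli_pmf p)" by (rule prob_space_measure_pmf)
  interpret pair_prob_space "uniform_count_measure (edges_in \<Lambda>)" "measure_pmf (bernoulli_pmf p)" ..
  show ?thesis unfolding noise_def by unfold_locales
qed

lemma measure_noise_singleton:
  assumes "m \<in> edges_in \<Lambda> \<times> UNIV"
  shows "measure (noise \<Lambda> p) {m} = draw_prob m"
proof -
  obtain e b where m: "m = (e, b)" "e \<in> edges_in \<Lambda>" using assms by auto
  have "measure (noise \<Lambda> p) ({e} \<times> {b}) = measure (uniform_count_measure (edges_in \<Lambda>)) {e} * measure (measure_pmf (bernoulli_pmf p)) {b}"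
    unfolding noise_def using m
    by (intro measure_pair_Times measure_pmf.sigma_finite_measure_axioms) (auto simp: sets_uniform_count_measure)
  also have "measure (uniform_count_measure (edges_in \<Lambda>)) {e} = 1 / N"
    using m by (simp add: measure_uniform_count_measure finite_edges)
  also have "measure (measure_pmf (bernoulli_pmf p)) {b} = (if b then p else 1 - p)"
    using p_pos p_less by (simp add: measure_pmf_single)
  finally show ?thesis by (simp add: m draw_prob_def)
qed

lemma measure_noise:
  assumes "A \<subseteq> edges_in \<Lambda> \<times> UNIV"
  shows "measure (noise \<Lambda> p) A = (\<Sum>m\<in>A. draw_prob m)"
proof -
  interpret prob_space "noise \<Lambda> p" by (rule prob_space_noise)
  have "finite A" using assms by (rule finite_subset) (simp add: finite_edges)
  then have "measure (noise \<Lambda> p) A = (\<Sum>m\<in>A. measure (noise \<Lambda> p) {m})"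
    using assms by (intro finite_measure_eq_sum_singleton) (auto simp: sets_noise)
  also have "\<dots> = (\<Sum>m\<in>A. draw_prob m)" using assms by (intro sum.cong) (auto simp: measure_noise_singleton)
  finally show ?thesis .
qed

definition draws :: "(nat \<Rightarrow> (real ^ 'd) set \<times> bool) measure" where
  "draws = (\<Pi>\<^sub>M t\<in>{1..}. noise \<Lambda> p)"

lemma prob_space_draws: "prob_space draws"
  unfolding draws_def by (rule prob_space_PiM) (rule prob_space_noise)

lemma space_drawsD: "\<nu> \<in> space draws \<Longrightarrow> 1 \<le> u \<Longrightarrow> \<nu> u \<in> edges_in \<Lambda> \<times> UNIV"
  by (auto simp: draws_def space_PiM space_noise PiE_iff)

lemma product_prob_space_noise: "product_prob_space (\<lambda>_. noise \<Lambda> p)"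
  using prob_space_noise by (intro product_prob_spaceI)

definition cylinder :: "nat set \<Rightarrow> (nat \<Rightarrow> ((real ^ 'd) set \<times> bool) set) \<Rightarrow> (nat \<Rightarrow> (real ^ 'd) set \<times> bool) set" where
  "cylinder J A = {\<nu> \<in> space draws. \<forall>u\<in>J. \<nu> u \<in> A u}"

lemma cylinder:
  assumes "finite J" "J \<subseteq> {1..}" "\<And>u. u \<in> J \<Longrightarrow> A u \<subseteq> edges_in \<Lambda> \<times> UNIV"
  shows "cylinder J A \<in> sets draws" "measure draws (cylinder J A) = (\<Prod>u\<in>J. measure (noise \<Lambda> p) (A u))"
proof -
  interpret product_prob_space "\<lambda>_. noise \<Lambda> p" "{1::nat..}" by (rule product_prob_space_noise)
  show "cylinder J A \<in> sets draws"
    unfolding cylinder_def draws_def using assms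
    by (intro sets.sets_Collect_finite_All sets_Collect_single) (auto simp: sets_noise)
  have eq: "cylinder J A = prod_emb {1..} (\<lambda>_. noise \<Lambda> p) J (PiE J A)"
    unfolding cylinder_def draws_def prod_emb_def using assms by (auto simp: space_PiM Pi_iff)
  show "measure draws (cylinder J A) = (\<Prod>u\<in>J. measure (noise \<Lambda> p) (A u))"
    unfolding eq draws_def using assms by (intro measure_PiM_emb) (auto simp: sets_noise)
qed

text \<open>
  The share of one edge in the probability of its certificate: the forced draw, with the constant 4
  from \<open>draw_constraint_prob\<close>, and the \<open>w - z\<close> later steps without a draw of the edge.
\<close>

definition certificate_weight :: "nat \<Rightarrow> nat \<Rightarrow> nat \<Rightarrow> real" where
  "certificate_weight s w z = (if s < z then 4 * (1 - p) / N else 1) * (1 - 1 / N) ^ (w - z)"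

lemma certificate_weight_nonneg: "0 \<le> certificate_weight s w z"
  using p_less N_ge_2 by (simp add: certificate_weight_def)

text \<open>
  One time step. If some edge is required to be the one drawn, the other edges are automatically not
  drawn, and the product on the right loses at most the factors \<open>1 - 1 / N\<close> of fewer than \<open>N\<close> other
  edges; the constant 4 compensates for them. If the edges in question are only required not to
  be drawn, this is Bernoulli's inequality.
\<close>

lemma draw_constraint_prob:
  fixes gs :: "(real ^ 'd) set list" and z w :: "nat \<Rightarrow> nat"
  assumes gs: "distinct gs" "set gs \<subseteq> edges_in \<Lambda>" and n: "n = length gs"
    and A: "A = {m \<in> edges_in \<Lambda> \<times> UNIV. \<forall>i<n. (z i = u \<longrightarrow> m = (gs ! i, False)) \<and>
        (z i < u \<and> u \<le> w i \<longrightarrow> fst m \<noteq> gs ! i)}"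
  shows "measure (noise \<Lambda> p) A \<le>
    (\<Prod>i<n. (if u = z i then 4 * (1 - p) / N else 1) * (if z i < u \<and> u \<le> w i then 1 - 1 / N else 1))"
    (is "_ \<le> prod ?q _")
proof -
  interpret prob_space "noise \<Lambda> p" by (rule prob_space_noise)
  have N: "real N \<ge> 2" using N_ge_2 by simp
  have "n \<le> N" using gs n card_mono[OF finite_edges gs(2)] distinct_card[OF gs(1)] by simp
  have q_nonneg: "0 \<le> ?q i" for i using p_less N by auto
  have AE: "A \<subseteq> edges_in \<Lambda> \<times> UNIV" using A by auto
  show ?thesis
  proof (cases "A = {}")
    case True
    then show ?thesis using q_nonneg by (simp add: prod_nonneg)
  next
    case False
    then obtain m where m: "m \<in> A" by blast
    show ?thesis
    proof (cases "\<exists>i<n. z i = u")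
      case True
      then obtain i0 where i0: "i0 < n" "z i0 = u" by blast
      then have "A \<subseteq> {(gs ! i0, False)}" using A by auto
      moreover have mem: "(gs ! i0, False) \<in> edges_in \<Lambda> \<times> UNIV" using gs(2) i0 n nth_mem by blast
      ultimately have "measure (noise \<Lambda> p) A \<le> measure (noise \<Lambda> p) {(gs ! i0, False)}"
        by (intro finite_measure_mono) (auto simp: sets_noise)
      also have "\<dots> = (1 - p) / N" using measure_noise_singleton[OF mem] by (simp add: draw_prob_def)
      also have "\<dots> \<le> 4 * (1 - p) / N * (1 - 1 / N) ^ (N - 1)"
      proof -
        have "4 * (1 - p) / N * (1 / 4) \<le> 4 * (1 - p) / N * (1 - 1 / N) ^ (N - 1)"
          using p_less by (intro mult_left_mono one_minus_inverse_power_ge N_ge_2) simp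
        moreover have "4 * (1 - p) / N * (1 / 4) = (1 - p) / N" using N by (simp add: divide_simps)
        ultimately show ?thesis by metis
      qed
      also have "\<dots> \<le> ?q i0 * (1 - 1 / N) ^ (n - 1)"
        using i0 p_less N \<open>n \<le> N\<close> by (intro mult_mono power_decreasing) auto
      also have "(1 - 1 / N) ^ (n - 1) = (\<Prod>i\<in>{..<n} - {i0}. 1 - 1 / real N)"
        using i0 by simp
      also have "?q i0 * \<dots> \<le> ?q i0 * prod ?q ({..<n} - {i0})"
      proof (intro mult_left_mono prod_mono conjI)
        fix i assume i: "i \<in> {..<n} - {i0}"
        have "z i \<noteq> u"
        proof
          assume "z i = u"
          then have "gs ! i = gs ! i0" using m A i i0 by auto
          then show False using gs(1) i i0 n by (simp add: nth_eq_iff_index_eq)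
        qed
        then show "1 - 1 / real N \<le> ?q i" by auto
      qed (use q_nonneg N in auto)
      also have "\<dots> = prod ?q {..<n}" using i0 by (simp add: prod.remove[of "{..<n}" i0])
      finally show ?thesis .
    next
      case no_forced: False
      define X where "X = {i. i < n \<and> z i < u \<and> u \<le> w i}"
      have "X \<subseteq> {..<n}" by (auto simp: X_def)
      have "A \<subseteq> (edges_in \<Lambda> - (!) gs ` X) \<times> UNIV" using A by (auto simp: X_def)
      then have "measure (noise \<Lambda> p) A \<le> measure (noise \<Lambda> p) ((edges_in \<Lambda> - (!) gs ` X) \<times> UNIV)"
        by (intro finite_measure_mono) (auto simp: sets_noise)
      also have "\<dots> = (\<Sum>e\<in>edges_in \<Lambda> - (!) gs ` X. \<Sum>b\<in>UNIV. draw_prob (e, b))"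
        by (subst measure_noise) (auto simp: sum.cartesian_product)
      also have "\<dots> = real (card (edges_in \<Lambda> - (!) gs ` X)) / N"
        by (simp add: draw_prob_def UNIV_bool flip: add_divide_distrib)
      also have "card (edges_in \<Lambda> - (!) gs ` X) = N - card X"
      proof -
        have "inj_on ((!) gs) X" using inj_on_nth[OF gs(1)] n by (auto simp: X_def)
        moreover have "(!) gs ` X \<subseteq> edges_in \<Lambda>" using gs(2) n by (auto simp: X_def)
        ultimately show ?thesis using finite_edges by (simp add: card_Diff_subset finite_subset card_image)
      qed
      also have "card X \<le> n" using \<open>X \<subseteq> {..<n}\<close> card_mono[of "{..<n}" X] by simp
      then have "real (N - card X) / N = 1 + real (card X) * (- 1 / N)"
        using \<open>n \<le> N\<close> N by (simp add: of_nat_diff field_simps)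
      also have "\<dots> \<le> (1 + - 1 / N) ^ card X" using N by (intro Bernoulli_inequality) simp
      also have "\<dots> = (\<Prod>i<n. if i \<in> X then 1 - 1 / real N else 1)"
        using \<open>X \<subseteq> {..<n}\<close> by (simp add: prod.If_cases Int_absorb1)
      also have "\<dots> = prod ?q {..<n}" using no_forced by (intro prod.cong) (auto simp: X_def)
      finally show ?thesis .
    qed
  qed
qed

text \<open>
  Draws at distinct times are independent. The bound for one time is a product over the edges, so
  the two products can be exchanged, and the weights of the edges separate.
\<close>

lemma certificates_prob:
  fixes gs :: "(real ^ 'd) set list" and z w :: "nat \<Rightarrow> nat"
  assumes gs: "distinct gs" "set gs \<subseteq> edges_in \<Lambda>" "length gs = n"
    and z: "\<And>i. i < n \<Longrightarrow> s \<le> z i"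
  shows "\<exists>C\<in>sets draws. {\<nu> \<in> space draws. \<forall>i<n. closing_certificate \<nu> s (w i) (gs ! i) (z i)} \<subseteq> C \<and>
     measure draws C \<le> (\<Prod>i<n. certificate_weight s (w i) (z i))"
proof -
  interpret prob_space "noise \<Lambda> p" by (rule prob_space_noise)
  define A where "A u = {m \<in> edges_in \<Lambda> \<times> UNIV. \<forall>i<n. (z i = u \<longrightarrow> m = (gs ! i, False)) \<and>
        (z i < u \<and> u \<le> w i \<longrightarrow> fst m \<noteq> gs ! i)}" for u
  obtain T where T: "\<And>i. i < n \<Longrightarrow> z i \<le> T \<and> w i \<le> T"
  proof -
    have "finite (z ` {..<n} \<union> w ` {..<n})" by simp
    then obtain T where "\<forall>u\<in>z ` {..<n} \<union> w ` {..<n}. u \<le> T" using finite_nat_set_iff_bounded_le by blast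
    then have "\<And>i. i < n \<Longrightarrow> z i \<le> T \<and> w i \<le> T" by blast
    then show ?thesis by (rule that)
  qed
  define J where "J = {s<..T}"
  have J: "finite J" "J \<subseteq> {1..}" by (auto simp: J_def)
  let ?q = "\<lambda>i u. (if u = z i then 4 * (1 - p) / N else 1) * (if z i < u \<and> u \<le> w i then 1 - 1 / N else 1)"
  have "measure draws (cylinder J A) = (\<Prod>u\<in>J. measure (noise \<Lambda> p) (A u))"
    using J by (intro cylinder(2)) (auto simp: A_def)
  also have "\<dots> \<le> (\<Prod>u\<in>J. \<Prod>i<n. ?q i u)"
    using gs by (intro prod_mono conjI measure_nonneg draw_constraint_prob) (auto simp: A_def)
  also have "\<dots> = (\<Prod>i<n. \<Prod>u\<in>J. ?q i u)" by (rule prod.swap)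
  also have "\<dots> = (\<Prod>i<n. certificate_weight s (w i) (z i))"
  proof (rule prod.cong)
    fix i assume i: "i \<in> {..<n}"
    have "(\<Prod>u\<in>J. if u = z i then 4 * (1 - p) / N else 1) = (if s < z i then 4 * (1 - p) / N else 1)"
      using i T[of i] J(1) by (auto simp: prod.delta J_def)
    moreover have "(\<Prod>u\<in>J. if z i < u \<and> u \<le> w i then 1 - 1 / real N else 1) = (1 - 1 / N) ^ (w i - z i)"
    proof -
      have "J \<inter> {u. z i < u \<and> u \<le> w i} = {z i<..w i}" using i T[of i] z[of i] by (auto simp: J_def)
      then show ?thesis using J by (simp add: prod.If_cases)
    qed
    ultimately show "(\<Prod>u\<in>J. ?q i u) = certificate_weight s (w i) (z i)"
      by (simp add: prod.distrib certificate_weight_def)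
  qed simp
  finally have "measure draws (cylinder J A) \<le> (\<Prod>i<n. certificate_weight s (w i) (z i))" .
  moreover have "cylinder J A \<in> sets draws" using J by (intro cylinder(1)) (auto simp: A_def)
  moreover have "{\<nu> \<in> space draws. \<forall>i<n. closing_certificate \<nu> s (w i) (gs ! i) (z i)} \<subseteq> cylinder J A"
  proof
    fix \<nu> assume nu: "\<nu> \<in> {\<nu> \<in> space draws. \<forall>i<n. closing_certificate \<nu> s (w i) (gs ! i) (z i)}"
    have "\<nu> u \<in> A u" if u: "u \<in> J" for u
    proof -
      have "\<nu> u \<in> edges_in \<Lambda> \<times> UNIV" using nu u by (intro space_drawsD) (auto simp: J_def)
      moreover have "\<nu> u = (gs ! i, False)" if "i < n" "z i = u" for i
        using nu that u by (auto simp: closing_certificate_def J_def)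
      moreover have "fst (\<nu> u) \<noteq> gs ! i" if "i < n" "z i < u" "u \<le> w i" for i
        using nu that by (auto simp: closing_certificate_def)
      ultimately show ?thesis by (auto simp: A_def)
    qed
    then show "\<nu> \<in> cylinder J A" using nu by (auto simp: cylinder_def)
  qed
  ultimately show ?thesis by blast
qed

text \<open>
  The three contributions are: no draw since \<open>s\<close>; a last draw before the block (a geometric series,
  at most \<open>4 * (1 - p)\<close>); a draw inside the block, which has at most \<open>2 * N\<close> steps (at most
  \<open>8 * (1 - p)\<close>).
\<close>

lemma certificate_weight_sum:
  assumes "s \<le> t" "t \<le> w" "w1 \<le> w + L" "w \<le> w1" "L \<le> 2 * N"
  shows "(\<Sum>z\<in>{s..w1}. certificate_weight s w z) \<le> (1 - 1 / N) ^ (t - s) + 12 * (1 - p)"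
proof -
  have N: "real N \<ge> 2" using N_ge_2 by simp
  define r where "r = 1 - 1 / real N"
  define c where "c = 4 * (1 - p) / real N"
  have r: "0 \<le> r" "r < 1" using N by (auto simp: r_def)
  have c: "c \<ge> 0" using p_less by (simp add: c_def)
  have "{s..w1} = {s} \<union> ({s<..w} \<union> {w<..w1})" using assms by auto
  then have "(\<Sum>z\<in>{s..w1}. certificate_weight s w z) =
      certificate_weight s w s + ((\<Sum>z\<in>{s<..w}. certificate_weight s w z) + (\<Sum>z\<in>{w<..w1}. certificate_weight s w z))"
    using assms by (simp add: sum.union_disjoint ivl_disj_int)
  also have "certificate_weight s w s = r ^ (w - s)" by (simp add: certificate_weight_def r_def)
  also have "\<dots> \<le> r ^ (t - s)" using r assms by (intro power_decreasing) auto
  also have "(\<Sum>z\<in>{s<..w}. certificate_weight s w z) = c * (\<Sum>z\<in>{s<..w}. r ^ (w - z))"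
    by (simp add: sum_distrib_left certificate_weight_def c_def r_def)
  also have "\<dots> \<le> c * (1 / (1 - r))" using sum_geometric_le[OF r] c by (intro mult_left_mono)
  also have "\<dots> = 4 * (1 - p)" using N by (simp add: c_def r_def)
  also have "(\<Sum>z\<in>{w<..w1}. certificate_weight s w z) = (\<Sum>z\<in>{w<..w1}. c)"
    using assms by (intro sum.cong) (auto simp: certificate_weight_def c_def)
  also have "\<dots> = real (w1 - w) * c" by simp
  also have "\<dots> \<le> real (2 * N) * c" using assms c by (intro mult_right_mono) auto
  also have "\<dots> = 8 * (1 - p)" using N by (simp add: c_def)
  finally show ?thesis by (simp add: r_def)
qed

text \<open>
  Union bound over the edges of the path, the blocks and the times of the last draws. The sum over
  these times factorizes over the edges of the path.
\<close>

lemma strays_draws_prob: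
  assumes "s \<le> t" "L \<le> 2 * N" "n \<ge> 1"
  defines "\<theta> \<equiv> (1 - 1 / N) ^ (t - s) + 12 * (1 - p)"
  shows "\<exists>C\<in>sets draws. {\<nu> \<in> space draws. \<exists>gs bs. length gs = n \<and> distinct gs \<and> set gs \<subseteq> edges_in \<Lambda> \<and>
       successively star_adj gs \<and> bs \<in> nonincreasing_lists n K \<and>
      (\<forall>i<n. \<exists>z\<in>{s..t + (bs ! i + 1) * L}. closing_certificate \<nu> s (t + bs ! i * L) (gs ! i) z)} \<subseteq> C \<and>
     measure draws C \<le> real (N * (16 * CARD('d)\<^sup>2) ^ (n - 1)) * 2 ^ (n + K) * \<theta> ^ n"
proof -
  interpret prob_space draws by (rule prob_space_draws)
  define GS where "GS = {gs. length gs = n \<and> distinct gs \<and> set gs \<subseteq> edges_in \<Lambda> \<and> successively star_adj gs}"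
  define BS where "BS = nonincreasing_lists n K"
  define Z where "Z bs = (\<Pi>\<^sub>E i\<in>{..<n}. {s..t + (bs ! i + 1) * L})" for bs
  have finGS: "finite GS"
    by (rule finite_subset[OF _ finite_lists_length_eq[OF finite_edges, of n]]) (auto simp: GS_def)
  have cardGS: "card GS \<le> N * (16 * CARD('d)\<^sup>2) ^ (n - 1)"
  proof -
    obtain n' where n': "n = Suc n'" using assms by (cases n) auto
    have "card GS \<le> card {xs. length xs = Suc n' \<and> set xs \<subseteq> edges_in \<Lambda> \<and> successively star_adj xs}"
      using n' by (intro card_mono finite_subset[OF _ finite_lists_length_eq[OF finite_edges, of n]]) (auto simp: GS_def)
    also have "\<dots> \<le> N * (16 * CARD('d)\<^sup>2) ^ n'"
    proof (rule card_successively_lists[OF finite_edges])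
      fix y assume "y \<in> edges_in \<Lambda>"
      then have "y \<noteq> {}" by (auto simp: edges_in_def lattice_edges_def)
      then have "card {x \<in> edges_in \<Lambda>. star_adj x y} \<le> card {x. star_adj y x}"
        using card_star_adj(1) star_adj_sym by (intro card_mono) auto
      also have "\<dots> \<le> 16 * CARD('d)\<^sup>2" using \<open>y \<noteq> {}\<close> by (rule card_star_adj(2))
      finally show "card {x \<in> edges_in \<Lambda>. star_adj x y} \<le> 16 * CARD('d)\<^sup>2" .
    qed
    finally show ?thesis by (simp add: n')
  qed
  have finZ: "finite (Z bs)" for bs by (simp add: Z_def finite_PiE)
  define I where "I = Sigma GS (\<lambda>_. Sigma BS Z)"
  have finI: "finite I" using finGS finZ finite_nonincreasing_lists by (auto simp: I_def BS_def)
  define ev where "ev = (\<lambda>(gs, bs, z). {\<nu> \<in> space draws. \<forall>i<n. closing_certificate \<nu> s (t + bs ! i * L) (gs ! i) (z i)})"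
  define wt where "wt = (\<lambda>(gs :: (real ^ 'd) set list, bs, z). \<Prod>i<n. certificate_weight s (t + bs ! i * L) (z i))"
  have "\<forall>x\<in>I. \<exists>C\<in>sets draws. ev x \<subseteq> C \<and> measure draws C \<le> wt x"
  proof
    fix x assume "x \<in> I"
    then obtain gs bs z where x: "x = (gs, bs, z)" "gs \<in> GS" "z \<in> Z bs" by (auto simp: I_def)
    show "\<exists>C\<in>sets draws. ev x \<subseteq> C \<and> measure draws C \<le> wt x"
      unfolding x(1) ev_def wt_def prod.case
      by (rule certificates_prob) (use x in \<open>auto simp: GS_def Z_def PiE_iff\<close>)
  qed
  then obtain C where C: "\<And>x. x \<in> I \<Longrightarrow> C x \<in> sets draws" "\<And>x. x \<in> I \<Longrightarrow> ev x \<subseteq> C x"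
    "\<And>x. x \<in> I \<Longrightarrow> measure draws (C x) \<le> wt x" by metis
  have "measure draws (\<Union>x\<in>I. C x) \<le> (\<Sum>x\<in>I. measure draws (C x))"
    using finI C by (intro finite_measure_subadditive_finite) auto
  also have "\<dots> \<le> (\<Sum>x\<in>I. wt x)" using C by (intro sum_mono)
  also have "\<dots> = (\<Sum>gs\<in>GS. \<Sum>bs\<in>BS. \<Sum>z\<in>Z bs. \<Prod>i<n. certificate_weight s (t + bs ! i * L) (z i))"
  proof -
    have "(\<Sum>x\<in>I. wt x) = (\<Sum>gs\<in>GS. \<Sum>y\<in>Sigma BS Z. wt (gs, y))"
      unfolding I_def sum.cartesian_product by (rule sum.cong) auto
    moreover have "(\<Sum>y\<in>Sigma BS Z. wt (gs, y)) =
        (\<Sum>bs\<in>BS. \<Sum>z\<in>Z bs. \<Prod>i<n. certificate_weight s (t + bs ! i * L) (z i))" for gs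
      using finZ finite_nonincreasing_lists by (subst sum.Sigma) (auto simp: BS_def wt_def)
    ultimately show ?thesis by simp
  qed
  also have "\<dots> = (\<Sum>gs\<in>GS. \<Sum>bs\<in>BS. \<Prod>i<n. \<Sum>z\<in>{s..t + (bs ! i + 1) * L}. certificate_weight s (t + bs ! i * L) z)"
    unfolding Z_def by (subst prod_sum_PiE) auto
  also have "\<dots> \<le> (\<Sum>gs\<in>GS. \<Sum>bs\<in>BS. \<Prod>i<n. \<theta>)"
    unfolding \<theta>_def using assms
    by (intro sum_mono prod_mono conjI sum_nonneg certificate_weight_nonneg certificate_weight_sum) auto
  also have "\<dots> = real (card GS) * real (card BS) * \<theta> ^ n" by simp
  also have "\<dots> \<le> real (N * (16 * CARD('d)\<^sup>2) ^ (n - 1)) * 2 ^ (n + K) * \<theta> ^ n"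
  proof (intro mult_right_mono mult_mono)
    show "real (card BS) \<le> 2 ^ (n + K)"
      using card_nonincreasing_lists[of n K] unfolding BS_def by (simp flip: of_nat_power add: of_nat_le_iff)
    show "0 \<le> \<theta> ^ n" using N_ge_2 p_less by (simp add: \<theta>_def)
  qed (use cardGS in \<open>simp_all only: of_nat_le_iff of_nat_0_le_iff\<close>)
  finally have "measure draws (\<Union>x\<in>I. C x) \<le> real (N * (16 * CARD('d)\<^sup>2) ^ (n - 1)) * 2 ^ (n + K) * \<theta> ^ n" .
  moreover have "(\<Union>x\<in>I. C x) \<in> sets draws" using finI C by auto
  moreover have "{\<nu> \<in> space draws. \<exists>gs bs. length gs = n \<and> distinct gs \<and> set gs \<subseteq> edges_in \<Lambda> \<and>
       successively star_adj gs \<and> bs \<in> nonincreasing_lists n K \<and>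
      (\<forall>i<n. \<exists>z\<in>{s..t + (bs ! i + 1) * L}. closing_certificate \<nu> s (t + bs ! i * L) (gs ! i) z)} \<subseteq> (\<Union>x\<in>I. C x)"
  proof
    fix \<nu> assume nu: "\<nu> \<in> {\<nu> \<in> space draws. \<exists>gs bs. length gs = n \<and> distinct gs \<and> set gs \<subseteq> edges_in \<Lambda> \<and>
       successively star_adj gs \<and> bs \<in> nonincreasing_lists n K \<and>
      (\<forall>i<n. \<exists>z\<in>{s..t + (bs ! i + 1) * L}. closing_certificate \<nu> s (t + bs ! i * L) (gs ! i) z)}"
    then obtain gs bs where g: "gs \<in> GS" "bs \<in> BS"
      "\<forall>i<n. \<exists>z\<in>{s..t + (bs ! i + 1) * L}. closing_certificate \<nu> s (t + bs ! i * L) (gs ! i) z"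
      by (auto simp: GS_def BS_def)
    then obtain z where z: "\<And>i. i < n \<Longrightarrow> z i \<in> {s..t + (bs ! i + 1) * L}"
      "\<And>i. i < n \<Longrightarrow> closing_certificate \<nu> s (t + bs ! i * L) (gs ! i) (z i)" by metis
    have "restrict z {..<n} \<in> Z bs" using z(1) by (auto simp: Z_def)
    then have "(gs, bs, restrict z {..<n}) \<in> I" using g by (auto simp: I_def)
    moreover have "\<nu> \<in> ev (gs, bs, restrict z {..<n})" using nu z(2) by (auto simp: ev_def)
    ultimately show "\<nu> \<in> (\<Union>x\<in>I. C x)" using C(2) by blast
  qed
  ultimately show ?thesis by blast
qed

end

section \<open>Time reversal of the conditioned process\<close>

lemma top_bottom_connected_close:
  assumes "top_bottom_connected v \<Lambda> (y(e := False))"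
  shows "top_bottom_connected v \<Lambda> y"
proof -
  have "open_adj \<Lambda> (y(e := False)) \<subseteq> open_adj \<Lambda> y" by (auto simp: open_adj_def split: if_splits)
  then show ?thesis using assms rtrancl_mono unfolding top_bottom_connected_def by blast
qed

text \<open>
  A weighted mean of values that are at most \<open>g y\<close> equals \<open>g y\<close> only if every value of positive
  weight does.
\<close>

lemma harmonic_max_propagates:
  fixes g :: "'a \<Rightarrow> real"
  assumes "finite \<Omega>" "y \<in> \<Omega>" "z \<in> \<Omega>" and K: "\<And>x. x \<in> \<Omega> \<Longrightarrow> 0 \<le> K x" "(\<Sum>x\<in>\<Omega>. K x) = 1" "0 < K z"
    and harm: "g y = (\<Sum>x\<in>\<Omega>. K x * g x)" and mx: "\<And>x. x \<in> \<Omega> \<Longrightarrow> g x \<le> g y"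
  shows "g z = g y"
proof -
  have "(\<Sum>x\<in>\<Omega>. K x * (g y - g x)) = (\<Sum>x\<in>\<Omega>. K x) * g y - (\<Sum>x\<in>\<Omega>. K x * g x)"
    by (simp add: right_diff_distrib sum_subtractf sum_distrib_right)
  also have "\<dots> = 0" using K(2) harm by simp
  finally have "\<forall>x\<in>\<Omega>. K x * (g y - g x) = 0"
    using assms(1) K(1) mx by (subst (asm) sum_nonneg_eq_0_iff) auto
  then show ?thesis using \<open>z \<in> \<Omega>\<close> K(3) by auto
qed

context noisy_box
begin

definition disconnected_configs :: "'d \<Rightarrow> 'd config set" where
  "disconnected_configs v = {y \<in> configs \<Lambda>. \<not> top_bottom_connected v \<Lambda> y}"

lemma finite_configs: "finite (configs \<Lambda> :: 'd config set)"
  unfolding configs_def using finite_edges by (simp add: finite_PiE)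

lemma finite_disconnected: "finite (disconnected_configs v)"
  unfolding disconnected_configs_def using finite_configs by simp

lemma finite_coupled_states: "finite (coupled_states v \<Lambda>)"
  by (rule finite_subset[of _ "configs \<Lambda> \<times> configs \<Lambda>"]) (auto simp: coupled_states_def finite_configs)

lemma configs_upd: "y \<in> configs \<Lambda> \<Longrightarrow> e \<in> edges_in \<Lambda> \<Longrightarrow> y(e := b) \<in> configs \<Lambda>"
  by (auto simp: configs_def PiE_iff extensional_def)

lemma conditioned_step_not_connected:
  assumes "\<not> top_bottom_connected v \<Lambda> y"
  shows "\<not> top_bottom_connected v \<Lambda> (conditioned_step v \<Lambda> n y)"
proof (cases "snd n \<and> \<not> top_bottom_connected v \<Lambda> (y(fst n := True))")
  case True
  then show ?thesis by (simp add: conditioned_step_def)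
next
  case False
  then have "conditioned_step v \<Lambda> n y = y(fst n := False)" by (simp only: conditioned_step_def)
  then show ?thesis using assms top_bottom_connected_close by metis
qed

lemma conditioned_step_disconnected:
  assumes "y \<in> disconnected_configs v" "n \<in> edges_in \<Lambda> \<times> UNIV"
  shows "conditioned_step v \<Lambda> n y \<in> disconnected_configs v"
  using assms conditioned_step_not_connected configs_upd
  by (auto simp: disconnected_configs_def conditioned_step_def)

lemma snd_coupled_step: "snd (coupled_step v \<Lambda> n s) = conditioned_step v \<Lambda> n (snd s)"
  by (cases n; cases s) (simp add: conditioned_step_def)

lemma coupled_states_snd: "s \<in> coupled_states v \<Lambda> \<Longrightarrow> snd s \<in> disconnected_configs v"
  by (auto simp: coupled_states_def disconnected_configs_def)

lemma coupled_step_in: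
  assumes "s \<in> coupled_states v \<Lambda>" "n \<in> edges_in \<Lambda> \<times> UNIV"
  shows "coupled_step v \<Lambda> n s \<in> coupled_states v \<Lambda>"
proof -
  obtain x y e b where s: "s = (x, y)" "n = (e, b)" "e \<in> edges_in \<Lambda>" using assms by (cases s; cases n) auto
  have "\<not> top_bottom_connected v \<Lambda> y" using assms by (simp add: s coupled_states_def)
  then have "\<not> top_bottom_connected v \<Lambda> (y(e := b \<and> \<not> top_bottom_connected v \<Lambda> (y(e := True))))"
    using conditioned_step_not_connected[of v y n] by (simp add: conditioned_step_def s)
  then show ?thesis using assms configs_upd by (auto simp: s coupled_states_def)
qed

lemma coupled_state_in:
  assumes "s \<in> coupled_states v \<Lambda>" "\<nu> \<in> space draws"
  shows "coupled_state v \<Lambda> s \<nu> t \<in> coupled_states v \<Lambda>"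
proof (induction t)
  case (Suc t)
  have "\<nu> (Suc t) \<in> edges_in \<Lambda> \<times> UNIV" using assms(2) by (intro space_drawsD) simp_all
  then show ?case using Suc coupled_step_in by simp
qed (use assms in simp)

lemma coupled_state_conditioned_path:
  assumes "s \<in> coupled_states v \<Lambda>" "\<nu> \<in> space draws"
  shows "conditioned_path v \<Lambda> T \<nu> (\<lambda>i. snd (coupled_state v \<Lambda> s \<nu> i))"
  using coupled_states_snd[OF coupled_state_in[OF assms]]
  by (auto simp: conditioned_path_def snd_coupled_step disconnected_configs_def)

definition step_prob :: "'d \<Rightarrow> 'd config \<Rightarrow> 'd config \<Rightarrow> real" where
  "step_prob v y y' = measure (noise \<Lambda> p) {n \<in> edges_in \<Lambda> \<times> UNIV. conditioned_step v \<Lambda> n y = y'}"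

lemma draw_prob_pos: "0 < draw_prob m"
  using p_pos p_less N_ge_2 by (simp add: draw_prob_def)

lemma step_prob_sum:
  assumes "y \<in> disconnected_configs v"
  shows "(\<Sum>y'\<in>disconnected_configs v. step_prob v y y') = 1"
proof -
  interpret prob_space "noise \<Lambda> p" by (rule prob_space_noise)
  have "(\<Sum>y'\<in>disconnected_configs v. step_prob v y y') =
      measure (noise \<Lambda> p) (\<Union>y'\<in>disconnected_configs v. {n \<in> edges_in \<Lambda> \<times> UNIV. conditioned_step v \<Lambda> n y = y'})"
    unfolding step_prob_def using finite_disconnected
    by (intro finite_measure_finite_Union[symmetric]) (auto simp: sets_noise disjoint_family_on_def)
  also have "(\<Union>y'\<in>disconnected_configs v. {n \<in> edges_in \<Lambda> \<times> UNIV. conditioned_step v \<Lambda> n y = y'}) = space (noise \<Lambda> p)"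
    using conditioned_step_disconnected[OF assms] by (auto simp: space_noise)
  finally show ?thesis by (simp add: prob_space)
qed

lemma step_prob_close_pos:
  assumes "e \<in> edges_in \<Lambda>"
  shows "0 < step_prob v y (y(e := False))"
proof -
  interpret prob_space "noise \<Lambda> p" by (rule prob_space_noise)
  have "draw_prob (e, False) = measure (noise \<Lambda> p) {(e, False)}"
    using assms by (intro measure_noise_singleton[symmetric]) simp
  also have "\<dots> \<le> step_prob v y (y(e := False))"
    unfolding step_prob_def using assms
    by (intro finite_measure_mono) (auto simp: sets_noise conditioned_step_def)
  finally show ?thesis using draw_prob_pos[of "(e, False)"] by simp
qed

text \<open>
  The Bernoulli weight of a configuration. Restricted to the disconnected configurations it is,
  up to normalization, the reversible law of the conditioned chain.
\<close>

definition product_weight :: "'d config \<Rightarrow> real" where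
  "product_weight y = (\<Prod>e\<in>edges_in \<Lambda>. if y e then p else 1 - p)"

lemma product_weight_pos: "0 < product_weight y"
  unfolding product_weight_def using p_pos p_less by (intro prod_pos) auto

text \<open>
  Detailed balance holds separately for the update of each edge. If the edge is pivotal, the update
  leaves a disconnected configuration unchanged. Otherwise it resamples the edge, and pivotality depends
  only on the other edges, which the update does not change.
\<close>

lemma product_weight_balance:
  assumes y: "y \<in> disconnected_configs v" and y': "y' \<in> disconnected_configs v"
  shows "product_weight y * step_prob v y y' = product_weight y' * step_prob v y' y"
proof -
  define k where "k e y y' = (\<Sum>b\<in>UNIV. if conditioned_step v \<Lambda> (e, b) y = y' then draw_prob (e, b) else 0)"
    for e and y y' :: "'d config"
  have step_k: "step_prob v y y' = (\<Sum>e\<in>edges_in \<Lambda>. k e y y')" for y y'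
  proof -
    have "step_prob v y y' = (\<Sum>n\<in>{n \<in> edges_in \<Lambda> \<times> UNIV. conditioned_step v \<Lambda> n y = y'}. draw_prob n)"
      unfolding step_prob_def by (rule measure_noise) auto
    also have "\<dots> = (\<Sum>n\<in>edges_in \<Lambda> \<times> UNIV. if conditioned_step v \<Lambda> n y = y' then draw_prob n else 0)"
      using finite_edges by (intro sum.inter_filter) simp
    also have "\<dots> = (\<Sum>e\<in>edges_in \<Lambda>. k e y y')"
      unfolding k_def sum.cartesian_product by (rule sum.cong) auto
    finally show ?thesis .
  qed
  have "product_weight y * k e y y' = product_weight y' * k e y' y" if e: "e \<in> edges_in \<Lambda>" for e
  proof (cases "\<forall>e'. e' \<noteq> e \<longrightarrow> y e' = y' e'")
    case False
    then obtain e' where e': "e' \<noteq> e" "y e' \<noteq> y' e'" by blast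
    then have "conditioned_step v \<Lambda> (e, b) y e' = y e'" "conditioned_step v \<Lambda> (e, b) y' e' = y' e'" for b
      by (simp_all add: conditioned_step_def)
    then have "conditioned_step v \<Lambda> (e, b) y \<noteq> y'" "conditioned_step v \<Lambda> (e, b) y' \<noteq> y" for b
      using e'(2) by metis+
    then show ?thesis by (simp add: k_def)
  next
    case True
    then have same: "y(e := b) = y'(e := b)" for b using True by (intro ext) simp
    show ?thesis
    proof (cases "top_bottom_connected v \<Lambda> (y(e := True))")
      case conn: True
      have "\<not> y e"
      proof
        assume "y e"
        then have "y(e := True) = y" by (simp add: fun_upd_idem)
        then show False using conn y by (simp add: disconnected_configs_def)
      qed
      moreover have "\<not> y' e"
      proof
        assume "y' e"
        then have "y'(e := True) = y'" by (simp add: fun_upd_idem)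
        then show False using conn y' same[of True] by (simp add: disconnected_configs_def)
      qed
      ultimately have "y e' = y' e'" for e' using True by (cases "e' = e") auto
      then have "y = y'" by (rule ext)
      then show ?thesis by simp
    next
      case False
      have st: "conditioned_step v \<Lambda> (e, b) y = y(e := b)" "conditioned_step v \<Lambda> (e, b) y' = y'(e := b)" for b
        using False same[of True] by (auto simp: conditioned_step_def)
      have eq: "y(e := b) = y' \<longleftrightarrow> b = y' e" "y'(e := b) = y \<longleftrightarrow> b = y e" for b
        using True by (auto simp: fun_eq_iff)
      have "k e y y' = draw_prob (e, y' e)" "k e y' y = draw_prob (e, y e)"
        by (simp_all add: k_def st eq)
      moreover have "product_weight z = (if z e then p else 1 - p) * (\<Prod>e\<in>edges_in \<Lambda> - {e}. if z e then p else 1 - p)" for z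
        unfolding product_weight_def using finite_edges e by (rule prod.remove)
      moreover have "(\<Prod>e\<in>edges_in \<Lambda> - {e}. if y e then p else 1 - p) = (\<Prod>e\<in>edges_in \<Lambda> - {e}. if y' e then p else 1 - p)"
        using True by (intro prod.cong) auto
      ultimately show ?thesis by (simp add: draw_prob_def)
    qed
  qed
  then show ?thesis by (simp add: step_k sum_distrib_left)
qed

text \<open>
  From a maximum of a harmonic function close the edges one by one; each closing has positive
  probability, so all configurations on the way are maxima.
\<close>

lemma harmonic_at_closed:
  fixes g :: "'d config \<Rightarrow> real"
  assumes harm: "\<And>y. y \<in> disconnected_configs v \<Longrightarrow> g y = (\<Sum>x\<in>disconnected_configs v. step_prob v y x * g x)"
    and y: "y \<in> disconnected_configs v" "\<And>x. x \<in> disconnected_configs v \<Longrightarrow> g x \<le> g y"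
  shows "g (\<lambda>e\<in>edges_in \<Lambda>. False) = g y"
proof -
  define cl where "cl F = (\<lambda>e. if e \<in> F then False else y e)" for F
  have "cl F \<in> disconnected_configs v \<and> g (cl F) = g y" if "finite F" "F \<subseteq> edges_in \<Lambda>" for F
    using that
  proof (induction F rule: finite_induct)
    case empty
    have "cl {} = y" by (auto simp: cl_def)
    then show ?case using y by simp
  next
    case (insert e F)
    have eq: "cl (insert e F) = (cl F)(e := False)" by (rule ext) (simp add: cl_def)
    have F: "cl F \<in> disconnected_configs v" "g (cl F) = g y" using insert by auto
    have in_d: "(cl F)(e := False) \<in> disconnected_configs v"
      using F(1) insert.prems top_bottom_connected_close configs_upd by (auto simp: disconnected_configs_def)
    have "g ((cl F)(e := False)) = g (cl F)"
    proof (rule harmonic_max_propagates[OF finite_disconnected F(1) in_d, where K = "step_prob v (cl F)"])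
      show "0 \<le> step_prob v (cl F) x" for x by (simp add: step_prob_def)
      show "0 < step_prob v (cl F) ((cl F)(e := False))" using insert.prems by (intro step_prob_close_pos) simp
      show "g (cl F) = (\<Sum>x\<in>disconnected_configs v. step_prob v (cl F) x * g x)" using harm F(1) by simp
      show "(\<Sum>x\<in>disconnected_configs v. step_prob v (cl F) x) = 1" using step_prob_sum F(1) by simp
      show "g x \<le> g (cl F)" if "x \<in> disconnected_configs v" for x using y(2) F(2) that by simp
    qed
    then show ?case unfolding eq using in_d F(2) by metis
  qed
  from this[OF finite_edges order_refl] have "g (cl (edges_in \<Lambda>)) = g y" by simp
  also have "cl (edges_in \<Lambda>) = (\<lambda>e\<in>edges_in \<Lambda>. False)"
  proof
    fix e
    have "y \<in> extensional (edges_in \<Lambda>)" using y(1) by (simp add: disconnected_configs_def configs_def PiE_iff)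
    then show "cl (edges_in \<Lambda>) e = (\<lambda>e\<in>edges_in \<Lambda>. False) e"
      by (simp add: cl_def extensional_def)
  qed
  finally show ?thesis .
qed

text \<open>
  By detailed balance the density of a stationary weight with respect to the product weight is
  harmonic. Its maximum and its minimum are both attained at the fully closed configuration, so it is
  constant, and the stationary weight inherits detailed balance.
\<close>

lemma stationary_balance:
  assumes stat: "\<And>y'. y' \<in> disconnected_configs v \<Longrightarrow> m y' = (\<Sum>y\<in>disconnected_configs v. m y * step_prob v y y')"
    and y: "y \<in> disconnected_configs v" and y': "y' \<in> disconnected_configs v"
  shows "m y * step_prob v y y' = m y' * step_prob v y' y"
proof -
  define g where "g y = m y / product_weight y" for y
  have harm: "g y = (\<Sum>x\<in>disconnected_configs v. step_prob v y x * g x)" if y: "y \<in> disconnected_configs v" for y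
  proof -
    have "g y = (\<Sum>x\<in>disconnected_configs v. m x * step_prob v x y / product_weight y)"
      using stat[OF y] by (simp add: g_def sum_divide_distrib)
    also have "\<dots> = (\<Sum>x\<in>disconnected_configs v. step_prob v y x * g x)"
    proof (rule sum.cong)
      fix x assume x: "x \<in> disconnected_configs v"
      have "step_prob v x y / product_weight y = step_prob v y x / product_weight x"
        using product_weight_balance[OF x y] product_weight_pos[of x] product_weight_pos[of y]
        by (simp add: field_simps)
      then show "m x * step_prob v x y / product_weight y = step_prob v y x * g x"
        by (simp add: g_def) (metis times_divide_eq_right mult.commute)
    qed simp
    finally show ?thesis .
  qed
  have ne: "disconnected_configs v \<noteq> {}" using y by auto
  define ymax where "ymax = arg_min_on (\<lambda>y. - g y) (disconnected_configs v)"
  define ymin where "ymin = arg_min_on g (disconnected_configs v)"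
  have mx: "ymax \<in> disconnected_configs v" "\<And>x. x \<in> disconnected_configs v \<Longrightarrow> g x \<le> g ymax"
    using arg_min_if_finite[OF finite_disconnected ne, of "\<lambda>y. - g y"] unfolding ymax_def by (auto simp: not_less)
  have mn: "ymin \<in> disconnected_configs v" "\<And>x. x \<in> disconnected_configs v \<Longrightarrow> g ymin \<le> g x"
    using arg_min_if_finite[OF finite_disconnected ne, of g] unfolding ymin_def by (auto simp: not_less)
  have "g (\<lambda>e\<in>edges_in \<Lambda>. False) = g ymax" by (rule harmonic_at_closed[OF harm mx])
  moreover have "- g (\<lambda>e\<in>edges_in \<Lambda>. False) = - g ymin"
    by (rule harmonic_at_closed[where g = "\<lambda>y. - g y"]) (use harm mn in \<open>auto simp: sum_negf\<close>)
  ultimately have "g ymin = g ymax" by simp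
  then have const: "g x = g ymax" if "x \<in> disconnected_configs v" for x
    using mx(2)[OF that] mn(2)[OF that] by simp
  have m: "m x = g ymax * product_weight x" if "x \<in> disconnected_configs v" for x
    using const[OF that] product_weight_pos[of x] by (simp add: g_def field_simps)
  show ?thesis using product_weight_balance[OF y y'] by (simp add: m y y' mult.assoc)
qed

end

locale stationary_box = noisy_box \<Lambda> M p for \<Lambda> :: "(real ^ 'd::finite) set" and M p +
  fixes v :: 'd and \<mu> :: "('d config \<times> 'd config) measure"
  assumes equilibrium: "equilibrium v \<Lambda> p \<mu>"
begin

abbreviation "states \<equiv> coupled_states v \<Lambda>"
abbreviation "\<Omega> \<equiv> disconnected_configs v"
abbreviation "Q \<equiv> \<mu> \<Otimes>\<^sub>M draws"

sublocale mu: prob_space \<mu> using equilibrium by (simp add: equilibrium_def)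
sublocale draws: prob_space draws by (rule prob_space_draws)
sublocale Q: pair_prob_space \<mu> draws ..

lemma sets_mu: "sets \<mu> = Pow states" and space_mu: "space \<mu> = states"
proof -
  show s: "sets \<mu> = Pow states" using equilibrium by (simp add: equilibrium_def)
  show "space \<mu> = states" using sets_eq_imp_space_eq[of \<mu> "count_space states"] s by simp
qed

definition marginal :: "'d config \<Rightarrow> real" where
  "marginal y = measure \<mu> {s \<in> states. snd s = y}"

lemma marginal_stationary:
  assumes "y' \<in> \<Omega>"
  shows "marginal y' = (\<Sum>y\<in>\<Omega>. marginal y * step_prob v y y')"
proof -
  interpret noise: prob_space "noise \<Lambda> p" by (rule prob_space_noise)
  interpret pair_prob_space \<mu> "noise \<Lambda> p" ..
  have sets_pair: "sets (\<mu> \<Otimes>\<^sub>M noise \<Lambda> p) = Pow (states \<times> (edges_in \<Lambda> \<times> UNIV))"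
  proof -
    have "sets (\<mu> \<Otimes>\<^sub>M noise \<Lambda> p) = sets (count_space states \<Otimes>\<^sub>M count_space (edges_in \<Lambda> \<times> (UNIV :: bool set)))"
      by (intro sets_pair_measure_cong) (auto simp: sets_mu sets_noise)
    also have "count_space states \<Otimes>\<^sub>M count_space (edges_in \<Lambda> \<times> (UNIV :: bool set)) =
        count_space (states \<times> (edges_in \<Lambda> \<times> UNIV))"
      by (rule pair_measure_count_space) (auto simp: finite_coupled_states finite_edges)
    finally show ?thesis by simp
  qed
  have space_pair: "space (\<mu> \<Otimes>\<^sub>M noise \<Lambda> p) = states \<times> (edges_in \<Lambda> \<times> UNIV)"
    by (simp add: space_pair_measure space_mu space_noise)
  have meas: "(\<lambda>(s, n). coupled_step v \<Lambda> n s) \<in> (\<mu> \<Otimes>\<^sub>M noise \<Lambda> p) \<rightarrow>\<^sub>M count_space states"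
    using coupled_step_in by (intro measurableI) (auto simp: sets_pair space_pair)
  have "marginal y' = measure (distr (\<mu> \<Otimes>\<^sub>M noise \<Lambda> p) (count_space states) (\<lambda>(s, n). coupled_step v \<Lambda> n s))
      {s \<in> states. snd s = y'}"
    using equilibrium by (simp add: equilibrium_def marginal_def)
  also have "\<dots> = measure (\<mu> \<Otimes>\<^sub>M noise \<Lambda> p)
      ((\<lambda>(s, n). coupled_step v \<Lambda> n s) -` {s \<in> states. snd s = y'} \<inter> space (\<mu> \<Otimes>\<^sub>M noise \<Lambda> p))"
    by (rule measure_distr[OF meas]) simp
  also have "(\<lambda>(s, n). coupled_step v \<Lambda> n s) -` {s \<in> states. snd s = y'} \<inter> space (\<mu> \<Otimes>\<^sub>M noise \<Lambda> p) =
      (\<Union>y\<in>\<Omega>. {s \<in> states. snd s = y} \<times> {n \<in> edges_in \<Lambda> \<times> UNIV. conditioned_step v \<Lambda> n y = y'})"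
  proof (rule set_eqI)
    fix x :: "('d config \<times> 'd config) \<times> (real ^ 'd) set \<times> bool"
    obtain s n where x: "x = (s, n)" by (cases x) blast
    have "x \<in> (\<lambda>(s, n). coupled_step v \<Lambda> n s) -` {s \<in> states. snd s = y'} \<inter> space (\<mu> \<Otimes>\<^sub>M noise \<Lambda> p) \<longleftrightarrow>
        s \<in> states \<and> n \<in> edges_in \<Lambda> \<times> UNIV \<and> coupled_step v \<Lambda> n s \<in> states \<and> snd (coupled_step v \<Lambda> n s) = y'"
      unfolding x space_pair Int_iff vimage_eq prod.case mem_Collect_eq by blast
    also have "\<dots> \<longleftrightarrow> s \<in> states \<and> n \<in> edges_in \<Lambda> \<times> UNIV \<and> conditioned_step v \<Lambda> n (snd s) = y'"
      unfolding snd_coupled_step using coupled_step_in by blast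
    also have "\<dots> \<longleftrightarrow> x \<in> (\<Union>y\<in>\<Omega>. {s \<in> states. snd s = y} \<times> {n \<in> edges_in \<Lambda> \<times> UNIV. conditioned_step v \<Lambda> n y = y'})"
      unfolding x using coupled_states_snd by blast
    finally show "x \<in> (\<lambda>(s, n). coupled_step v \<Lambda> n s) -` {s \<in> states. snd s = y'} \<inter> space (\<mu> \<Otimes>\<^sub>M noise \<Lambda> p) \<longleftrightarrow>
      x \<in> (\<Union>y\<in>\<Omega>. {s \<in> states. snd s = y} \<times> {n \<in> edges_in \<Lambda> \<times> UNIV. conditioned_step v \<Lambda> n y = y'})" .
  qed
  also have "measure (\<mu> \<Otimes>\<^sub>M noise \<Lambda> p) \<dots> = (\<Sum>y\<in>\<Omega>. measure (\<mu> \<Otimes>\<^sub>M noise \<Lambda> p)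
      ({s \<in> states. snd s = y} \<times> {n \<in> edges_in \<Lambda> \<times> UNIV. conditioned_step v \<Lambda> n y = y'}))"
    by (intro finite_measure_finite_Union finite_disconnected)
      (auto simp: sets_pair disjoint_family_on_def)
  also have "\<dots> = (\<Sum>y\<in>\<Omega>. marginal y * step_prob v y y')"
    unfolding marginal_def step_prob_def
    by (intro sum.cong refl measure_pair_Times noise.sigma_finite_measure_axioms) (auto simp: sets_mu sets_noise)
  finally show ?thesis .
qed

definition path_prob :: "nat \<Rightarrow> (nat \<Rightarrow> 'd config) \<Rightarrow> real" where
  "path_prob T ys = marginal (ys 0) * (\<Prod>i<T. step_prob v (ys i) (ys (Suc i)))"

definition ypath :: "('d config \<times> 'd config) \<times> (nat \<Rightarrow> (real ^ 'd) set \<times> bool) \<Rightarrow> nat \<Rightarrow> 'd config" where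
  "ypath x i = snd (coupled_state v \<Lambda> (fst x) (snd x) i)"

lemma space_Q: "space Q = states \<times> space draws"
  by (simp add: space_pair_measure space_mu)

lemma ypath_in: "x \<in> space Q \<Longrightarrow> ypath x i \<in> \<Omega>"
  using coupled_states_snd[OF coupled_state_in] by (auto simp: ypath_def space_Q)

text \<open>
  Since \<open>Y\<close> is autonomous, prescribing its path prescribes its initial value and, at each time, a set
  of draws computed from the prescribed path. The event is therefore a product set.
\<close>

lemma path_event:
  shows "{x \<in> space Q. \<forall>i\<le>T. ypath x i = ys i} \<in> sets Q" (is "?E \<in> _")
    and "measure Q {x \<in> space Q. \<forall>i\<le>T. ypath x i = ys i} = path_prob T ys"
proof -
  define A where "A u = {n \<in> edges_in \<Lambda> \<times> UNIV. conditioned_step v \<Lambda> n (ys (u - 1)) = ys u}" for u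
  have char: "(\<forall>i\<le>T. ypath (s, \<nu>) i = ys i) \<longleftrightarrow> snd s = ys 0 \<and> (\<forall>u\<in>{1..T}. \<nu> u \<in> A u)"
    if "s \<in> states" "\<nu> \<in> space draws" for s \<nu>
  proof -
    have nu: "\<nu> (Suc i) \<in> edges_in \<Lambda> \<times> UNIV" for i using that by (intro space_drawsD) simp_all
    show ?thesis
    proof (induction T)
      case 0
      then show ?case by (simp add: ypath_def)
    next
      case (Suc T)
      have "(\<forall>i\<le>Suc T. ypath (s, \<nu>) i = ys i) \<longleftrightarrow>
          (\<forall>i\<le>T. ypath (s, \<nu>) i = ys i) \<and> conditioned_step v \<Lambda> (\<nu> (Suc T)) (ypath (s, \<nu>) T) = ys (Suc T)"
        by (auto simp: le_Suc_eq ypath_def snd_coupled_step)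
      also have "\<dots> \<longleftrightarrow> (\<forall>i\<le>T. ypath (s, \<nu>) i = ys i) \<and> \<nu> (Suc T) \<in> A (Suc T)"
        using nu[of T] by (auto simp: A_def)
      also have "\<dots> \<longleftrightarrow> snd s = ys 0 \<and> (\<forall>u\<in>{1..Suc T}. \<nu> u \<in> A u)"
        unfolding Suc by (auto simp: atLeastAtMostSuc_conv)
      finally show ?case .
    qed
  qed
  have eq: "?E = {s \<in> states. snd s = ys 0} \<times> cylinder {1..T} A"
  proof (rule set_eqI)
    fix x :: "('d config \<times> 'd config) \<times> (nat \<Rightarrow> (real ^ 'd) set \<times> bool)"
    obtain s \<nu> where x: "x = (s, \<nu>)" by (cases x) blast
    show "x \<in> ?E \<longleftrightarrow> x \<in> {s \<in> states. snd s = ys 0} \<times> cylinder {1..T} A"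
      unfolding x space_Q cylinder_def using char[of s \<nu>] by blast
  qed
  have cyl: "cylinder {1..T} A \<in> sets draws"
    "measure draws (cylinder {1..T} A) = (\<Prod>u\<in>{1..T}. measure (noise \<Lambda> p) (A u))"
    by (intro cylinder; auto simp: A_def)+
  show "?E \<in> sets Q" unfolding eq using cyl(1) by (intro pair_measureI) (auto simp: sets_mu)
  have "measure Q ?E = measure \<mu> {s \<in> states. snd s = ys 0} * measure draws (cylinder {1..T} A)"
    unfolding eq using cyl(1) by (intro measure_pair_Times draws.sigma_finite_measure_axioms) (auto simp: sets_mu)
  also have "\<dots> = path_prob T ys"
    unfolding path_prob_def marginal_def cyl(2) step_prob_def A_def
    by (simp add: prod.atLeast1_atMost_eq)
  finally show "measure Q ?E = path_prob T ys" .
qed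

text \<open>
  Detailed balance moves the marginal from one end of the path to the other, one step at a time.
\<close>

lemma path_prob_rev: 
  assumes "\<And>i. i \<le> T \<Longrightarrow> ys i \<in> \<Omega>"
  shows "path_prob T (\<lambda>i. ys (T - i)) = path_prob T ys"
proof -
  have bal: "marginal y * step_prob v y y' = marginal y' * step_prob v y' y" if "y \<in> \<Omega>" "y' \<in> \<Omega>" for y y'
    using stationary_balance[of v marginal, OF marginal_stationary that] .
  have "marginal (ys n) * (\<Prod>i<n. step_prob v (ys (Suc i)) (ys i)) = marginal (ys 0) * (\<Prod>i<n. step_prob v (ys i) (ys (Suc i)))"
    if "n \<le> T" for n
    using that
  proof (induction n)
    case (Suc n)
    have "marginal (ys (Suc n)) * (\<Prod>i<Suc n. step_prob v (ys (Suc i)) (ys i)) =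
        (marginal (ys (Suc n)) * step_prob v (ys (Suc n)) (ys n)) * (\<Prod>i<n. step_prob v (ys (Suc i)) (ys i))"
      by simp
    also have "\<dots> = (marginal (ys n) * (\<Prod>i<n. step_prob v (ys (Suc i)) (ys i))) * step_prob v (ys n) (ys (Suc n))"
      using bal[of "ys (Suc n)" "ys n"] assms Suc.prems by simp
    also have "\<dots> = marginal (ys 0) * (\<Prod>i<Suc n. step_prob v (ys i) (ys (Suc i)))"
      using Suc by simp
    finally show ?case .
  qed simp
  from this[of T] have "path_prob T ys = marginal (ys T) * (\<Prod>i<T. step_prob v (ys (Suc i)) (ys i))"
    by (simp add: path_prob_def)
  also have "(\<Prod>i<T. step_prob v (ys (Suc i)) (ys i)) = (\<Prod>i<T. step_prob v (ys (T - i)) (ys (T - Suc i)))"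
    by (subst prod.nat_diff_reindex[symmetric]) (auto intro!: prod.cong simp: Suc_diff_Suc)
  finally show ?thesis by (simp add: path_prob_def)
qed

lemma path_predicate:
  assumes dep: "\<And>ys zs. (\<And>i. i \<le> T \<Longrightarrow> ys i = zs i) \<Longrightarrow> P ys = P zs"
  shows "{x \<in> space Q. P (ypath x)} \<in> sets Q"
    and "measure Q {x \<in> space Q. P (ypath x)} = (\<Sum>ys\<in>{ys \<in> {..T} \<rightarrow>\<^sub>E \<Omega>. P ys}. path_prob T ys)"
proof -
  define Y where "Y = {ys \<in> {..T} \<rightarrow>\<^sub>E \<Omega>. P ys}"
  define ev where "ev ys = {x \<in> space Q. \<forall>i\<le>T. ypath x i = ys i}" for ys
  have fin: "finite Y" unfolding Y_def using finite_disconnected by (simp add: finite_PiE)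
  have ev: "ev ys \<in> sets Q" "measure Q (ev ys) = path_prob T ys" for ys
    unfolding ev_def by (rule path_event)+
  have eq: "{x \<in> space Q. P (ypath x)} = (\<Union>ys\<in>Y. ev ys)"
  proof (intro equalityI subsetI)
    fix x assume x: "x \<in> {x \<in> space Q. P (ypath x)}"
    have "P (restrict (ypath x) {..T}) = P (ypath x)" by (rule dep) simp
    then have "restrict (ypath x) {..T} \<in> Y" using x ypath_in by (auto simp: Y_def)
    moreover have "x \<in> ev (restrict (ypath x) {..T})" using x by (auto simp: ev_def)
    ultimately show "x \<in> (\<Union>ys\<in>Y. ev ys)" by blast
  next
    fix x assume "x \<in> (\<Union>ys\<in>Y. ev ys)"
    then obtain ys where ys: "ys \<in> Y" "x \<in> space Q" "\<forall>i\<le>T. ypath x i = ys i" by (auto simp: ev_def)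
    then have "P (ypath x) = P ys" by (intro dep) auto
    then show "x \<in> {x \<in> space Q. P (ypath x)}" using ys by (auto simp: Y_def)
  qed
  show "{x \<in> space Q. P (ypath x)} \<in> sets Q" unfolding eq using fin ev by auto
  have "disjoint_family_on ev Y"
    unfolding disjoint_family_on_def
  proof (intro ballI impI)
    fix ys zs assume yz: "ys \<in> Y" "zs \<in> Y" "ys \<noteq> zs"
    then have "ys \<in> {..T} \<rightarrow>\<^sub>E \<Omega>" "zs \<in> {..T} \<rightarrow>\<^sub>E \<Omega>" by (auto simp: Y_def)
    then obtain i where "i \<le> T" "ys i \<noteq> zs i" using yz(3) PiE_ext by (metis atMost_iff)
    then show "ev ys \<inter> ev zs = {}" by (auto simp: ev_def)
  qed
  then have "measure Q (\<Union>ys\<in>Y. ev ys) = (\<Sum>ys\<in>Y. measure Q (ev ys))"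
    using fin ev by (intro Q.finite_measure_finite_Union) auto
  then show "measure Q {x \<in> space Q. P (ypath x)} = (\<Sum>ys\<in>{ys \<in> {..T} \<rightarrow>\<^sub>E \<Omega>. P ys}. path_prob T ys)"
    unfolding eq using ev(2) by (simp add: Y_def)
qed

lemma time_reversal:
  assumes dep: "\<And>ys zs. (\<And>i. i \<le> T \<Longrightarrow> ys i = zs i) \<Longrightarrow> P ys = P zs"
  shows "measure Q {x \<in> space Q. P (ypath x)} = measure Q {x \<in> space Q. P (\<lambda>i. ypath x (T - i))}"
proof -
  define rv where "rv ys = (\<lambda>i\<in>{..T}. ys (T - i))" for ys :: "nat \<Rightarrow> 'd config"
  have rv_P: "P (\<lambda>i. ys (T - i)) = P (rv ys)" for ys by (rule dep) (simp add: rv_def)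
  have rv_rv: "rv (rv ys) = ys" if "ys \<in> {..T} \<rightarrow>\<^sub>E \<Omega>" for ys
    using that by (auto simp: rv_def fun_eq_iff PiE_iff extensional_def)
  have rv_in: "rv ys \<in> {..T} \<rightarrow>\<^sub>E \<Omega>" if "ys \<in> {..T} \<rightarrow>\<^sub>E \<Omega>" for ys
    using that by (auto simp: rv_def PiE_iff)
  have rv_prob: "path_prob T (rv ys) = path_prob T ys" if "ys \<in> {..T} \<rightarrow>\<^sub>E \<Omega>" for ys
  proof -
    have "path_prob T (rv ys) = path_prob T (\<lambda>i. ys (T - i))" by (simp add: path_prob_def rv_def)
    also have "\<dots> = path_prob T ys" using that by (intro path_prob_rev) auto
    finally show ?thesis .
  qed
  have "measure Q {x \<in> space Q. P (\<lambda>i. ypath x (T - i))} =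
      (\<Sum>ys\<in>{ys \<in> {..T} \<rightarrow>\<^sub>E \<Omega>. P (\<lambda>i. ys (T - i))}. path_prob T ys)"
    by (rule path_predicate(2)[where P = "\<lambda>ys. P (\<lambda>i. ys (T - i))"]) (auto intro!: dep)
  also have "\<dots> = (\<Sum>ys\<in>{ys \<in> {..T} \<rightarrow>\<^sub>E \<Omega>. P ys}. path_prob T ys)"
    unfolding rv_P
    by (rule sum.reindex_bij_witness[where i = rv and j = rv]) (use rv_rv rv_in rv_prob in auto)
  also have "\<dots> = measure Q {x \<in> space Q. P (ypath x)}" by (rule path_predicate(2)[symmetric, OF dep])
  finally show ?thesis ..
qed

end

section \<open>The law of the process and the final estimate\<close>

text \<open>
  Straying depends on the configurations during the two windows only, so it is an event about
  finitely many times.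
\<close>

lemma strays_cong:
  assumes "\<And>i. i \<in> I \<union> J \<Longrightarrow> ys i = zs i"
  shows "strays v \<Lambda> l ys I J = strays v \<Lambda> l zs I J"
proof -
  have "pivotal v \<Lambda> (ys i) = pivotal v \<Lambda> (zs i)" if "i \<in> I \<union> J" for i using assms[OF that] by simp
  then show ?thesis unfolding strays_def by (intro bex_cong ball_cong conj_cong refl) auto
qed

lemma strays_comp:
  "strays v \<Lambda> l (\<lambda>i. ys (f i)) I J = strays v \<Lambda> l ys (f ` I) (f ` J)"
  unfolding strays_def by simp

context stationary_box
begin

lemma coupled_state_measurable:
  "(\<lambda>x. coupled_state v \<Lambda> (fst x) (snd x) t) \<in> Q \<rightarrow>\<^sub>M count_space states"
proof (induction t)
  case 0
  have "fst \<in> Q \<rightarrow>\<^sub>M \<mu>" by simp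
  also have "Q \<rightarrow>\<^sub>M \<mu> = Q \<rightarrow>\<^sub>M count_space states"
    by (rule measurable_cong_sets) (simp_all add: sets_mu)
  finally show ?case by simp
next
  case (Suc t)
  have "(\<lambda>x. snd x (Suc t)) \<in> Q \<rightarrow>\<^sub>M noise \<Lambda> p"
    by (rule measurable_compose[OF measurable_snd]) (simp add: draws_def)
  then have pair: "(\<lambda>x. (snd x (Suc t), coupled_state v \<Lambda> (fst x) (snd x) t)) \<in>
      Q \<rightarrow>\<^sub>M noise \<Lambda> p \<Otimes>\<^sub>M count_space states"
    using Suc by (rule measurable_Pair)
  have sets: "sets (noise \<Lambda> p \<Otimes>\<^sub>M count_space states) = Pow ((edges_in \<Lambda> \<times> UNIV) \<times> states)"
  proof -
    have "sets (noise \<Lambda> p \<Otimes>\<^sub>M count_space states) = sets (count_space (edges_in \<Lambda> \<times> (UNIV :: bool set)) \<Otimes>\<^sub>M count_space states)"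
      by (intro sets_pair_measure_cong) (auto simp: sets_noise)
    also have "count_space (edges_in \<Lambda> \<times> (UNIV :: bool set)) \<Otimes>\<^sub>M count_space states =
        count_space ((edges_in \<Lambda> \<times> UNIV) \<times> states)"
      by (rule pair_measure_count_space) (auto simp: finite_coupled_states finite_edges)
    finally show ?thesis by simp
  qed
  have "(\<lambda>(n, s). coupled_step v \<Lambda> n s) \<in> noise \<Lambda> p \<Otimes>\<^sub>M count_space states \<rightarrow>\<^sub>M count_space states"
  proof (rule measurableI)
    show "(\<lambda>(n, s). coupled_step v \<Lambda> n s) x \<in> space (count_space states)"
      if "x \<in> space (noise \<Lambda> p \<Otimes>\<^sub>M count_space states)" for x
      using that coupled_step_in by (auto simp: space_pair_measure space_noise simp del: coupled_step.simps)
    show "(\<lambda>(n, s). coupled_step v \<Lambda> n s) -` A \<inter> space (noise \<Lambda> p \<Otimes>\<^sub>M count_space states) \<in>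
        sets (noise \<Lambda> p \<Otimes>\<^sub>M count_space states)" for A
      unfolding sets by (auto simp: space_pair_measure space_noise)
  qed
  from measurable_compose[OF pair this] show ?case by simp
qed

lemma process_measurable:
  "(\<lambda>(s, \<nu>). coupled_state v \<Lambda> s \<nu>) \<in> Q \<rightarrow>\<^sub>M (\<Pi>\<^sub>M t\<in>UNIV. count_space states)"
proof (rule measurable_PiM_single')
  show "(\<lambda>x. (case x of (s, \<nu>) \<Rightarrow> coupled_state v \<Lambda> s \<nu>) t) \<in> Q \<rightarrow>\<^sub>M count_space states" for t
    using coupled_state_measurable[of t] by (simp add: split_def)
  show "(\<lambda>x t. (case x of (s, \<nu>) \<Rightarrow> coupled_state v \<Lambda> s \<nu>) t) \<in> space Q \<rightarrow> (\<Pi>\<^sub>E t\<in>UNIV. space (count_space states))"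
    using coupled_state_in by (auto simp: space_Q)
qed

lemma process_law_eq: "process_law v \<Lambda> p \<mu> = distr Q (\<Pi>\<^sub>M t\<in>UNIV. count_space states) (\<lambda>(s, \<nu>). coupled_state v \<Lambda> s \<nu>)"
  by (simp add: process_law_def draws_def)

lemma prob_space_process_law: "prob_space (process_law v \<Lambda> p \<mu>)"
  unfolding process_law_eq by (rule Q.prob_space_distr[OF process_measurable])

text \<open>
  A set outside the sigma-algebra has measure zero by convention, so the bound holds for every
  predicate.
\<close>

lemma process_law_prob_le:
  "measure (process_law v \<Lambda> p \<mu>) {\<xi> \<in> space (process_law v \<Lambda> p \<mu>). P (\<lambda>i. snd (\<xi> i))} \<le> b"
  if b: "0 \<le> b" and E: "E \<in> sets Q" "measure Q E \<le> b" "{x \<in> space Q. P (ypath x)} \<subseteq> E"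
proof (cases "{\<xi> \<in> space (process_law v \<Lambda> p \<mu>). P (\<lambda>i. snd (\<xi> i))} \<in> sets (process_law v \<Lambda> p \<mu>)")
  case True
  let ?A = "{\<xi> \<in> space (process_law v \<Lambda> p \<mu>). P (\<lambda>i. snd (\<xi> i))}"
  let ?f = "\<lambda>(s, \<nu>). coupled_state v \<Lambda> s \<nu>"
  have "measure (process_law v \<Lambda> p \<mu>) ?A = measure Q (?f -` ?A \<inter> space Q)"
    using True unfolding process_law_eq by (subst measure_distr[OF process_measurable]) simp_all
  also have "\<dots> \<le> measure Q E"
  proof (rule Q.finite_measure_mono[OF _ E(1)])
    show "?f -` ?A \<inter> space Q \<subseteq> E"
    proof
      fix x assume x: "x \<in> ?f -` ?A \<inter> space Q"
      then have "P (\<lambda>i. snd (?f x i))" by blast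
      moreover have "(\<lambda>i. snd (?f x i)) = ypath x" by (auto simp: ypath_def split_def)
      ultimately show "x \<in> E" using x E(3) by auto
    qed
  qed
  finally show ?thesis using E(2) by simp
next
  case False
  then show ?thesis using b by (simp add: measure_notin_sets)
qed

lemma strays_prob:
  assumes st: "s \<le> t" "t \<le> T" and l: "4 * real n + 2 \<le> l" "n \<ge> 1" and L: "L > 0" "L \<le> 2 * N" "T - t \<le> K * L"
  shows "measure Q {x \<in> space Q. strays v \<Lambda> l (ypath x) {t..T} {s..t}} \<le>
    real (N * (16 * CARD('d)\<^sup>2) ^ (n - 1)) * 2 ^ (n + K) * ((1 - 1 / N) ^ (t - s) + 12 * (1 - p)) ^ n"
proof -
  define X where "X = {\<nu> \<in> space draws. \<exists>gs bs. length gs = n \<and> distinct gs \<and> set gs \<subseteq> edges_in \<Lambda> \<and>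
       successively star_adj gs \<and> bs \<in> nonincreasing_lists n K \<and>
      (\<forall>i<n. \<exists>z\<in>{s..t + (bs ! i + 1) * L}. closing_certificate \<nu> s (t + bs ! i * L) (gs ! i) z)}"
  obtain C where C: "C \<in> sets draws" "X \<subseteq> C" "measure draws C \<le>
      real (N * (16 * CARD('d)\<^sup>2) ^ (n - 1)) * 2 ^ (n + K) * ((1 - 1 / N) ^ (t - s) + 12 * (1 - p)) ^ n"
    using strays_draws_prob[OF st(1) L(2) l(2), of K] unfolding X_def by blast
  have "{x \<in> space Q. strays v \<Lambda> l (ypath x) {t..T} {s..t}} \<subseteq> states \<times> C"
  proof
    fix x assume x: "x \<in> {x \<in> space Q. strays v \<Lambda> l (ypath x) {t..T} {s..t}}"
    then have in_space: "fst x \<in> states" "snd x \<in> space draws" by (auto simp: space_Q)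
    have yp: "ypath x = (\<lambda>i. snd (coupled_state v \<Lambda> (fst x) (snd x) i))" by (rule ext) (simp add: ypath_def)
    have "strays v \<Lambda> l (\<lambda>i. snd (coupled_state v \<Lambda> (fst x) (snd x) i)) {t..T} {s..t}"
    proof -
      have "strays v \<Lambda> l (ypath x) {t..T} {s..t}" using x by blast
      then show ?thesis unfolding yp .
    qed
    from strays_certified_path[OF coupled_state_conditioned_path[OF in_space] st this l L(1,3)]
    have "snd x \<in> X" unfolding X_def using in_space by blast
    then show "x \<in> states \<times> C" using in_space C(2) by (auto simp: mem_Times_iff)
  qed
  then have "measure Q {x \<in> space Q. strays v \<Lambda> l (ypath x) {t..T} {s..t}} \<le> measure Q (states \<times> C)"
    using C by (intro Q.finite_measure_mono pair_measureI) (auto simp: sets_mu)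
  also have "\<dots> = measure \<mu> states * measure draws C"
    using C by (intro measure_pair_Times draws.sigma_finite_measure_axioms) (auto simp: sets_mu)
  also have "measure \<mu> states = 1" using mu.prob_space by (simp add: space_mu)
  finally show ?thesis using C(3) by simp
qed

text \<open>
  Reversing the time interval from 0 to \<open>t + a\<close> puts the quiet window first, at the times from 0 to
  \<open>a\<close>, and the other one from \<open>a\<close> to \<open>2 * a\<close>; this is the order covered by \<open>strays_prob\<close>.
\<close>

lemma strays_prob_reversed:
  assumes "a \<le> t" and l: "4 * real n + 2 \<le> l" "n \<ge> 1" and L: "L > 0" "L \<le> 2 * N" "a \<le> K * L"
  shows "measure Q {x \<in> space Q. strays v \<Lambda> l (ypath x) {t - a..t} {t..t + a}} \<le>
    real (N * (16 * CARD('d)\<^sup>2) ^ (n - 1)) * 2 ^ (n + K) * ((1 - 1 / N) ^ a + 12 * (1 - p)) ^ n"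
proof -
  define T where "T = t + a"
  have img: "(\<lambda>i. T - i) ` {t - a..t} = {a..2 * a}" "(\<lambda>i. T - i) ` {t..t + a} = {0..a}"
  proof -
    have "(\<lambda>i. T - i) ` {i..j} = {T - j..T - i}" if "i \<le> T" "j \<le> T" for i j
    proof (intro equalityI subsetI)
      fix k assume "k \<in> {T - j..T - i}"
      then show "k \<in> (\<lambda>i. T - i) ` {i..j}" using that by (intro image_eqI[of _ _ "T - k"]) auto
    qed auto
    then show "(\<lambda>i. T - i) ` {t - a..t} = {a..2 * a}" "(\<lambda>i. T - i) ` {t..t + a} = {0..a}"
      using \<open>a \<le> t\<close> by (simp_all add: T_def)
  qed
  have "measure Q {x \<in> space Q. strays v \<Lambda> l (ypath x) {t - a..t} {t..t + a}} =
      measure Q {x \<in> space Q. strays v \<Lambda> l (\<lambda>i. ypath x (T - i)) {t - a..t} {t..t + a}}"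
    by (rule time_reversal, rule strays_cong) (auto simp: T_def)
  also have "\<dots> = measure Q {x \<in> space Q. strays v \<Lambda> l (ypath x) {a..2 * a} {0..a}}"
    unfolding strays_comp img ..
  also have "\<dots> \<le> real (N * (16 * CARD('d)\<^sup>2) ^ (n - 1)) * 2 ^ (n + K) * ((1 - 1 / N) ^ (a - 0) + 12 * (1 - p)) ^ n"
    by (rule strays_prob) (use l L in auto)
  finally show ?thesis by simp
qed

lemma hausdorff_prob:
  assumes "a \<le> t" and l: "4 * real n + 2 \<le> l" "n \<ge> 1" and L: "L > 0" "L \<le> 2 * N" "a \<le> K * L"
  shows "measure (process_law v \<Lambda> p \<mu>) {\<xi> \<in> space (process_law v \<Lambda> p \<mu>).
      ereal l \<le> hausdorff_inner \<Lambda> l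
            (edges_support (\<Union>r\<in>{t - a..t}. pivotal v \<Lambda> (snd (\<xi> r))))
            (edges_support (\<Union>r\<in>{t..t + a}. pivotal v \<Lambda> (snd (\<xi> r))))} \<le>
     2 * (real (N * (16 * CARD('d)\<^sup>2) ^ (n - 1)) * 2 ^ (n + K) * ((1 - 1 / N) ^ a + 12 * (1 - p)) ^ n)"
    (is "_ \<le> 2 * ?b")
proof -
  define E1 where "E1 = {x \<in> space Q. strays v \<Lambda> l (ypath x) {t - a..t} {t..t + a}}"
  define E2 where "E2 = {x \<in> space Q. strays v \<Lambda> l (ypath x) {t..t + a} {t - a..t}}"
  have sets: "E1 \<in> sets Q" "E2 \<in> sets Q"
    unfolding E1_def E2_def by (rule path_predicate(1)[of "t + a"], rule strays_cong, auto)+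
  have E1: "measure Q E1 \<le> ?b" unfolding E1_def by (rule strays_prob_reversed[OF assms])
  have "measure Q E2 \<le> real (N * (16 * CARD('d)\<^sup>2) ^ (n - 1)) * 2 ^ (n + K) * ((1 - 1 / N) ^ (t - (t - a)) + 12 * (1 - p)) ^ n"
    unfolding E2_def by (rule strays_prob) (use assms in auto)
  then have E2: "measure Q E2 \<le> ?b" using \<open>a \<le> t\<close> by simp
  have "measure Q (E1 \<union> E2) \<le> 2 * ?b"
    using measure_Un_le[OF sets] E1 E2 by simp
  moreover have "0 \<le> ?b" using E1 measure_nonneg order_trans by blast
  moreover have "{x \<in> space Q. ereal l \<le> hausdorff_inner \<Lambda> l
            (edges_support (\<Union>r\<in>{t - a..t}. pivotal v \<Lambda> (ypath x r)))
            (edges_support (\<Union>r\<in>{t..t + a}. pivotal v \<Lambda> (ypath x r)))} \<subseteq> E1 \<union> E2"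
    using hausdorff_inner_large_strays l unfolding E1_def E2_def by fastforce
  ultimately show ?thesis using sets
    by (intro process_law_prob_le[where P = "\<lambda>ys. ereal l \<le> hausdorff_inner \<Lambda> l
            (edges_support (\<Union>r\<in>{t - a..t}. pivotal v \<Lambda> (ys r)))
            (edges_support (\<Union>r\<in>{t..t + a}. pivotal v \<Lambda> (ys r)))" and E = "E1 \<union> E2"]) auto
qed

end

text \<open>
  The quiet window has about \<open>c * L * u\<close> steps and there are at most \<open>d * L\<close> edges, where \<open>u = ln L\<close>,
  so an edge is missed with probability about \<open>exp (- c * u / d)\<close>. The lower bounds on \<open>u\<close> and \<open>c\<close>
  make \<open>c * u / d\<close> at least \<open>18 * d\<close>, which beats the entropy of the paths.
\<close>

lemma no_draw_factor_le:
  fixes d N a :: nat and c L u :: real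
  assumes d: "d \<ge> 2" and c: "c \<ge> 3" and L: "L \<ge> 1" and u: "u \<ge> 2 * (real d)\<^sup>2 * c"
    and N: "N \<ge> 1" "real N \<le> real d * L" and a: "c * L * u - 1 \<le> real a"
  shows "(1 - 1 / real N) ^ a \<le> exp (- 17 * real d)"
proof -
  have "18 * (real d)\<^sup>2 \<le> c * u"
  proof -
    have "18 * (real d)\<^sup>2 = 3 * (2 * (real d)\<^sup>2 * 3)" by simp
    also have "\<dots> \<le> c * (2 * (real d)\<^sup>2 * c)" using c by (intro mult_mono) auto
    also have "\<dots> \<le> c * u" using u c by (intro mult_left_mono) auto
    finally show ?thesis .
  qed
  then have "18 * (real d)\<^sup>2 * L \<le> c * L * u"
    using mult_right_mono[of "18 * (real d)\<^sup>2" "c * u" L] L by (simp add: mult_ac)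
  moreover have "1 \<le> (real d)\<^sup>2 * L"
    using d L by (metis mult_mono one_le_power of_nat_1 of_nat_mono mult_1 Suc_leD numeral_2_eq_2 One_nat_def zero_le_one zero_le_power of_nat_0_le_iff)
  ultimately have "17 * real d * (real d * L) \<le> real a" using a by (simp add: power2_eq_square)
  moreover have "17 * real d * real N \<le> 17 * real d * (real d * L)" using N by (intro mult_left_mono) auto
  ultimately have "17 * real d \<le> real a / real N" using N by (simp add: field_simps)
  have "1 - 1 / real N \<le> exp (- 1 / real N)" using exp_ge_add_one_self[of "- 1 / real N"] by simp
  then have "(1 - 1 / real N) ^ a \<le> exp (- 1 / real N) ^ a" using N by (intro power_mono) auto
  also have "\<dots> = exp (- (real a / real N))" by (simp flip: exp_of_nat_mult)
  also have "\<dots> \<le> exp (- 17 * real d)" using \<open>17 * real d \<le> real a / real N\<close> by simp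
  finally show ?thesis .
qed

text \<open>
  Each edge of the path costs at most \<open>exp (- 17 * d)\<close> up to a factor 2, while its choice and that of
  its block contribute a factor polynomial in \<open>d\<close>; the net gain per edge is at least
  \<open>exp (- 11 * d)\<close>. With \<open>n\<close> of order \<open>d * c * u / 2\<close> the product is a power of \<open>L = exp u\<close> that
  absorbs the number \<open>N\<close> of starting edges.
\<close>

lemma entropy_energy_bound:
  fixes d N n K :: nat and c L u \<theta> :: real
  assumes d: "d \<ge> 2" and c: "c \<ge> 3" and L: "L = exp u" and u: "u \<ge> 2 * (real d)\<^sup>2 * c"
    and N: "real N \<le> real d * L" and n: "real d * c * u / 2 - 3 / 2 \<le> real n"
    and K: "real K \<le> c * u + 1" and \<theta>: "0 \<le> \<theta>" "\<theta> \<le> 2 * exp (- 17 * real d)"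
  shows "2 * (real (N * (16 * d\<^sup>2) ^ (n - 1)) * 2 ^ (n + K) * \<theta> ^ n) \<le> exp (- (c - 3) * u)"
proof -
  have d2: "real d \<ge> 2" using d by simp
  have dd: "(real d)\<^sup>2 \<ge> 2 * real d" using d2 by (simp add: power2_eq_square)
  have u_pos: "u \<ge> 12 * real d"
  proof -
    have "12 * real d \<le> 2 * (real d)\<^sup>2 * 3" using dd by simp
    also have "\<dots> \<le> 2 * (real d)\<^sup>2 * c" using c by (intro mult_left_mono) auto
    finally show ?thesis using u by linarith
  qed
  have "c * u * 2 \<le> c * u * real d" using c u_pos d2 by (intro mult_left_mono) auto
  then have "real K \<le> real n + 5 / 2" using K n by (simp add: mult_ac)
  then have "K \<le> n + 3" by linarith
  have e1: "real d \<le> exp (real d)" using exp_ge_add_one_self[of "real d"] by linarith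
  have e2: "(2::real) \<le> exp 1" using exp_ge_add_one_self[of 1] by simp
  have pow2: "(2::real) ^ k \<le> exp (real k)" for k
    using power_mono[OF e2, of k] by (simp flip: exp_of_nat_mult)
  \<comment> \<open>The factors 4 and \<open>16 * d\<^sup>2\<close> count blocks and neighbours.\<close>
  have base: "4 * (16 * (real d)\<^sup>2) * \<theta> \<le> exp (- 11 * real d)"
  proof -
    have "4 * (16 * (real d)\<^sup>2) * \<theta> \<le> 4 * (16 * (real d)\<^sup>2) * (2 * exp (- 17 * real d))"
      using \<theta> by (intro mult_left_mono) auto
    also have "\<dots> = 2 ^ 7 * (real d)\<^sup>2 * exp (- 17 * real d)" by simp
    also have "\<dots> \<le> exp (4 * real d) * exp (real d) ^ 2 * exp (- 17 * real d)"
    proof (intro mult_right_mono mult_mono power_mono e1)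
      have "(2::real) ^ 7 \<le> exp 7" using pow2[of 7] by simp
      also have "\<dots> \<le> exp (4 * real d)" using d2 by simp
      finally show "(2::real) ^ 7 \<le> exp (4 * real d)" .
    qed auto
    also have "\<dots> = exp (- 11 * real d)" by (simp flip: exp_add exp_of_nat_mult add: power2_eq_square)
    finally show ?thesis .
  qed
  have "2 * (real (N * (16 * d\<^sup>2) ^ (n - 1)) * 2 ^ (n + K) * \<theta> ^ n) =
      2 * (real N * (16 * (real d)\<^sup>2) ^ (n - 1) * 2 ^ (n + K) * \<theta> ^ n)" by simp
  also have "\<dots> \<le> 2 * ((real d * L) * (16 * (real d)\<^sup>2) ^ n * 2 ^ (n + (n + 3)) * \<theta> ^ n)"
  proof (intro mult_left_mono mult_right_mono mult_mono power_increasing N)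
    have "1 \<le> (real d)\<^sup>2" using d2 by (intro one_le_power) simp
    then show "1 \<le> 16 * (real d)\<^sup>2" by simp
  qed (use \<theta> L \<open>K \<le> n + 3\<close> in auto)
  also have "\<dots> = (2 ^ 4 * real d) * L * (4 * (16 * (real d)\<^sup>2) * \<theta>) ^ n"
  proof -
    have four: "(4::real) ^ n = 2 ^ n * 2 ^ n" by (simp flip: power_mult_distrib)
    show ?thesis by (simp only: power_mult_distrib power_add four) simp
  qed
  also have "\<dots> \<le> (exp (2 * real d) * exp (real d)) * exp u * exp (- 11 * real d) ^ n"
  proof (intro mult_mono power_mono base e1)
    have "(2::real) ^ 4 \<le> exp 4" using pow2[of 4] by simp
    also have "\<dots> \<le> exp (2 * real d)" using d2 by simp
    finally show "(2::real) ^ 4 \<le> exp (2 * real d)" .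
  qed (use \<theta> L in auto)
  also have "\<dots> = exp (3 * real d + u - 11 * real d * real n)"
    by (simp flip: exp_add exp_of_nat_mult add: algebra_simps)
  also have "\<dots> \<le> exp (- (c - 3) * u)"
  proof -
    have "11 * real d * real n \<ge> 11 * real d * (real d * c * u / 2 - 3 / 2)"
      using n by (intro mult_left_mono) auto
    moreover have "11 * real d * (real d * c * u / 2 - 3 / 2) = 11 / 2 * ((real d)\<^sup>2 * (c * u)) - 33 / 2 * real d"
      by (simp add: algebra_simps power2_eq_square)
    moreover have "(real d)\<^sup>2 * (c * u) \<ge> 4 * (c * u)"
      using dd d2 c u_pos by (intro mult_right_mono) auto
    moreover have "c * u \<ge> 3 * u" using c u_pos by (intro mult_right_mono) auto
    ultimately have "3 * real d + u - 11 * real d * real n \<le> 3 * u - c * u"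
      using u_pos d2 by linarith
    then show ?thesis by (simp add: algebra_simps)
  qed
  finally show ?thesis .
qed

theorem theorem1p5:
  assumes "CARD('d::finite) \<ge> 2"
  shows "\<exists>p0<1. \<forall>p c. \<forall>(v::'d) (\<Lambda>::(real ^ 'd) set) \<mu> (t::nat).
    0 < p \<longrightarrow> p0 \<le> p \<longrightarrow> p < 1 \<longrightarrow> 1 \<le> c \<longrightarrow>
    centred_box \<Lambda> \<longrightarrow>
    real (box_card \<Lambda>) \<ge> exp (2 * (real CARD('d))\<^sup>2 * c) \<longrightarrow>
    real t \<ge> c * real (box_card \<Lambda>) * ln (real (box_card \<Lambda>)) \<longrightarrow>
    equilibrium v \<Lambda> p \<mu> \<longrightarrow>
    (let \<tau> = c * real (box_card \<Lambda>) * ln (real (box_card \<Lambda>));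
         l = 2 * real CARD('d) * c * ln (real (box_card \<Lambda>))
     in \<P>(\<xi> in process_law v \<Lambda> p \<mu>.
          hausdorff_inner \<Lambda> l
            (edges_support (\<Union>r\<in>{r. real t - \<tau> \<le> real r \<and> r \<le> t}. pivotal v \<Lambda> (snd (\<xi> r))))
            (edges_support (\<Union>s\<in>{s. t \<le> s \<and> real s \<le> real t + \<tau>}. pivotal v \<Lambda> (snd (\<xi> s))))
          \<ge> ereal l)
        \<le> 1 / real (box_card \<Lambda>) powr (c - 3))"
proof (rule exI[of _ "1 - exp (- 17 * real CARD('d)) / 12"], intro conjI allI impI)
  show "1 - exp (- 17 * real CARD('d)) / 12 < 1" by simp
  fix p c :: real and v :: 'd and \<Lambda> :: "(real ^ 'd) set" and \<mu> and t :: nat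
  assume p: "0 < p" "1 - exp (- 17 * real CARD('d)) / 12 \<le> p" "p < 1" and c1: "1 \<le> c"
    and box: "centred_box \<Lambda>" and card: "exp (2 * (real CARD('d))\<^sup>2 * c) \<le> real (box_card \<Lambda>)"
    and t: "c * real (box_card \<Lambda>) * ln (real (box_card \<Lambda>)) \<le> real t" and eq: "equilibrium v \<Lambda> p \<mu>"
  define d where "d = CARD('d)"
  define L where "L = real (box_card \<Lambda>)"
  define u where "u = ln L"
  define l where "l = 2 * real d * c * u"
  define \<tau> where "\<tau> = c * L * u"
  define a where "a = nat \<lfloor>\<tau>\<rfloor>"
  obtain M where "lattice_box \<Lambda> M" using centred_box_lattice_box[OF box assms] by blast
  then interpret lattice_box \<Lambda> M .
  have "stationary_box \<Lambda> M p v \<mu>"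
    using p(1,3) eq by unfold_locales
  then interpret stationary_box \<Lambda> M p v \<mu> .
  have d: "d \<ge> 2" using assms by (simp add: d_def)
  have L_ge: "exp (2 * (real d)\<^sup>2 * c) \<le> L" using card by (simp add: L_def d_def)
  have "0 \<le> 2 * (real d)\<^sup>2 * c" using c1 by simp
  then have "1 \<le> exp (2 * (real d)\<^sup>2 * c)" by simp
  then have L1: "1 \<le> L" using L_ge by linarith
  have u: "2 * (real d)\<^sup>2 * c \<le> u" using L_ge L1 by (simp add: u_def ln_ge_iff)
  then have u0: "0 \<le> u" using \<open>0 \<le> 2 * (real d)\<^sup>2 * c\<close> by linarith
  have Lu: "L = exp u" using L1 by (simp add: u_def)
  have \<tau>0: "0 \<le> \<tau>" using c1 L1 u0 by (simp add: \<tau>_def)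
  have a: "real a \<le> \<tau>" "\<tau> - 1 \<le> real a" using \<tau>0 by (auto simp: a_def)
  have "a \<le> t" using a(1) t by (simp add: \<tau>_def L_def u_def)
  have I: "{r. real t - \<tau> \<le> real r \<and> r \<le> t} = {t - a..t}"
  proof (intro equalityI subsetI)
    fix r assume r: "r \<in> {r. real t - \<tau> \<le> real r \<and> r \<le> t}"
    then have "real (t - r) \<le> \<tau>" by (simp add: of_nat_diff)
    then have "int (t - r) \<le> \<lfloor>\<tau>\<rfloor>" by (simp add: le_floor_iff)
    then show "r \<in> {t - a..t}" using r by (auto simp: a_def)
  next
    fix r assume r: "r \<in> {t - a..t}"
    then have "t \<le> r + a" by simp linarith
    then have "real t \<le> real r + real a" by linarith
    then show "r \<in> {r. real t - \<tau> \<le> real r \<and> r \<le> t}" using r a(1) by auto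
  qed
  have J: "{s. t \<le> s \<and> real s \<le> real t + \<tau>} = {t..t + a}"
  proof (intro equalityI subsetI)
    fix r assume r: "r \<in> {s. t \<le> s \<and> real s \<le> real t + \<tau>}"
    then have "real (r - t) \<le> \<tau>" by (simp add: of_nat_diff)
    then have "int (r - t) \<le> \<lfloor>\<tau>\<rfloor>" by (simp add: le_floor_iff)
    then show "r \<in> {t..t + a}" using r by (auto simp: a_def)
  next
    fix r assume r: "r \<in> {t..t + a}"
    then have "real r \<le> real t + real a" by simp
    then show "r \<in> {s. t \<le> s \<and> real s \<le> real t + \<tau>}" using r a(1) by auto
  qed
  have main: "measure (process_law v \<Lambda> p \<mu>) {\<xi> \<in> space (process_law v \<Lambda> p \<mu>).
      ereal l \<le> hausdorff_inner \<Lambda> l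
            (edges_support (\<Union>r\<in>{t - a..t}. pivotal v \<Lambda> (snd (\<xi> r))))
            (edges_support (\<Union>r\<in>{t..t + a}. pivotal v \<Lambda> (snd (\<xi> r))))} \<le> 1 / L powr (c - 3)"
    (is "measure _ ?A \<le> _")
  \<comment> \<open>For \<open>c \<le> 3\<close> the right-hand side is at least 1.\<close>
  proof (cases "c \<le> 3")
    case True
    have "measure (process_law v \<Lambda> p \<mu>) ?A \<le> 1"
      using prob_space.prob_le_1[OF prob_space_process_law] .
    also have "1 \<le> 1 / L powr (c - 3)"
      using True L1 powr_mono[of "c - 3" 0 L] by (simp add: field_simps)
    finally show ?thesis .
  next
    case False
    \<comment> \<open>The largest \<open>n\<close> with \<open>4 * n + 2 \<le> l\<close>.\<close>
    define n where "n = nat \<lfloor>l / 4 - 1 / 2\<rfloor>"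
    \<comment> \<open>The number of blocks of \<open>\<bar>\<Lambda>\<bar>\<close> steps that cover a window.\<close>
    define K where "K = nat \<lceil>c * u\<rceil>"
    define \<theta> where "\<theta> = (1 - 1 / real N) ^ a + 12 * (1 - p)"
    have "6 * real d * real d \<le> 2 * (real d)\<^sup>2 * c" using False by (simp add: power2_eq_square mult_mono)
    moreover have "4 \<le> real d * real d" using d mult_mono[of 2 "real d" 2 "real d"] by simp
    ultimately have "24 \<le> u" using u by linarith
    then have "2 * 3 * 24 \<le> real d * c * u" using False d by (intro mult_mono) auto
    then have l: "l \<ge> 6" unfolding l_def by linarith
    have n: "real n \<le> l / 4 - 1 / 2" "l / 4 - 3 / 2 \<le> real n" "n \<ge> 1"
      using l unfolding n_def by linarith+
    have "l / 4 = real d * c * u / 2" by (simp add: l_def)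
    then have n_ge: "real d * c * u / 2 - 3 / 2 \<le> real n" using n(2) by linarith
    have "real N \<le> real d * L" using card_edges_le by (simp add: d_def L_def flip: of_nat_mult)
    have "real a \<le> real K * L"
    proof -
      have "c * u \<le> real K" by (simp add: K_def real_nat_ceiling_ge)
      then have "c * u * L \<le> real K * L" using L1 by (intro mult_right_mono) auto
      then show ?thesis using a(1) by (simp add: \<tau>_def mult_ac)
    qed
    then have aK: "a \<le> K * box_card \<Lambda>" unfolding L_def of_nat_mult[symmetric] of_nat_le_iff .
    have "real K \<le> c * u + 1" using u0 c1 by (simp add: K_def of_nat_nat)
    have "(1 - 1 / real N) ^ a \<le> exp (- 17 * real d)"
      by (rule no_draw_factor_le[of d c L u]) (use d False L1 u N_ge_2 \<open>real N \<le> real d * L\<close> a(2) in \<open>auto simp: \<tau>_def\<close>)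
    then have \<theta>: "\<theta> \<le> 2 * exp (- 17 * real d)" using p(2) by (simp add: \<theta>_def d_def)
    have "measure (process_law v \<Lambda> p \<mu>) ?A \<le>
        2 * (real (N * (16 * CARD('d)\<^sup>2) ^ (n - 1)) * 2 ^ (n + K) * \<theta> ^ n)"
      unfolding \<theta>_def
      by (rule hausdorff_prob[OF \<open>a \<le> t\<close>, where L = "box_card \<Lambda>"])
        (use n box_card_le aK L1 in \<open>auto simp: L_def\<close>)
    also have "\<dots> \<le> exp (- (c - 3) * u)"
      unfolding d_def[symmetric]
      by (rule entropy_energy_bound[of d c L u])
        (use d False Lu u \<open>real N \<le> real d * L\<close> n_ge \<open>real K \<le> c * u + 1\<close> \<theta> N_ge_2 p in \<open>simp_all add: \<theta>_def\<close>)
    also have "\<dots> = 1 / L powr (c - 3)"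
      using L1 by (simp add: powr_def u_def exp_minus field_simps flip: exp_add)
    finally show ?thesis .
  qed
  show "let \<tau> = c * real (box_card \<Lambda>) * ln (real (box_card \<Lambda>));
         l = 2 * real CARD('d) * c * ln (real (box_card \<Lambda>))
     in \<P>(\<xi> in process_law v \<Lambda> p \<mu>.
          hausdorff_inner \<Lambda> l
            (edges_support (\<Union>r\<in>{r. real t - \<tau> \<le> real r \<and> r \<le> t}. pivotal v \<Lambda> (snd (\<xi> r))))
            (edges_support (\<Union>s\<in>{s. t \<le> s \<and> real s \<le> real t + \<tau>}. pivotal v \<Lambda> (snd (\<xi> s))))
          \<ge> ereal l)
        \<le> 1 / real (box_card \<Lambda>) powr (c - 3)"
    using main unfolding Let_def I[unfolded \<tau>_def L_def u_def] J[unfolded \<tau>_def L_def u_def] l_def u_def L_def d_def .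
qed

end
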